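(* For plane curves of degree $d$ ($d\ge 0$) marked by $n$ points, the cone $\Lambda(\mathcal{C}_{n,d})$ is $$\Big\{(\gamma,w_1,\dots,w_n)\in\mathbb{Q}^{n+1}\ \Big|\ w_i\le \frac{W+\gamma(2d-3)}{3},\ \ w_i\le\frac{W+\gamma(d-2)}{2},\ \ w_i+w_j\le\frac{2W+\gamma d}{3},\ \ 0<w_i,\ \ 0<\gamma\Big\},$$ where $W=\sum_{k=1}^n w_k$ denotes the total weight of the points, and the inequalities are imposed for all $i\in\{1,\dots,n\}$ and, in the third family, for all pairs of distinct indices $i,j\in\{1,\dots,n\}$.
   Context: Work over $\mathbb{C}$. $\mathcal{C}_{n,d}\subset \mathbb{P}(\Gamma(\mathbb{P}^2,\mathcal{O}(d)))\times(\mathbb{P}^2)^n$ is the closed subvariety of tuples $(C,p_1,\dots,p_n)$ where $C=\{f=0\}$ is a plane curve of degree $d$ (possibly singular, reducible or non-reduced) and each $p_i$ is a point of $C$ (points may coincide). $SL(3)$ acts by $g\cdot(C,p_1,\dots,p_n)=(g\cdot C,g\cdot p_1,\dots,g\cdot p_n)$. A vector $\mathbf{w}=(\gamma,w_1,\dots,w_n)\in\mathbb{Q}^{n+1}$ corresponds to the class of the line bundle $L_{\mathbf w}$ obtained, after clearing denominators, by restricting $\mathcal{O}(\gamma)\boxtimes\mathcal{O}(w_1)\boxtimes\cdots\boxtimes\mathcal{O}(w_n)$ to $\mathcal{C}_{n,d}$, with its unique $SL(3)$-linearization. A point $x$ is $L$-semi-stable if for some $m>0$ there is an $SL(3)$-invariant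 section $s$ of $L^{\otimes m}$ with $s(x)\ne0$. The $SL(3)$-ample cone is the set of classes in $NS^{SL(3)}(\mathcal{C}_{n,d})_{\mathbb{Q}}$, the rational Néron–Severi group of $SL(3)$-linearized line bundles up to $SL(3)$-algebraic equivalence, of ample $SL(3)$-linearized line bundles $L$ for which the semi-stable locus $\mathcal{C}_{n,d}^{ss}(L)$ is non-empty. $\Lambda(\mathcal{C}_{n,d})$ is the intersection of the $SL(3)$-ample cone with the subspace of classes generated by restrictions of line bundles on $\mathbb{P}(\Gamma(\mathbb{P}^2,\mathcal{O}(d)))\times(\mathbb{P}^2)^n$, regarded as a subset of $\mathbb{Q}^{n+1}$ with coordinates $(\gamma,w_1,\dots,w_n)$.
   Formalization: Proved for d ≥ 2 (all n), and for d ≤ 1 when n is 1, 2 or 3. The other cases fail: for d = 1, or d = 0 with n ≥ 1, the cone is empty, yet (1/3,1,…,1) satisfies the inequalities if n ≥ 4 or (d,n) = (1,0); for d = n = 0 the variety is a point and γ is not determined by the class. *)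

theory Defs
  imports "HOL-Analysis.Analysis"
begin

text \<open>
  Everything is written on the affine multicone over the incidence variety: a point
  \<open>(C, p\<^sub>1, \<dots>, p\<^sub>n)\<close> is represented by homogeneous coordinates \<open>(f, p)\<close>, with \<open>f\<close> a nonzero
  ternary form of degree \<open>d\<close> and \<open>p i \<in> \<complex>\<^sup>3 - {0}\<close>, up to rescaling each of these \<open>n + 1\<close> entries.
  A section of a line bundle \<open>O(a) \<boxtimes> O(b\<^sub>1) \<boxtimes> \<dots> \<boxtimes> O(b\<^sub>n)\<close> restricted to the incidence variety is a
  regular function on the multicone of multidegree \<open>(a, b\<^sub>1, \<dots>, b\<^sub>n)\<close>.
\<close>

type_synonym form = "complex ^ 3 \<Rightarrow> complex"
type_synonym mcurve = "form \<times> (nat \<Rightarrow> complex ^ 3)"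

definition forms :: "nat \<Rightarrow> form set" where
  "forms d = {f. \<exists>c. f = (\<lambda>v. \<Sum>i\<le>d. \<Sum>j\<le>d - i. c i j * (v $ 1) ^ i * (v $ 2) ^ j * (v $ 3) ^ (d - i - j))}"

definition multicone :: "nat \<Rightarrow> nat \<Rightarrow> mcurve set" where
  "multicone n d = {(f, p). f \<in> forms d \<and> f \<noteq> (\<lambda>_. 0) \<and>
     p \<in> {1..n} \<rightarrow>\<^sub>E (UNIV - {0}) \<and> (\<forall>i\<in>{1..n}. f (p i) = 0)}"

definition rescale :: "nat \<Rightarrow> complex \<Rightarrow> (nat \<Rightarrow> complex) \<Rightarrow> mcurve \<Rightarrow> mcurve" where
  "rescale n \<alpha> \<beta> x = ((\<lambda>v. \<alpha> * fst x v), (\<lambda>i\<in>{1..n}. \<beta> i *s snd x i))"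

definition same_point :: "nat \<Rightarrow> mcurve \<Rightarrow> mcurve \<Rightarrow> bool" where
  "same_point n x y \<longleftrightarrow> (\<exists>\<alpha> \<beta>. \<alpha> \<noteq> 0 \<and> (\<forall>i\<in>{1..n}. \<beta> i \<noteq> 0) \<and> y = rescale n \<alpha> \<beta> x)"

definition act :: "nat \<Rightarrow> complex ^ 3 ^ 3 \<Rightarrow> mcurve \<Rightarrow> mcurve" where
  "act n g x = ((\<lambda>v. fst x (matrix_inv g *v v)), (\<lambda>i\<in>{1..n}. g *v snd x i))"

text \<open>The algebra of polynomials in a given set of coordinate functions.\<close>

inductive_set polys :: "('a \<Rightarrow> complex) set \<Rightarrow> ('a \<Rightarrow> complex) set" for X where
  const: "(\<lambda>_. c) \<in> polys X"
| coord: "u \<in> X \<Longrightarrow> u \<in> polys X"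
| add: "P \<in> polys X \<Longrightarrow> Q \<in> polys X \<Longrightarrow> (\<lambda>x. P x + Q x) \<in> polys X"
| mult: "P \<in> polys X \<Longrightarrow> Q \<in> polys X \<Longrightarrow> (\<lambda>x. P x * Q x) \<in> polys X"

text \<open>
  The evaluations \<open>f \<mapsto> f u\<close> span the dual of the finite-dimensional function space \<open>forms d\<close>,
  so they generate the same algebra as the coefficients of \<open>f\<close>.
\<close>

definition coords :: "nat \<Rightarrow> (mcurve \<Rightarrow> complex) set" where
  "coords n = {\<lambda>x. fst x u | u. True} \<union> {\<lambda>x. snd x i $ k | i k. i \<in> {1..n}}"

definition multihomogeneous ::
    "nat \<Rightarrow> nat \<Rightarrow> int \<Rightarrow> (nat \<Rightarrow> int) \<Rightarrow> (mcurve \<Rightarrow> complex) \<Rightarrow> bool" where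
  "multihomogeneous n d a b s \<longleftrightarrow>
     (\<forall>x\<in>multicone n d. \<forall>\<alpha> \<beta>. \<alpha> \<noteq> 0 \<longrightarrow> (\<forall>i\<in>{1..n}. \<beta> i \<noteq> 0) \<longrightarrow>
        s (rescale n \<alpha> \<beta> x) = \<alpha> powi a * (\<Prod>i\<in>{1..n}. \<beta> i powi b i) * s x)"

definition regular :: "nat \<Rightarrow> nat \<Rightarrow> (mcurve \<Rightarrow> complex) \<Rightarrow> bool" where
  "regular n d s \<longleftrightarrow>
     (\<forall>x\<in>multicone n d. \<exists>P\<in>polys (coords n). \<exists>Q\<in>polys (coords n).
        Q x \<noteq> 0 \<and> (\<forall>y\<in>multicone n d. Q y \<noteq> 0 \<longrightarrow> s y = P y / Q y))"

definition sections :: "nat \<Rightarrow> nat \<Rightarrow> int \<Rightarrow> (nat \<Rightarrow> int) \<Rightarrow> (mcurve \<Rightarrow> complex) set" where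
  "sections n d a b = {s. multihomogeneous n d a b s \<and> regular n d s}"

definition proj_coords :: "nat \<Rightarrow> ((nat \<Rightarrow> complex) \<Rightarrow> complex) set" where
  "proj_coords N = {\<lambda>z. z j | j. j \<le> N}"

text \<open>
  Very ampleness: finitely many sections \<open>\<sigma> 0, \<dots>, \<sigma> N\<close> without common zero define an immersion into
  \<open>\<P>\<^sup>N\<close>. The last two clauses say that the map is injective, and that every regular germ
  \<open>P / Q\<close> on the incidence variety is the pullback of a rational function \<open>F / G\<close> of degree zero on
  \<open>\<P>\<^sup>N\<close>, defined at the image point, whose domain \<open>{G \<noteq> 0}\<close> pulls back into \<open>{Q \<noteq> 0}\<close>; that is,
  the map is a homeomorphism onto its image and surjective on stalks. The image is automatically
  closed, since the incidence variety is complete.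
\<close>

definition very_ample :: "nat \<Rightarrow> nat \<Rightarrow> int \<Rightarrow> (nat \<Rightarrow> int) \<Rightarrow> bool" where
  "very_ample n d a b \<longleftrightarrow>
     (\<exists>N \<sigma>. (\<forall>j\<le>N. \<sigma> j \<in> sections n d a b) \<and>
        (\<forall>x\<in>multicone n d. \<exists>j\<le>N. \<sigma> j x \<noteq> 0) \<and>
        (\<forall>x\<in>multicone n d. \<forall>y\<in>multicone n d.
           (\<exists>c. c \<noteq> 0 \<and> (\<forall>j\<le>N. \<sigma> j y = c * \<sigma> j x)) \<longrightarrow> same_point n x y) \<and>
        (\<forall>x\<in>multicone n d. \<forall>P\<in>polys (coords n). \<forall>Q\<in>polys (coords n). \<forall>a' b'.
           multihomogeneous n d a' b' P \<and> multihomogeneous n d a' b' Q \<and> Q x \<noteq> 0 \<longrightarrow>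
           (\<exists>F\<in>polys (proj_coords N). \<exists>G\<in>polys (proj_coords N). \<exists>k.
              (\<forall>c z. F (\<lambda>j. c * z j) = c ^ k * F z) \<and> (\<forall>c z. G (\<lambda>j. c * z j) = c ^ k * G z) \<and>
              G (\<lambda>j. \<sigma> j x) \<noteq> 0 \<and>
              (\<forall>y\<in>multicone n d. G (\<lambda>j. \<sigma> j y) \<noteq> 0 \<longrightarrow>
                 Q y \<noteq> 0 \<and> P y / Q y = F (\<lambda>j. \<sigma> j y) / G (\<lambda>j. \<sigma> j y)))))"

text \<open>\<open>(a, b)\<close> is the integral multidegree \<open>m \<cdot> (\<gamma>, w\<^sub>1, \<dots>, w\<^sub>n)\<close>.\<close>

definition cleared ::
    "nat \<Rightarrow> nat \<Rightarrow> rat \<Rightarrow> (nat \<Rightarrow> rat) \<Rightarrow> int \<Rightarrow> (nat \<Rightarrow> int) \<Rightarrow> bool" where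
  "cleared n m \<gamma> w a b \<longleftrightarrow> of_int a = of_nat m * \<gamma> \<and> (\<forall>i\<in>{1..n}. of_int (b i) = of_nat m * w i)"

definition ample :: "nat \<Rightarrow> nat \<Rightarrow> rat \<Rightarrow> (nat \<Rightarrow> rat) \<Rightarrow> bool" where
  "ample n d \<gamma> w \<longleftrightarrow> (\<exists>m>0. \<exists>a b. cleared n m \<gamma> w a b \<and> very_ample n d a b)"

definition invariant :: "nat \<Rightarrow> nat \<Rightarrow> (mcurve \<Rightarrow> complex) \<Rightarrow> bool" where
  "invariant n d s \<longleftrightarrow> (\<forall>g. det g = 1 \<longrightarrow> (\<forall>x\<in>multicone n d. s (act n g x) = s x))"

definition semistable :: "nat \<Rightarrow> nat \<Rightarrow> rat \<Rightarrow> (nat \<Rightarrow> rat) \<Rightarrow> mcurve set" where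
  "semistable n d \<gamma> w = {x \<in> multicone n d.
     \<exists>m>0. \<exists>a b. \<exists>s\<in>sections n d a b. cleared n m \<gamma> w a b \<and> invariant n d s \<and> s x \<noteq> 0}"

text \<open>Vectors \<open>(w\<^sub>1, \<dots>, w\<^sub>n) \<in> \<rat>\<^sup>n\<close> are extensional functions on \<open>{1..n}\<close>.\<close>

definition git_cone :: "nat \<Rightarrow> nat \<Rightarrow> (rat \<times> (nat \<Rightarrow> rat)) set" where
  "git_cone n d = {(\<gamma>, w). w \<in> {1..n} \<rightarrow>\<^sub>E UNIV \<and> ample n d \<gamma> w \<and> semistable n d \<gamma> w \<noteq> {}}"

subsection \<open>Degrees zero and one\<close>

text \<open>
  If \<open>d \<le> 1\<close> and \<open>n \<ge> 4\<close>, or \<open>d = 1\<close> and \<open>n = 0\<close>, the vector \<open>(1/3, 1, \<dots>, 1)\<close> satisfies all the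
  inequalities of the main theorem, but by the next lemmas it is not in the cone: for \<open>d = 1\<close> the
  one-parameter subgroup acting as \<open>t\<close> on the line and as \<open>t\<^sup>-\<^sup>2\<close> on a complement rescales the
  marked line, so semistability forces \<open>2 \<gamma> + W = 0\<close>; for \<open>d = 0\<close> a marked curve does not exist.
  If \<open>d = n = 0\<close>, the variety is a point and every \<open>\<gamma>\<close>, including \<open>-1\<close>, is in the cone.
  These are exactly the pairs \<open>(n, d)\<close> excluded from the theorem.
\<close>

lemma forms_1_linear:
  assumes "f \<in> forms 1"
  obtains u :: "complex ^ 3" where "\<And>v. f v = u $ 1 * v $ 1 + u $ 2 * v $ 2 + u $ 3 * v $ 3"
proof -
  from assms obtain c where
    c: "f = (\<lambda>v. \<Sum>i\<le>1. \<Sum>j\<le>1 - i. c i j * (v $ 1) ^ i * (v $ 2) ^ j * (v $ 3) ^ (1 - i - j))"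
    by (auto simp: forms_def)
  define u :: "complex ^ 3" where "u = vector [c 1 0, c 0 1, c 0 0]"
  show thesis
    by (rule that[of u]) (simp add: c u_def algebra_simps)
qed

lemma git_cone_degree_1:
  assumes "(\<gamma>, w) \<in> git_cone n 1"
  shows "2 * \<gamma> + (\<Sum>k=1..n. w k) = 0"
proof -
  obtain x m a b s where x: "x \<in> multicone n 1" and m: "m > 0"
    and s: "s \<in> sections n 1 a b" and cl: "cleared n m \<gamma> w a b"
    and inv: "invariant n 1 s" and sx: "s x \<noteq> 0"
    using assms by (auto simp: git_cone_def semistable_def)
  obtain f p where fp: "x = (f, p)" by (cases x)
  have f: "f \<in> forms 1" "f \<noteq> (\<lambda>_. 0)" and p: "\<forall>i\<in>{1..n}. f (p i) = 0"
    using x by (auto simp: fp multicone_def)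
  obtain u :: "complex ^ 3" where u: "\<And>v. f v = u $ 1 * v $ 1 + u $ 2 * v $ 2 + u $ 3 * v $ 3"
    using forms_1_linear[OF f(1)] by blast
  obtain e where e: "f e \<noteq> 0" using f(2) by auto
  define k where "k = - (7/4) / f e"
  have kS: "k * f e = - (7/4)" using e by (simp add: k_def)
  define g :: "complex ^ 3 ^ 3" where
    "g = (\<chi> i j. (if i = j then 2 else 0) + k * e $ i * u $ j)"
  have "det g = 8 + 4 * (k * f e)"
    unfolding det_3 g_def u by (simp add: algebra_simps)
  then have det: "det g = 1" by (simp add: kS)
  have gv: "g *v v = 2 *s v + (k * f v) *s e" for v
    unfolding vec_eq_iff forall_3
    by (simp add: matrix_vector_mult_def sum_3 g_def u algebra_simps)
  have f_lin: "f (2 *s v + c *s e) = 2 * f v + c * f e" for v c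
    by (simp add: u algebra_simps)
  have fg: "f (g *v v) = f v / 4" for v
  proof -
    have "f (g *v v) = 2 * f v + (k * f e) * f v"
      by (simp add: gv f_lin)
    then show ?thesis by (simp add: kS)
  qed
  have "invertible g" using det by (simp add: invertible_det_nz)
  then have "g ** matrix_inv g = mat 1" by (auto simp: invertible_def matrix_inv_def intro: someI2_ex)
  then have "f v = f (matrix_inv g *v v) / 4" for v
    by (metis fg matrix_vector_mul_assoc matrix_vector_mul_lid)
  then have 1: "f (matrix_inv g *v v) = 4 * f v" for v
    by (metis (no_types) nonzero_mult_div_cancel_left times_divide_eq_right zero_neq_numeral)
  have "act n g x = rescale n 4 (\<lambda>_. 2) x"
    using p by (auto simp: act_def rescale_def fp 1 gv restrict_def)
  then have "s x = s (rescale n 4 (\<lambda>_. 2) x)"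
    using inv det x by (metis invariant_def)
  also have "\<dots> = 4 powi a * (\<Prod>i\<in>{1..n}. 2 powi b i) * s x"
    using s x by (simp add: sections_def multihomogeneous_def)
  finally have 2: "(4::complex) powi a * (\<Prod>i\<in>{1..n}. 2 powi b i) = 1"
    using sx by simp
  have "(\<Prod>i\<in>A. (2::complex) powi b i) = 2 powi (\<Sum>i\<in>A. b i)" if "finite A" for A
    using that by induction (auto simp: power_int_add)
  moreover have "(4::complex) powi a = 2 powi (2 * a)"
    by (simp add: power_int_mult)
  ultimately have "(2::complex) powi (2 * a + (\<Sum>i\<in>{1..n}. b i)) = 1"
    using 2 by (simp add: power_int_add)
  then have "(2::real) powi (2 * a + (\<Sum>i\<in>{1..n}. b i)) = 1"
    by (metis norm_numeral norm_one norm_power_int)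
  then have 0: "2 * a + (\<Sum>i\<in>{1..n}. b i) = 0"
    using power_int_strict_increasing[of 0 "2 * a + (\<Sum>i\<in>{1..n}. b i)" "2::real"]
      power_int_strict_increasing[of "2 * a + (\<Sum>i\<in>{1..n}. b i)" 0 "2::real"]
    by (cases "2 * a + (\<Sum>i\<in>{1..n}. b i)" "0::int" rule: linorder_cases) auto
  have "of_nat m * (2 * \<gamma> + (\<Sum>k=1..n. w k)) = of_int (2 * a + (\<Sum>i\<in>{1..n}. b i))"
    using cl by (simp add: cleared_def algebra_simps sum_distrib_left)
  also have "\<dots> = 0" by (simp only: 0 of_int_0)
  finally show ?thesis using m by simp
qed

lemma git_cone_degree_0:
  assumes "n > 0"
  shows "git_cone n 0 = {}"
proof -
  have "multicone n 0 = {}"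
    using assms by (fastforce simp: multicone_def forms_def)
  then show ?thesis by (simp add: git_cone_def semistable_def)
qed

lemma uniform_weights_not_in_git_cone:
  assumes "d \<le> 1" "n \<ge> 4 \<or> d = 1 \<and> n = 0"
  shows "(1/3, \<lambda>i\<in>{1..n}. 1) \<notin> git_cone n d"
proof (cases "d = 0")
  case True
  then show ?thesis using assms git_cone_degree_0[of n] by auto
next
  case False
  then have "d = 1" using assms by simp
  moreover have "2 * (1/3) + (\<Sum>k=1..n. (\<lambda>i\<in>{1..n}. 1::rat) k) \<noteq> 0"
    by (simp add: add_pos_nonneg order.strict_implies_not_eq[symmetric])
  ultimately show ?thesis using git_cone_degree_1 by blast
qed

lemma git_cone_0_0: "(-1, \<lambda>_. undefined) \<in> git_cone 0 0"
proof -
  let ?w = "\<lambda>_. undefined :: rat"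
  let ?b = "\<lambda>_. 0 :: int"
  let ?s = "\<lambda>x :: mcurve. 1 / fst x 0"
  have mc: "x \<in> multicone 0 0 \<longleftrightarrow> (\<exists>c. c \<noteq> 0 \<and> x = (\<lambda>_. c, \<lambda>_. undefined))" for x
    by (cases x) (auto simp: multicone_def forms_def fun_eq_iff)
  have sec: "?s \<in> sections 0 0 (-1) ?b"
  proof -
    have "regular 0 0 ?s"
      unfolding regular_def
    proof
      fix x assume "x \<in> multicone 0 0"
      then show "\<exists>P\<in>polys (coords 0). \<exists>Q\<in>polys (coords 0).
          Q x \<noteq> 0 \<and> (\<forall>y\<in>multicone 0 0. Q y \<noteq> 0 \<longrightarrow> ?s y = P y / Q y)"
        by (intro bexI[of _ "\<lambda>_. 1"] bexI[of _ "\<lambda>x. fst x 0"])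
           (auto simp: mc coords_def intro: polys.const polys.coord)
    qed
    then show ?thesis
      by (auto simp: sections_def multihomogeneous_def rescale_def power_int_minus field_simps)
  qed
  have va: "very_ample 0 0 (-1) ?b"
    unfolding very_ample_def
  proof (intro exI[of _ 0] exI[of _ "\<lambda>_. ?s"] conjI ballI allI impI)
    fix x y assume "x \<in> multicone 0 0" "y \<in> multicone 0 0"
    then obtain c c' where "c \<noteq> 0" "c' \<noteq> 0" "x = (\<lambda>_. c, \<lambda>_. undefined)" "y = (\<lambda>_. c', \<lambda>_. undefined)"
      by (auto simp: mc)
    then show "same_point 0 x y"
      by (auto simp: same_point_def rescale_def fun_eq_iff intro!: exI[of _ "c' / c"])
  next
    fix x P Q a' b'
    assume x: "x \<in> multicone 0 0"
      and PQ: "multihomogeneous 0 0 a' b' P \<and> multihomogeneous 0 0 a' b' Q \<and> Q x \<noteq> 0"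
    have const: "Q y \<noteq> 0 \<and> P y / Q y = P x / Q x" if "y \<in> multicone 0 0" for y
    proof -
      obtain c c' where c: "c \<noteq> 0" "c' \<noteq> 0"
        "x = (\<lambda>_. c, \<lambda>_. undefined)" "y = (\<lambda>_. c', \<lambda>_. undefined)"
        using x \<open>y \<in> multicone 0 0\<close> by (auto simp: mc)
      then have "y = rescale 0 (c' / c) (\<lambda>_. 1) x"
        by (auto simp: rescale_def fun_eq_iff)
      moreover have "c' / c \<noteq> 0" using c by simp
      ultimately have "P y = (c' / c) powi a' * P x" "Q y = (c' / c) powi a' * Q x"
        using PQ x by (auto simp: multihomogeneous_def)
      then show ?thesis using PQ \<open>c' / c \<noteq> 0\<close> by simp
    qed
    show "\<exists>F\<in>polys (proj_coords 0). \<exists>G\<in>polys (proj_coords 0). \<exists>k.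
      (\<forall>c z. F (\<lambda>j. c * z j) = c ^ k * F z) \<and> (\<forall>c z. G (\<lambda>j. c * z j) = c ^ k * G z) \<and>
      G (\<lambda>j. ?s x) \<noteq> 0 \<and>
      (\<forall>y\<in>multicone 0 0. G (\<lambda>j. ?s y) \<noteq> 0 \<longrightarrow>
         Q y \<noteq> 0 \<and> P y / Q y = F (\<lambda>j. ?s y) / G (\<lambda>j. ?s y))"
      by (intro bexI[of _ "\<lambda>_. P x / Q x"] bexI[of _ "\<lambda>_. 1"] exI[of _ 0])
         (auto simp: const intro: polys.const)
  qed (use sec in \<open>auto simp: mc\<close>)
  have cl: "cleared 0 1 (-1) ?w (-1) ?b" by (simp add: cleared_def)
  have "(\<lambda>_. 1, \<lambda>_. undefined) \<in> semistable 0 0 (-1) ?w"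
    unfolding semistable_def mem_Collect_eq
  proof (intro conjI exI[of _ "1::nat"] exI[of _ "-1::int"] exI[of _ ?b] bexI[OF _ sec])
    show "(\<lambda>_. 1, \<lambda>_. undefined) \<in> multicone 0 0"
      unfolding mc by (rule exI[of _ 1]) simp
    show "invariant 0 0 ?s" by (auto simp: mc invariant_def act_def)
  qed (use cl in auto)
  moreover have "ample 0 0 (-1) ?w"
    unfolding ample_def using cl va zero_less_one by blast
  ultimately show ?thesis by (auto simp: git_cone_def)
qed

end

theory Submission
  imports Defs "HOL-Complex_Analysis.Cauchy_Integral_Formula" "HOL-Computational_Algebra.Polynomial"
begin

text \<open>
  A class is ample iff all its coordinates are positive: a section of nonpositive degree is constant
  on a pencil by Liouville's theorem, and conversely products of coordinates give a Segre-Veronese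
  embedding.

  Necessity of the inequalities is the easy half of the Hilbert-Mumford criterion, for the
  one-parameter subgroups of weights \<open>(2, -1, -1)\<close>, \<open>(1, -1, 0)\<close> and \<open>(1, 1, -2)\<close> in coordinates
  adapted to one marked point, to its tangent line and to two marked points.

  For sufficiency, the cone cut out by the inequalities is spanned by the multidegrees of four
  kinds of invariants: a sextic invariant of the form \<open>f\<close>, the Hessian of \<open>f\<close> at \<open>p i\<close>, the polar
  \<open>\<partial>f (p i) (p j)\<close> and the bracket \<open>det (p i, p j, p k)\<close>. None of them vanishes
  at the Fermat curve \<open>x\<^sup>d + y\<^sup>d = z\<^sup>d\<close> marked by distinct real points in the open positive quadrant,
  because the real arc is strictly convex. Hence this marked curve is semistable for every
  class in the cone.
\<close>

section \<open>Ternary forms and the apolar pairing\<close>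

text \<open>The easy half of the Hilbert-Mumford criterion bounds the cone only from outside; that
  the semistable locus is non-empty has to be shown by exhibiting sections. One point serves all
  classes, because the classes for which a fixed point is semistable are closed under sums and
  nonnegative rational multiples: invariant sections can be multiplied and raised to powers. Up to
  scaling, the four generators have multidegrees \<open>(1, 0)\<close>,
  \<open>(1, (d - 2) e_i)\<close>, \<open>(1, (d - 1) e_i + e_j)\<close> and
  \<open>(0, e_i + e_j + e_k)\<close>. They sit on the boundary where it matters: the polar turns
  both inequalities for \<open>i\<close> and the one for the pair into equalities, the Hessian the
  second one for \<open>i\<close>, the bracket the first and the third for its points. Geometrically
  the marked points must avoid flexes (Hessian), tangent lines at other marked points (polar) and
  collinear triples (bracket). The Fermat form is chosen because it is a signed sum of powers of
  three linear forms, so that every symbolic invariant reduces to finitely many evaluations at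
  coordinate vectors.\<close>

text \<open>Lagrange interpolation expresses the coefficients of a form by its values, so that they are
  polynomials in the coordinate functions.\<close>

definition lagrange :: "nat \<Rightarrow> nat \<Rightarrow> complex poly" where
  "lagrange d s = (\<Prod>l\<in>{..d} - {s}. smult (1 / (of_nat s - of_nat l)) [:- of_nat l, 1:])"

definition vandermonde_dual :: "nat \<Rightarrow> nat \<Rightarrow> nat \<Rightarrow> complex" where
  "vandermonde_dual d i s = coeff (lagrange d s) i"

lemma poly_lagrange:
  assumes "r \<le> d" "s \<le> d"
  shows "poly (lagrange d s) (of_nat r) = (if r = s then 1 else 0)"
proof (cases "r = s")
  case True
  have "(of_nat s - of_nat l :: complex) \<noteq> 0" if "l \<noteq> s" for l using that by simp
  then show ?thesis using True
    by (auto simp: lagrange_def poly_prod diff_divide_distrib[symmetric] intro!: prod.neutral)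
next
  case False
  then have "r \<in> {..d} - {s}" using assms by simp
  then show ?thesis using False by (auto simp: lagrange_def poly_prod intro!: prod_zero)
qed

lemma degree_lagrange: "s \<le> d \<Longrightarrow> degree (lagrange d s) \<le> d"
proof -
  assume "s \<le> d"
  have "degree (lagrange d s) \<le> (\<Sum>l\<in>{..d} - {s}. degree (smult (1 / (of_nat s - of_nat l)) [:- of_nat l, 1::complex:]))"
    unfolding lagrange_def by (rule order_trans[OF degree_prod_sum_le]) simp_all
  also have "\<dots> \<le> (\<Sum>l\<in>{..d} - {s}. 1)"
    by (rule sum_mono) (simp add: degree_smult_le)
  also have "\<dots> = d" using \<open>s \<le> d\<close> by simp
  finally show ?thesis .
qed

text \<open>Interpolating \<open>x ^ k\<close> at the \<open>d + 1\<close> nodes returns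
  \<open>x ^ k\<close> itself; comparing coefficients of \<open>x ^ i\<close> shows that
  \<open>vandermonde_dual\<close> inverts the Vandermonde matrix.\<close>

lemma vandermonde_dual_sum:
  assumes "i \<le> d" "k \<le> d"
  shows "(\<Sum>s\<le>d. vandermonde_dual d i s * of_nat s ^ k) = (if i = k then 1 else 0)"
proof -
  let ?L = "\<Sum>s\<le>d. smult (of_nat s ^ k) (lagrange d s)"
  have "?L = monom 1 k"
  proof (rule poly_eqI_degree[of "of_nat ` {..d}"])
    fix x :: complex assume "x \<in> of_nat ` {..d}"
    then obtain r where r: "r \<le> d" "x = of_nat r" by auto
    have "poly ?L x = (\<Sum>s\<le>d. if s = r then of_nat s ^ k else 0)"
      unfolding r(2) poly_sum poly_smult
      by (intro sum.cong refl) (use r(1) in \<open>simp add: poly_lagrange\<close>)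
    then show "poly ?L x = poly (monom 1 k) x" using r by (simp add: poly_monom)
  next
    have "card (of_nat ` {..d} :: complex set) = Suc d"
      by (subst card_image) (auto simp: inj_on_def)
    moreover have "degree ?L \<le> d"
      by (rule degree_sum_le) (auto intro: order_trans[OF degree_smult_le] degree_lagrange)
    moreover have "degree (monom (1::complex) k) \<le> d" using assms degree_monom_le le_trans by blast
    ultimately show "degree ?L < card (of_nat ` {..d} :: complex set)"
      "degree (monom (1::complex) k) < card (of_nat ` {..d} :: complex set)" by simp_all
  qed
  then have "coeff ?L i = (if i = k then 1 else 0)" by simp
  moreover have "coeff ?L i = (\<Sum>s\<le>d. vandermonde_dual d i s * of_nat s ^ k)"
    by (simp add: coeff_sum vandermonde_dual_def mult.commute)
  ultimately show ?thesis by simp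
qed

section \<open>Monomials and closure properties of ternary forms\<close>

definition mon3 :: "nat \<Rightarrow> nat \<Rightarrow> nat \<Rightarrow> form" where
  "mon3 i j k v = (v $ 1) ^ i * (v $ 2) ^ j * (v $ 3) ^ k"

lemma mon3_mult: "mon3 i j k v * mon3 i' j' k' v = mon3 (i + i') (j + j') (k + k') v"
  by (simp add: mon3_def power_add)

lemma forms_iff: "f \<in> forms d \<longleftrightarrow> (\<exists>c. f = (\<lambda>v. \<Sum>i\<le>d. \<Sum>j\<le>d - i. c i j * mon3 i j (d - i - j) v))"
  by (simp add: forms_def mon3_def mult.assoc)

lemma forms_add: "f \<in> forms d \<Longrightarrow> g \<in> forms d \<Longrightarrow> (\<lambda>v. f v + g v) \<in> forms d"
proof -
  assume "f \<in> forms d" "g \<in> forms d"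
  then obtain a b where "f = (\<lambda>v. \<Sum>i\<le>d. \<Sum>j\<le>d - i. a i j * mon3 i j (d - i - j) v)"
    "g = (\<lambda>v. \<Sum>i\<le>d. \<Sum>j\<le>d - i. b i j * mon3 i j (d - i - j) v)" by (auto simp: forms_iff)
  then show ?thesis unfolding forms_iff
    by (intro exI[of _ "\<lambda>i j. a i j + b i j"]) (simp add: sum.distrib distrib_right)
qed

lemma forms_scale: "f \<in> forms d \<Longrightarrow> (\<lambda>v. c * f v) \<in> forms d"
proof -
  assume "f \<in> forms d"
  then obtain a where "f = (\<lambda>v. \<Sum>i\<le>d. \<Sum>j\<le>d - i. a i j * mon3 i j (d - i - j) v)"
    by (auto simp: forms_iff)
  then show ?thesis unfolding forms_iff
    by (intro exI[of _ "\<lambda>i j. c * a i j"]) (simp add: sum_distrib_left mult.assoc)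
qed

lemma forms_0: "(\<lambda>_. 0) \<in> forms d"
  unfolding forms_iff by (rule exI[of _ "\<lambda>_ _. 0"]) simp

lemma forms_sum: "(\<And>i. i \<in> I \<Longrightarrow> f i \<in> forms d) \<Longrightarrow> (\<lambda>v. \<Sum>i\<in>I. f i v) \<in> forms d"
  by (induction I rule: infinite_finite_induct) (auto intro: forms_add forms_0)

lemma sum_triangle_delta:
  assumes "a + b \<le> (d::nat)"
  shows "(\<Sum>i\<le>d. \<Sum>j\<le>d - i. if i = a \<and> j = b then h i j else (0::complex)) = h a b"
proof -
  have "(\<Sum>i\<le>d. \<Sum>j\<le>d - i. if i = a \<and> j = b then h i j else 0)
      = (\<Sum>i\<le>d. if i = a then (\<Sum>j\<le>d - i. if j = b then h i j else 0) else 0)"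
    by (intro sum.cong refl) auto
  also have "\<dots> = h a b" using assms by simp
  finally show ?thesis .
qed

lemma forms_mon3: "i + j + k = d \<Longrightarrow> mon3 i j k \<in> forms d"
  unfolding forms_iff
proof (intro exI[of _ "\<lambda>i' j'. if i' = i \<and> j' = j then 1 else 0"] ext)
  fix v assume *: "i + j + k = d"
  have "mon3 i j k v = mon3 i j (d - i - j) v" using * by auto
  also have "\<dots> = (\<Sum>i'\<le>d. \<Sum>j'\<le>d - i'. if i' = i \<and> j' = j then mon3 i' j' (d - i' - j') v else 0)"
    using * by (subst sum_triangle_delta) auto
  also have "\<dots> = (\<Sum>i'\<le>d. \<Sum>j'\<le>d - i'. (if i' = i \<and> j' = j then 1 else 0) * mon3 i' j' (d - i' - j') v)"
    by (intro sum.cong refl) auto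
  finally show "mon3 i j k v = \<dots>" .
qed

lemma forms_mult:
  assumes "f \<in> forms d" "g \<in> forms e"
  shows "(\<lambda>v. f v * g v) \<in> forms (d + e)"
proof -
  obtain a b where *: "f = (\<lambda>v. \<Sum>i\<le>d. \<Sum>j\<le>d - i. a i j * mon3 i j (d - i - j) v)"
    "g = (\<lambda>v. \<Sum>i\<le>e. \<Sum>j\<le>e - i. b i j * mon3 i j (e - i - j) v)"
    using assms by (auto simp: forms_iff)
  have "(\<lambda>v. f v * g v) = (\<lambda>v. \<Sum>i\<le>d. \<Sum>j\<le>d - i. \<Sum>i'\<le>e. \<Sum>j'\<le>e - i'.
      (a i j * b i' j') * (mon3 i j (d - i - j) v * mon3 i' j' (e - i' - j') v))"
    unfolding * sum_distrib_right unfolding sum_distrib_left by (simp only: mult_ac)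
  also have "\<dots> \<in> forms (d + e)"
    unfolding mon3_mult by (intro forms_sum forms_scale forms_mon3) auto
  finally show ?thesis .
qed

lemma forms_const: "(\<lambda>_. c) \<in> forms 0"
  unfolding forms_iff by (rule exI[of _ "\<lambda>_ _. c"]) (simp add: mon3_def)

lemma forms_power: "f \<in> forms d \<Longrightarrow> (\<lambda>v. f v ^ k) \<in> forms (k * d)"
  by (induction k) (auto intro: forms_const forms_mult)

lemma forms_nth: "(\<lambda>v. v $ k) \<in> forms 1"
proof -
  have "(\<lambda>v::complex^3. v $ 1) = mon3 1 0 0" "(\<lambda>v::complex^3. v $ 2) = mon3 0 1 0" "(\<lambda>v::complex^3. v $ 3) = mon3 0 0 1"
    by (auto simp: mon3_def)
  then show ?thesis using exhaust_3[of k] by (auto simp: forms_mon3)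
qed

lemma forms_comp:
  assumes "f \<in> forms d"
  shows "(\<lambda>v. f (A *v v)) \<in> forms d"
proof -
  obtain a where *: "f = (\<lambda>v. \<Sum>i\<le>d. \<Sum>j\<le>d - i. a i j * mon3 i j (d - i - j) v)"
    using assms by (auto simp: forms_iff)
  have lin: "(\<lambda>v. (A *v v) $ k) \<in> forms 1" for k
    unfolding matrix_vector_mult_def vec_lambda_beta by (intro forms_sum forms_scale forms_nth)
  have "(\<lambda>v. mon3 i j (d - i - j) (A *v v)) \<in> forms d" if "i \<le> d" "j \<le> d - i" for i j
  proof -
    have "(\<lambda>v. mon3 i j (d - i - j) (A *v v)) \<in> forms (i * 1 + j * 1 + (d - i - j) * 1)"
      unfolding mon3_def by (intro forms_mult forms_power lin)
    then show ?thesis using that by simp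
  qed
  then show ?thesis unfolding * by (intro forms_sum forms_scale) auto
qed

definition dot3 :: "complex ^ 3 \<Rightarrow> complex ^ 3 \<Rightarrow> complex" where
  "dot3 u v = u $ 1 * v $ 1 + u $ 2 * v $ 2 + u $ 3 * v $ 3"

lemma dot3_commute: "dot3 u v = dot3 v u"
  by (simp add: dot3_def mult.commute)

lemma dot3_matrix: "dot3 u (A *v v) = dot3 (transpose A *v u) v"
  by (simp add: dot3_def matrix_vector_mult_def sum_3 transpose_def algebra_simps)

lemma forms_dot3: "(\<lambda>v. dot3 v u) \<in> forms 1"
  unfolding dot3_def mult.commute[of _ "u $ _"] by (intro forms_add forms_scale forms_nth)

text \<open>In the affine chart with last coordinate 1 a form of degree \<open>d\<close> becomes a
  polynomial of degree at most \<open>d\<close> in each of two variables, hence is determined by its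
  values on a square grid.\<close>

definition node :: "nat \<Rightarrow> nat \<Rightarrow> complex ^ 3" where
  "node s t = vector [of_nat s, of_nat t, 1]"

text \<open>Defined on all functions, so that it is linear without side conditions and visibly
  polynomial in the values of \<open>f\<close>; on forms it is the coefficient of
  \<open>mon3 i j (d - i - j)\<close>.\<close>

definition form_coeff :: "nat \<Rightarrow> form \<Rightarrow> nat \<Rightarrow> nat \<Rightarrow> complex" where
  "form_coeff d f i j = (\<Sum>s\<le>d. \<Sum>t\<le>d. vandermonde_dual d i s * vandermonde_dual d j t * f (node s t))"

lemma form_coeff_eq:
  assumes f: "\<And>v. f v = (\<Sum>i\<le>d. \<Sum>j\<le>d - i. c i j * mon3 i j (d - i - j) v)" and ab: "a + b \<le> d"
  shows "form_coeff d f a b = c a b"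
proof -
  have "form_coeff d f a b = (\<Sum>s\<le>d. \<Sum>t\<le>d. \<Sum>i\<le>d. \<Sum>j\<le>d - i. c i j * (vandermonde_dual d a s * of_nat s ^ i) * (vandermonde_dual d b t * of_nat t ^ j))"
    unfolding form_coeff_def f by (simp add: node_def mon3_def sum_distrib_left mult_ac)
  also have "\<dots> = (\<Sum>s\<le>d. \<Sum>i\<le>d. \<Sum>t\<le>d. \<Sum>j\<le>d - i. c i j * (vandermonde_dual d a s * of_nat s ^ i) * (vandermonde_dual d b t * of_nat t ^ j))"
    by (intro sum.cong refl sum.swap)
  also have "\<dots> = (\<Sum>i\<le>d. \<Sum>s\<le>d. \<Sum>t\<le>d. \<Sum>j\<le>d - i. c i j * (vandermonde_dual d a s * of_nat s ^ i) * (vandermonde_dual d b t * of_nat t ^ j))"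
    by (rule sum.swap)
  also have "\<dots> = (\<Sum>i\<le>d. \<Sum>s\<le>d. \<Sum>j\<le>d - i. \<Sum>t\<le>d. c i j * (vandermonde_dual d a s * of_nat s ^ i) * (vandermonde_dual d b t * of_nat t ^ j))"
    by (intro sum.cong refl sum.swap)
  also have "\<dots> = (\<Sum>i\<le>d. \<Sum>j\<le>d - i. \<Sum>s\<le>d. \<Sum>t\<le>d. c i j * (vandermonde_dual d a s * of_nat s ^ i) * (vandermonde_dual d b t * of_nat t ^ j))"
    by (intro sum.cong refl sum.swap)
  also have "\<dots> = (\<Sum>i\<le>d. \<Sum>j\<le>d - i. c i j * ((\<Sum>s\<le>d. vandermonde_dual d a s * of_nat s ^ i) * (\<Sum>t\<le>d. vandermonde_dual d b t * of_nat t ^ j)))"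
    unfolding sum_product unfolding sum_distrib_left by (simp only: mult_ac)
  also have "\<dots> = (\<Sum>i\<le>d. \<Sum>j\<le>d - i. if i = a \<and> j = b then c i j else 0)"
    using ab by (intro sum.cong refl) (auto simp: vandermonde_dual_sum)
  also have "\<dots> = c a b" by (rule sum_triangle_delta[OF ab])
  finally show ?thesis .
qed

lemma forms_expand:
  assumes "f \<in> forms d"
  shows "f v = (\<Sum>i\<le>d. \<Sum>j\<le>d - i. form_coeff d f i j * mon3 i j (d - i - j) v)"
proof -
  obtain c where c: "f = (\<lambda>v. \<Sum>i\<le>d. \<Sum>j\<le>d - i. c i j * mon3 i j (d - i - j) v)"
    using assms by (auto simp: forms_iff)
  then have "form_coeff d f i j = c i j" if "i + j \<le> d" for i j using that by (intro form_coeff_eq) auto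
  then have "(\<Sum>i\<le>d. \<Sum>j\<le>d - i. form_coeff d f i j * mon3 i j (d - i - j) v) = (\<Sum>i\<le>d. \<Sum>j\<le>d - i. c i j * mon3 i j (d - i - j) v)"
    by (intro sum.cong refl) auto
  then show ?thesis by (simp add: c)
qed

definition trinomial :: "nat \<Rightarrow> nat \<Rightarrow> nat \<Rightarrow> complex" where
  "trinomial d i j = of_nat (d choose i) * of_nat ((d - i) choose j)"

lemma trinomial_nonzero: "i \<le> d \<Longrightarrow> j \<le> d - i \<Longrightarrow> trinomial d i j \<noteq> 0"
  by (simp add: trinomial_def)

lemma dot3_power: "dot3 u v ^ d = (\<Sum>i\<le>d. \<Sum>j\<le>d - i. (trinomial d i j * mon3 i j (d - i - j) v) * mon3 i j (d - i - j) u)"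
proof -
  have "dot3 u v ^ d = (u $ 1 * v $ 1 + (u $ 2 * v $ 2 + u $ 3 * v $ 3)) ^ d" by (simp add: dot3_def add.assoc)
  also have "\<dots> = (\<Sum>i\<le>d. of_nat (d choose i) * (u $ 1 * v $ 1) ^ i * (\<Sum>j\<le>d - i. of_nat ((d - i) choose j) * (u $ 2 * v $ 2) ^ j * (u $ 3 * v $ 3) ^ (d - i - j)))"
    unfolding binomial_ring[of "u $ 1 * v $ 1"] binomial_ring[of "u $ 2 * v $ 2"] by simp
  finally show ?thesis by (simp add: trinomial_def mon3_def sum_distrib_left power_mult_distrib mult_ac)
qed

lemma form_coeff_dot3_power: "i \<le> d \<Longrightarrow> j \<le> d - i \<Longrightarrow> form_coeff d (\<lambda>u. dot3 u v ^ d) i j = trinomial d i j * mon3 i j (d - i - j) v"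
  by (rule form_coeff_eq) (auto simp: dot3_power)

text \<open>The apolar pairing of forms in dual variables; it pairs \<open>f\<close> with the \<open>d\<close>-th power of the
  linear form \<open>dot3 v\<close> to \<open>f v\<close>, so it implements the symbolic method of classical invariant theory.\<close>

definition apolar :: "nat \<Rightarrow> form \<Rightarrow> form \<Rightarrow> complex" where
  "apolar d f \<psi> = (\<Sum>i\<le>d. \<Sum>j\<le>d - i. form_coeff d f i j * form_coeff d \<psi> i j / trinomial d i j)"

lemma apolar_commute: "apolar d f g = apolar d g f"
  by (simp add: apolar_def mult.commute)

lemma apolar_power:
  assumes "f \<in> forms d"
  shows "apolar d f (\<lambda>u. dot3 u v ^ d) = f v"
  unfolding apolar_def forms_expand[OF assms, of v]
  by (intro sum.cong refl) (simp add: form_coeff_dot3_power trinomial_nonzero)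

lemma form_coeff_add: "form_coeff d (\<lambda>v. f v + g v) i j = form_coeff d f i j + form_coeff d g i j"
  by (simp add: form_coeff_def distrib_left sum.distrib)

lemma form_coeff_zero: "form_coeff d (\<lambda>v. 0) i j = 0"
  by (simp add: form_coeff_def)

lemma form_coeff_scale: "form_coeff d (\<lambda>v. c * f v) i j = c * form_coeff d f i j"
  by (simp add: form_coeff_def sum_distrib_left mult_ac)

lemma apolar_sum: "apolar d (\<lambda>v. \<Sum>k\<in>K. f k v) \<psi> = (\<Sum>k\<in>K. apolar d (f k) \<psi>)"
  by (induction K rule: infinite_finite_induct)
    (simp_all add: apolar_def form_coeff_add form_coeff_zero distrib_right add_divide_distrib sum.distrib)

lemma apolar_scale: "apolar d (\<lambda>v. c * f v) \<psi> = c * apolar d f \<psi>"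
  by (simp add: apolar_def form_coeff_scale sum_distrib_left mult_ac)

lemma apolar_scale_right: "apolar d f (\<lambda>v. c * \<psi> v) = c * apolar d f \<psi>"
  by (simp add: apolar_commute[of d f] apolar_scale)

text \<open>By symmetry of the pairing, \<open>apolar_power\<close> can be read with the roles
  exchanged: a power of a linear form acts on \<psi> as evaluation at its coefficient
  vector.\<close>

lemma apolar_waring:
  assumes "\<And>v. f v = (\<Sum>k\<in>K. c k * dot3 (\<xi> k) v ^ d)" "\<psi> \<in> forms d"
  shows "apolar d f \<psi> = (\<Sum>k\<in>K. c k * \<psi> (\<xi> k))"
proof -
  have "f = (\<lambda>v. \<Sum>k\<in>K. c k * dot3 v (\<xi> k) ^ d)" using assms(1) by (auto simp: dot3_commute)
  then have "apolar d f \<psi> = (\<Sum>k\<in>K. c k * apolar d \<psi> (\<lambda>v. dot3 v (\<xi> k) ^ d))"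
    by (simp add: apolar_sum apolar_scale apolar_commute[of d \<psi>])
  then show ?thesis by (simp add: apolar_power[OF assms(2)])
qed

text \<open>In \<open>f v = apolar d f (\<lambda>u. dot3 u v ^ d)\<close> the coefficients of the
  power are combinations of its values at the nodes. Collecting the terms of each node gives a sum
  of powers of linear forms.\<close>

lemma waring_exists:
  assumes "f \<in> forms d"
  obtains K :: "(nat \<times> nat) set" and c \<xi> where "finite K" "\<And>v. f v = (\<Sum>k\<in>K. c k * dot3 (\<xi> k) v ^ d)"
proof -
  define K where "K = {..d} \<times> {..d}"
  define c where "c = (\<lambda>(s, t). \<Sum>i\<le>d. \<Sum>j\<le>d - i. form_coeff d f i j * (vandermonde_dual d i s * vandermonde_dual d j t) / trinomial d i j)"
  have "f v = (\<Sum>k\<in>K. c k * dot3 (case k of (s, t) \<Rightarrow> node s t) v ^ d)" for v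
  proof -
    let ?h = "\<lambda>i j s t. form_coeff d f i j * (vandermonde_dual d i s * vandermonde_dual d j t) / trinomial d i j * dot3 (node s t) v ^ d"
    have "f v = apolar d f (\<lambda>u. dot3 u v ^ d)" by (simp add: apolar_power[OF assms])
    also have "\<dots> = (\<Sum>i\<le>d. \<Sum>j\<le>d - i. \<Sum>k\<in>K. ?h i j (fst k) (snd k))"
      unfolding apolar_def form_coeff_def[of d "\<lambda>u. dot3 u v ^ d"]
      by (simp add: K_def sum.cartesian_product split_beta sum_distrib_left sum_divide_distrib mult_ac)
    also have "\<dots> = (\<Sum>i\<le>d. \<Sum>k\<in>K. \<Sum>j\<le>d - i. ?h i j (fst k) (snd k))"
      by (intro sum.cong refl sum.swap)
    also have "\<dots> = (\<Sum>k\<in>K. \<Sum>i\<le>d. \<Sum>j\<le>d - i. ?h i j (fst k) (snd k))" by (rule sum.swap)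
    also have "\<dots> = (\<Sum>k\<in>K. c k * dot3 (case k of (s, t) \<Rightarrow> node s t) v ^ d)"
      by (simp add: c_def split_beta sum_distrib_right)
    finally show ?thesis .
  qed
  then show thesis using that[of K c "\<lambda>(s, t). node s t"] by (simp add: K_def)
qed

text \<open>Equivariance is invisible in coefficients but immediate for powers of linear forms,
  where a substitution acts on the coefficient vector by the transpose; the Waring decomposition
  extends it to all forms.\<close>

lemma apolar_comp:
  assumes "f \<in> forms d" "\<psi> \<in> forms d"
  shows "apolar d (\<lambda>v. f (A *v v)) \<psi> = apolar d f (\<lambda>u. \<psi> (transpose A *v u))"
proof -
  obtain K :: "(nat \<times> nat) set" and c \<xi> where K: "finite K" "\<And>v. f v = (\<Sum>k\<in>K. c k * dot3 (\<xi> k) v ^ d)"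
    using waring_exists[OF assms(1)] by blast
  have "apolar d (\<lambda>v. f (A *v v)) \<psi> = (\<Sum>k\<in>K. c k * \<psi> (transpose A *v \<xi> k))"
    by (rule apolar_waring[OF _ assms(2)]) (simp add: K(2) dot3_matrix)
  also have "\<dots> = apolar d f (\<lambda>u. \<psi> (transpose A *v u))"
    by (rule apolar_waring[OF K(2), symmetric]) (rule forms_comp[OF assms(2)])
  finally show ?thesis .
qed

text \<open>In nested pairings this keeps the result of the inner pairing a form in each of the
  outer symbols.\<close>

lemma forms_apolar:
  assumes "\<And>u. (\<lambda>v. \<Psi> v u) \<in> forms e"
  shows "(\<lambda>v. apolar d f (\<Psi> v)) \<in> forms e"
proof -
  have "(\<lambda>v. form_coeff d (\<Psi> v) i j) \<in> forms e" for i j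
    unfolding form_coeff_def by (intro forms_sum forms_scale assms)
  then have "(\<lambda>v. \<Sum>i\<le>d. \<Sum>j\<le>d - i. (form_coeff d f i j / trinomial d i j) * form_coeff d (\<Psi> v) i j) \<in> forms e"
    by (intro forms_sum forms_scale)
  then show ?thesis by (simp add: apolar_def)
qed

section \<open>Closure properties of polynomial functions\<close>

lemma polys_sum: "(\<And>i. i \<in> I \<Longrightarrow> P i \<in> polys X) \<Longrightarrow> (\<lambda>x. \<Sum>i\<in>I. P i x) \<in> polys X"
  by (induction I rule: infinite_finite_induct) (auto intro: polys.intros)

lemma polys_prod: "(\<And>i. i \<in> I \<Longrightarrow> P i \<in> polys X) \<Longrightarrow> (\<lambda>x. \<Prod>i\<in>I. P i x) \<in> polys X"
  by (induction I rule: infinite_finite_induct) (auto intro: polys.intros)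

lemma polys_power: "P \<in> polys X \<Longrightarrow> (\<lambda>x. P x ^ k) \<in> polys X"
  by (induction k) (auto intro: polys.intros)

lemma polys_diff: "P \<in> polys X \<Longrightarrow> Q \<in> polys X \<Longrightarrow> (\<lambda>x. P x - Q x) \<in> polys X"
  using polys.add[OF _ polys.mult[OF polys.const[of "-1"]], of P X Q] by simp

lemma polys_fst: "(\<lambda>x. fst x u) \<in> polys (coords n)"
  by (auto simp: coords_def intro!: polys.coord)

lemma polys_snd: "i \<in> {1..n} \<Longrightarrow> (\<lambda>x. snd x i $ k) \<in> polys (coords n)"
  by (auto simp: coords_def intro!: polys.coord)

lemma polys_form_coeff: "(\<And>u. (\<lambda>x. \<Psi> x u) \<in> polys X) \<Longrightarrow> (\<lambda>x. form_coeff d (\<Psi> x) i j) \<in> polys X"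
  unfolding form_coeff_def by (intro polys_sum polys.mult polys.const)

lemma polys_apolar: "(\<And>u. (\<lambda>x. \<Phi> x u) \<in> polys X) \<Longrightarrow> (\<And>u. (\<lambda>x. \<Psi> x u) \<in> polys X)
   \<Longrightarrow> (\<lambda>x. apolar d (\<Phi> x) (\<Psi> x)) \<in> polys X"
  unfolding apolar_def divide_inverse by (intro polys_sum polys.mult polys.const polys_form_coeff)

section \<open>Symbolic invariants of marked forms\<close>

definition det3 :: "complex ^ 3 \<Rightarrow> complex ^ 3 \<Rightarrow> complex ^ 3 \<Rightarrow> complex" where
  "det3 a b c = a $ 1 * (b $ 2 * c $ 3 - b $ 3 * c $ 2) - a $ 2 * (b $ 1 * c $ 3 - b $ 3 * c $ 1)
     + a $ 3 * (b $ 1 * c $ 2 - b $ 2 * c $ 1)"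

lemma det3_eq_det: "det3 a b c = det (transpose (vector [a, b, c] :: complex ^ 3 ^ 3))"
  by (simp add: det3_def det_3 transpose_def algebra_simps)

lemma det3_mult: "det3 (A *v a) (A *v b) (A *v c) = det A * det3 a b c"
proof -
  have "transpose (vector [A *v a, A *v b, A *v c] :: complex ^ 3 ^ 3) = A ** transpose (vector [a, b, c])"
    by (simp add: vec_eq_iff forall_3 transpose_def matrix_matrix_mult_def matrix_vector_mult_def)
  then show ?thesis by (simp add: det3_eq_det det_mul)
qed

lemma det3_swap: "det3 b a c = - det3 a b c" "det3 a c b = - det3 a b c"
  by (simp_all add: det3_def algebra_simps)

lemma det3_scale: "det3 (x *s a) (y *s b) (z *s c) = x * y * z * det3 a b c"
  by (simp add: det3_def algebra_simps)

lemma forms_diff: "f \<in> forms d \<Longrightarrow> g \<in> forms d \<Longrightarrow> (\<lambda>v. f v - g v) \<in> forms d"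
  using forms_add[OF _ forms_scale[of g d "-1"], of f] by simp

lemma forms_det3_1: "(\<lambda>a. det3 a b c) \<in> forms 1"
proof -
  have "(\<lambda>a. (b $ 2 * c $ 3 - b $ 3 * c $ 2) * a $ 1 - (b $ 1 * c $ 3 - b $ 3 * c $ 1) * a $ 2
     + (b $ 1 * c $ 2 - b $ 2 * c $ 1) * a $ 3) \<in> forms 1"
    by (intro forms_add forms_diff forms_scale forms_nth)
  then show ?thesis unfolding det3_def by (simp only: mult.commute)
qed

lemma forms_det3_2: "(\<lambda>b. det3 a b c) \<in> forms 1"
  using forms_scale[OF forms_det3_1, of "-1" a c] by (simp add: det3_swap(1)[of a])

lemma forms_det3_3: "(\<lambda>c. det3 a b c) \<in> forms 1"
  using forms_scale[OF forms_det3_2, of "-1" a b] by (simp add: det3_swap(2)[of _ _ b])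

lemmas forms_det3 = forms_det3_1 forms_det3_2 forms_det3_3

text \<open>The substitution passes from \<open>f\<close> to the symbols one pairing at a time; each
  passage needs a form of degree \<open>d\<close> in the symbol concerned, supplied by
  \<open>forms_apolar\<close>.\<close>

lemma apolar3_comp:
  fixes A :: "complex ^ 3 ^ 3"
  assumes f: "f \<in> forms d"
    and "\<And>b c. (\<lambda>a. \<Phi> a b c) \<in> forms d" "\<And>a c. (\<lambda>b. \<Phi> a b c) \<in> forms d" "\<And>a b. (\<lambda>c. \<Phi> a b c) \<in> forms d"
  defines "f' \<equiv> (\<lambda>v. f (A *v v))" and "T \<equiv> (*v) (transpose A)"
  shows "apolar d f' (\<lambda>a. apolar d f' (\<lambda>b. apolar d f' (\<lambda>c. \<Phi> a b c)))
    = apolar d f (\<lambda>a. apolar d f (\<lambda>b. apolar d f (\<lambda>c. \<Phi> (T a) (T b) (T c))))"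
proof -
  have "apolar d f' \<psi> = apolar d f (\<lambda>u. \<psi> (T u))" if "\<psi> \<in> forms d" for \<psi>
    unfolding f'_def T_def by (rule apolar_comp[OF f that])
  then show ?thesis by (simp add: assms(2-4) forms_apolar)
qed

lemma apolar6_comp:
  fixes A :: "complex ^ 3 ^ 3"
  assumes f: "f \<in> forms d"
    and "\<And>b c k l m. (\<lambda>a. \<Phi> a b c k l m) \<in> forms d" "\<And>a c k l m. (\<lambda>b. \<Phi> a b c k l m) \<in> forms d"
      "\<And>a b k l m. (\<lambda>c. \<Phi> a b c k l m) \<in> forms d" "\<And>a b c l m. (\<lambda>k. \<Phi> a b c k l m) \<in> forms d"
      "\<And>a b c k m. (\<lambda>l. \<Phi> a b c k l m) \<in> forms d" "\<And>a b c k l. (\<lambda>m. \<Phi> a b c k l m) \<in> forms d"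
  defines "f' \<equiv> (\<lambda>v. f (A *v v))" and "T \<equiv> (*v) (transpose A)"
  shows "apolar d f' (\<lambda>a. apolar d f' (\<lambda>b. apolar d f' (\<lambda>c. apolar d f' (\<lambda>k. apolar d f' (\<lambda>l. apolar d f' (\<lambda>m. \<Phi> a b c k l m))))))
    = apolar d f (\<lambda>a. apolar d f (\<lambda>b. apolar d f (\<lambda>c. apolar d f (\<lambda>k. apolar d f (\<lambda>l. apolar d f (\<lambda>m. \<Phi> (T a) (T b) (T c) (T k) (T l) (T m)))))))"
proof -
  have "apolar d f' \<psi> = apolar d f (\<lambda>u. \<psi> (T u))" if "\<psi> \<in> forms d" for \<psi>
    unfolding f'_def T_def by (rule apolar_comp[OF f that])
  then show ?thesis by (simp add: assms(2-7) forms_apolar)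
qed

text \<open>In symbolic notation \<open>f = a\<^sup>d = b\<^sup>d = \<dots>\<close>, a polynomial of degree \<open>d\<close> in each symbol that
  is built from brackets and from values at marked points is invariant. The sextic is chosen such
  that on the Fermat form only the assignments with \<open>a, b, c\<close> distinct, \<open>k = c\<close>, \<open>l = a\<close> and
  \<open>m = b\<close> contribute, and all of them with the same sign, whatever the parity of \<open>d\<close>.\<close>

definition sextic_symbol where
  "sextic_symbol d a b c k l m = det3 a b c ^ (d - 2) * det3 a b k * det3 b c l * det3 c a m * det3 k l m ^ (d - 1)"

definition sextic_inv :: "nat \<Rightarrow> form \<Rightarrow> complex" where
  "sextic_inv d f = apolar d f (\<lambda>a. apolar d f (\<lambda>b. apolar d f (\<lambda>c. apolar d f (\<lambda>k. apolar d f (\<lambda>l. apolar d f (\<lambda>m. sextic_symbol d a b c k l m))))))"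

text \<open>The classical symbol of the Hessian: up to a constant factor, the pairing below gives
  the determinant of the second partial derivatives of \<open>f\<close> at \<open>p\<close>.\<close>

definition hessian_symbol where
  "hessian_symbol d p a b c = det3 a b c ^ 2 * dot3 a p ^ (d - 2) * dot3 b p ^ (d - 2) * dot3 c p ^ (d - 2)"

definition hessian_inv :: "nat \<Rightarrow> form \<Rightarrow> complex ^ 3 \<Rightarrow> complex" where
  "hessian_inv d f p = apolar d f (\<lambda>a. apolar d f (\<lambda>b. apolar d f (\<lambda>c. hessian_symbol d p a b c)))"

text \<open>Up to the factor \<open>d\<close>, the derivative of \<open>f\<close> at
  \<open>p\<close> in the direction \<open>q\<close>; at a smooth point \<open>p\<close> of the
  curve it vanishes exactly when \<open>q\<close> lies on the tangent line.\<close>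

definition polar_inv :: "nat \<Rightarrow> form \<Rightarrow> complex ^ 3 \<Rightarrow> complex ^ 3 \<Rightarrow> complex" where
  "polar_inv d f p q = apolar d f (\<lambda>a. dot3 a p ^ (d - 1) * dot3 a q)"

lemma forms_sextic_symbol:
  assumes "2 \<le> d"
  shows "(\<lambda>a. sextic_symbol d a b c k l m) \<in> forms d" "(\<lambda>b. sextic_symbol d a b c k l m) \<in> forms d" "(\<lambda>c. sextic_symbol d a b c k l m) \<in> forms d"
    "(\<lambda>k. sextic_symbol d a b c k l m) \<in> forms d" "(\<lambda>l. sextic_symbol d a b c k l m) \<in> forms d" "(\<lambda>m. sextic_symbol d a b c k l m) \<in> forms d"
proof -
  \<comment> \<open>The summands are the degrees of the five factors in the given symbol, in the
    shape produced by \<open>forms_mult\<close> and \<open>forms_power\<close>; a factor without the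
    symbol counts as a constant of degree 0.\<close>
  have deg: "(d-2) * 1 + 1 + 0 + 1 + 0 = d" "(d-2) * 1 + 1 + 1 + 0 + 0 = d" "(d-2) * 1 + 0 + 1 + 1 + 0 = d"
    "0 + 1 + 0 + 0 + (d - 1) * 1 = d" "0 + 0 + 1 + 0 + (d - 1) * 1 = d" "0 + 0 + 0 + 1 + (d - 1) * 1 = d"
    using assms by simp_all
  have "(\<lambda>a. sextic_symbol d a b c k l m) \<in> forms ((d-2) * 1 + 1 + 0 + 1 + 0)" "(\<lambda>b. sextic_symbol d a b c k l m) \<in> forms ((d-2) * 1 + 1 + 1 + 0 + 0)" "(\<lambda>c. sextic_symbol d a b c k l m) \<in> forms ((d-2) * 1 + 0 + 1 + 1 + 0)"
    "(\<lambda>k. sextic_symbol d a b c k l m) \<in> forms (0 + 1 + 0 + 0 + (d - 1) * 1)" "(\<lambda>l. sextic_symbol d a b c k l m) \<in> forms (0 + 0 + 1 + 0 + (d - 1) * 1)" "(\<lambda>m. sextic_symbol d a b c k l m) \<in> forms (0 + 0 + 0 + 1 + (d - 1) * 1)"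
    unfolding sextic_symbol_def by (intro forms_mult forms_power forms_det3 forms_const)+
  then show "(\<lambda>a. sextic_symbol d a b c k l m) \<in> forms d" "(\<lambda>b. sextic_symbol d a b c k l m) \<in> forms d" "(\<lambda>c. sextic_symbol d a b c k l m) \<in> forms d"
    "(\<lambda>k. sextic_symbol d a b c k l m) \<in> forms d" "(\<lambda>l. sextic_symbol d a b c k l m) \<in> forms d" "(\<lambda>m. sextic_symbol d a b c k l m) \<in> forms d"
    unfolding deg by blast+
qed

lemma forms_hessian_symbol:
  assumes "2 \<le> d"
  shows "(\<lambda>a. hessian_symbol d p a b c) \<in> forms d" "(\<lambda>b. hessian_symbol d p a b c) \<in> forms d" "(\<lambda>c. hessian_symbol d p a b c) \<in> forms d"
proof -
  have deg: "2 * 1 + (d-2) * 1 + 0 + 0 = d" "2 * 1 + 0 + (d-2) * 1 + 0 = d" "2 * 1 + 0 + 0 + (d-2) * 1 = d"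
    using assms by simp_all
  have "(\<lambda>a. hessian_symbol d p a b c) \<in> forms (2 * 1 + (d-2) * 1 + 0 + 0)" "(\<lambda>b. hessian_symbol d p a b c) \<in> forms (2 * 1 + 0 + (d-2) * 1 + 0)"
    "(\<lambda>c. hessian_symbol d p a b c) \<in> forms (2 * 1 + 0 + 0 + (d-2) * 1)"
    unfolding hessian_symbol_def by (intro forms_mult forms_power forms_det3 forms_const forms_dot3)+
  then show "(\<lambda>a. hessian_symbol d p a b c) \<in> forms d" "(\<lambda>b. hessian_symbol d p a b c) \<in> forms d" "(\<lambda>c. hessian_symbol d p a b c) \<in> forms d"
    unfolding deg by blast+
qed

lemma forms_polar_symbol: "1 \<le> d \<Longrightarrow> (\<lambda>a. dot3 a p ^ (d - 1) * dot3 a q) \<in> forms d"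
  using forms_mult[OF forms_power[OF forms_dot3] forms_dot3, of p "d - 1" q] by simp

text \<open>Once the substitution acts on the symbols, every bracket picks up the factor
  \<open>det (transpose A) = 1\<close>. In the Hessian and polar analogues
  \<open>dot3_transpose\<close> then carries the matrix on to the marked points.\<close>

lemma sextic_inv_comp:
  assumes "f \<in> forms d" "2 \<le> d" "det A = 1"
  shows "sextic_inv d (\<lambda>v. f (A *v v)) = sextic_inv d f"
  unfolding sextic_inv_def
  by (subst apolar6_comp[OF assms(1)], (rule forms_sextic_symbol[OF assms(2)])+)
     (simp add: sextic_symbol_def[abs_def] det3_mult assms(3) del: transpose_matrix_vector)

lemma dot3_transpose: "dot3 (transpose A *v a) p = dot3 a (A *v p)"
  by (simp add: dot3_matrix)

lemma hessian_inv_comp: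
  assumes "f \<in> forms d" "2 \<le> d" "det A = 1" "A *v q = p"
  shows "hessian_inv d (\<lambda>v. f (A *v v)) q = hessian_inv d f p"
  unfolding hessian_inv_def
  by (subst apolar3_comp[OF assms(1)], (rule forms_hessian_symbol[OF assms(2)])+)
     (simp add: hessian_symbol_def[abs_def] det3_mult assms dot3_transpose del: transpose_matrix_vector)

lemma polar_inv_comp:
  assumes "f \<in> forms d" "1 \<le> d" "A *v p' = p" "A *v q' = q"
  shows "polar_inv d (\<lambda>v. f (A *v v)) p' q' = polar_inv d f p q"
  unfolding polar_inv_def
  by (subst apolar_comp[OF assms(1) forms_polar_symbol[OF assms(2)]]) (simp add: assms dot3_transpose del: transpose_matrix_vector)

lemma sextic_inv_scale: "sextic_inv d (\<lambda>v. c * f v) = c ^ 6 * sextic_inv d f"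
  unfolding sextic_inv_def apolar_scale apolar_scale_right by (simp add: power_numeral_reduce mult.assoc)

lemma dot3_scale: "dot3 a (c *s p) = c * dot3 a p"
  by (simp add: dot3_def algebra_simps)

lemma hessian_inv_scale: "hessian_inv d (\<lambda>v. c * f v) (e *s p) = c ^ 3 * e ^ (3 * (d - 2)) * hessian_inv d f p"
proof -
  have "hessian_symbol d (e *s p) a b = (\<lambda>k. e ^ (3 * (d - 2)) * hessian_symbol d p a b k)" for a b
    by (simp add: fun_eq_iff hessian_symbol_def dot3_scale power_mult_distrib power_mult[of e 3] power3_eq_cube mult_ac)
  then show ?thesis
    unfolding hessian_inv_def apolar_scale by (simp only: apolar_scale_right) (simp add: power3_eq_cube mult_ac)
qed

lemma polar_inv_scale:
  "polar_inv d (\<lambda>v. c * f v) (e *s p) (e' *s q) = c * e ^ (d - 1) * e' * polar_inv d f p q"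
proof -
  have "dot3 a (e *s p) ^ (d - 1) * dot3 a (e' *s q) = (e ^ (d - 1) * e') * (dot3 a p ^ (d - 1) * dot3 a q)" for a
    by (simp add: dot3_scale power_mult_distrib mult_ac)
  then show ?thesis unfolding polar_inv_def by (simp only: apolar_scale apolar_scale_right) (simp add: mult_ac)
qed

lemma polys_dot3: "i \<in> {1..n} \<Longrightarrow> (\<lambda>x. dot3 a (snd x i)) \<in> polys (coords n)"
  unfolding dot3_def by (intro polys.add polys.mult polys.const polys_snd)

lemma polys_sextic_inv: "(\<lambda>x. sextic_inv d (fst x)) \<in> polys (coords n)"
  unfolding sextic_inv_def by (intro polys_apolar polys_fst polys.const)

lemma polys_hessian_inv: "i \<in> {1..n} \<Longrightarrow> (\<lambda>x. hessian_inv d (fst x) (snd x i)) \<in> polys (coords n)"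
  unfolding hessian_inv_def hessian_symbol_def by (intro polys_apolar polys_fst polys.mult polys.const polys_power polys_dot3)

lemma polys_polar_inv: "i \<in> {1..n} \<Longrightarrow> j \<in> {1..n} \<Longrightarrow> (\<lambda>x. polar_inv d (fst x) (snd x i) (snd x j)) \<in> polys (coords n)"
  unfolding polar_inv_def by (intro polys_apolar polys_fst polys.mult polys.const polys_power polys_dot3)

lemma polys_det3: "i \<in> {1..n} \<Longrightarrow> j \<in> {1..n} \<Longrightarrow> k \<in> {1..n} \<Longrightarrow> (\<lambda>x. det3 (snd x i) (snd x j) (snd x k)) \<in> polys (coords n)"
  unfolding det3_def by (intro polys.add polys_diff polys.mult polys_snd)

section \<open>Values of the invariants on the Fermat form\<close>

definition fermat :: "nat \<Rightarrow> form" where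
  "fermat d v = (v $ 1) ^ d + (v $ 2) ^ d - (v $ 3) ^ d"

abbreviation e3 :: "3 \<Rightarrow> complex ^ 3" where "e3 k \<equiv> axis k 1"

lemma dot3_e3: "dot3 (e3 k) v = v $ k"
  using exhaust_3[of k] by (auto simp: dot3_def axis_def)

lemma fermat_forms: "fermat d \<in> forms d"
proof -
  have "(\<lambda>v. (v $ k) ^ d) \<in> forms d" for k using forms_power[OF forms_nth, of k d] by simp
  then show ?thesis unfolding fermat_def[abs_def] by (intro forms_add forms_diff)
qed

text \<open>The Fermat form is its own Waring decomposition, with the coordinate functions as linear
  forms.\<close>

lemma apolar_fermat:
  assumes "\<psi> \<in> forms d"
  shows "apolar d (fermat d) \<psi> = \<psi> (e3 1) + \<psi> (e3 2) - \<psi> (e3 3)"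
proof -
  have "apolar d (fermat d) \<psi> = (\<Sum>k\<in>UNIV. (if k = 3 then - 1 else 1) * \<psi> (e3 k))"
    by (rule apolar_waring[OF _ assms]) (simp add: fermat_def dot3_e3 sum_3)
  then show ?thesis by (simp add: sum_3)
qed

text \<open>Arithmetic in the index type \<open>3\<close> is modulo 3, so for distinct indices
  \<open>j = i + 1\<close> singles out the even permutations.\<close>

lemma det3_e3:
  "det3 (e3 i) (e3 j) (e3 k) = of_int (if i = j \<or> j = k \<or> k = i then 0 else if j = i + 1 then 1 else - 1)"
  using exhaust_3[of i] exhaust_3[of j] exhaust_3[of k] by (auto simp: det3_def axis_def)

lemma polar_inv_fermat: "1 \<le> d \<Longrightarrow> polar_inv d (fermat d) p q = (p $ 1) ^ (d - 1) * q $ 1 + (p $ 2) ^ (d - 1) * q $ 2 - (p $ 3) ^ (d - 1) * q $ 3"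
  unfolding polar_inv_def by (subst apolar_fermat[OF forms_polar_symbol]) (auto simp: dot3_e3)

text \<open>The squared bracket is 1 on the six orderings of the coordinate vectors and 0 otherwise;
  the vector \<open>e3 3\<close>, used once, contributes the sign.\<close>

lemma hessian_inv_fermat: "2 \<le> d \<Longrightarrow> hessian_inv d (fermat d) p = - 6 * (p $ 1 * p $ 2 * p $ 3) ^ (d - 2)"
  unfolding hessian_inv_def
  by (simp add: apolar_fermat forms_apolar forms_hessian_symbol forms_add forms_diff)
    (simp add: hessian_symbol_def dot3_e3 det3_e3 power_mult_distrib)

text \<open>The brackets \<open>abk\<close>, \<open>bcl\<close>, \<open>cam\<close> force
  \<open>a, b, c\<close> to be distinct and then \<open>k = c\<close>, \<open>l = a\<close>,
  \<open>m = b\<close>. Every remaining bracket equals \<open>det3 a b c\<close>, with total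
  exponent \<open>2 * d\<close>, and \<open>e3 3\<close> is used twice, so each of the six orderings
  contributes 1.\<close>

lemma sextic_inv_fermat:
  assumes "2 \<le> d"
  shows "sextic_inv d (fermat d) = 6"
proof -
  obtain k where d: "d = k + 2" using assms by (metis add.commute le_Suc_ex)
  have 1: "(-1::complex) ^ k * ((-1) ^ k) = 1" by (simp flip: power_mult_distrib)
  have 0: "(0::complex) ^ (d - Suc 0) = 0" using assms by simp
  define G where "G a b c i j k = det3 a b (e3 i) * det3 b c (e3 j) * det3 c a (e3 k)" for a b c i j k
  \<comment> \<open>The pairings in \<open>k, l, m\<close> are evaluated with \<open>a, b, c\<close>
    still symbolic, which avoids expanding all assignments of six symbols at once. Since
    \<open>d - 1 > 0\<close>, the last bracket leaves only the six permutations.\<close>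
  have inner: "apolar d (fermat d) (\<lambda>k. apolar d (fermat d) (\<lambda>l. apolar d (fermat d) (\<lambda>m. sextic_symbol d a b c k l m)))
      = (-1) * det3 a b c ^ (d - 2) * (G a b c 1 2 3 + G a b c 2 3 1 + G a b c 3 1 2
        + (-1) ^ (d - 1) * (G a b c 1 3 2 + G a b c 2 1 3 + G a b c 3 2 1))" for a b c
    using assms
    by (simp add: apolar_fermat forms_apolar forms_sextic_symbol forms_add forms_diff)
      (simp add: sextic_symbol_def det3_e3 0 G_def algebra_simps)
  have "(\<lambda>a. apolar d (fermat d) (\<lambda>k. apolar d (fermat d) (\<lambda>l. apolar d (fermat d) (\<lambda>m. sextic_symbol d a b c k l m)))) \<in> forms d"
     "(\<lambda>b. apolar d (fermat d) (\<lambda>k. apolar d (fermat d) (\<lambda>l. apolar d (fermat d) (\<lambda>m. sextic_symbol d a b c k l m)))) \<in> forms d"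
     "(\<lambda>c. apolar d (fermat d) (\<lambda>k. apolar d (fermat d) (\<lambda>l. apolar d (fermat d) (\<lambda>m. sextic_symbol d a b c k l m)))) \<in> forms d"
    for a b c
    by (simp_all add: forms_apolar forms_sextic_symbol assms)
  note forms = this[unfolded inner]
  show ?thesis
    unfolding sextic_inv_def inner
    by (simp only: apolar_fermat forms_apolar forms forms_add forms_diff)
      (simp add: G_def det3_e3 d 1)
qed

section \<open>Semistability and a marked Fermat curve\<close>

lemma matrix_inv_SL:
  fixes g :: "complex ^ 3 ^ 3"
  assumes "det g = 1"
  shows "matrix_inv g ** g = mat 1" "g ** matrix_inv g = mat 1" "det (matrix_inv g) = 1"
proof -
  have "invertible g" using assms by (simp add: invertible_det_nz)
  then have "g ** matrix_inv g = mat 1 \<and> matrix_inv g ** g = mat 1"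
    unfolding invertible_def matrix_inv_def by (rule someI_ex)
  then show 1: "matrix_inv g ** g = mat 1" "g ** matrix_inv g = mat 1" by auto
  have "det g * det (matrix_inv g) = 1" using 1(2) by (metis det_mul det_I)
  then show "det (matrix_inv g) = 1" using assms by simp
qed

lemma matrix_inv_SL_mult:
  fixes g :: "complex ^ 3 ^ 3"
  assumes "det g = 1"
  shows "matrix_inv g *v (g *v v) = v" "g *v (matrix_inv g *v v) = v"
  using matrix_inv_SL[OF assms] by (simp_all add: matrix_vector_mul_assoc)

lemma act_multicone:
  assumes "x \<in> multicone n d" "det g = 1"
  shows "act n g x \<in> multicone n d"
proof -
  obtain f p where x: "x = (f, p)" by fastforce
  have f: "f \<in> forms d" "f \<noteq> (\<lambda>_. 0)" and p: "p \<in> {1..n} \<rightarrow>\<^sub>E (UNIV - {0})" "\<forall>i\<in>{1..n}. f (p i) = 0"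
    using assms(1) by (auto simp: x multicone_def)
  obtain v where v: "f v \<noteq> 0" using f(2) by auto
  have "(\<lambda>v. f (matrix_inv g *v v)) \<noteq> (\<lambda>_. 0)"
    using v matrix_inv_SL_mult(1)[OF assms(2), of v] by metis
  moreover have "g *v p i \<noteq> 0" if "i \<in> {1..n}" for i
  proof
    assume "g *v p i = 0"
    then have "p i = 0" using matrix_inv_SL_mult(1)[OF assms(2), of "p i"] by simp
    then show False using p(1) that by auto
  qed
  ultimately show ?thesis
    using p(2) forms_comp[OF f(1)]
    by (simp add: act_def x multicone_def matrix_inv_SL_mult[OF assms(2)] Pi_iff)
qed

lemma regular_poly: "s \<in> polys (coords n) \<Longrightarrow> regular n d s"
  unfolding regular_def by (intro ballI bexI[of _ s] bexI[of _ "\<lambda>_. 1"]) (simp_all add: polys.const)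

lemma regular_mult:
  assumes "regular n d s" "regular n d s'"
  shows "regular n d (\<lambda>x. s x * s' x)"
  unfolding regular_def
proof
  fix x assume x: "x \<in> multicone n d"
  obtain P Q where 1: "P \<in> polys (coords n)" "Q \<in> polys (coords n)" "Q x \<noteq> 0" "\<forall>y\<in>multicone n d. Q y \<noteq> 0 \<longrightarrow> s y = P y / Q y"
    using bspec[OF assms(1)[unfolded regular_def] x] by (elim bexE conjE)
  obtain P' Q' where 2: "P' \<in> polys (coords n)" "Q' \<in> polys (coords n)" "Q' x \<noteq> 0" "\<forall>y\<in>multicone n d. Q' y \<noteq> 0 \<longrightarrow> s' y = P' y / Q' y"
    using bspec[OF assms(2)[unfolded regular_def] x] by (elim bexE conjE)
  show "\<exists>P\<in>polys (coords n). \<exists>Q\<in>polys (coords n). Q x \<noteq> 0 \<and> (\<forall>y\<in>multicone n d. Q y \<noteq> 0 \<longrightarrow> s y * s' y = P y / Q y)"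
  proof (rule bexI, rule bexI)
    show "Q x * Q' x \<noteq> 0 \<and> (\<forall>y\<in>multicone n d. Q y * Q' y \<noteq> 0 \<longrightarrow> s y * s' y = (P y * P' y) / (Q y * Q' y))"
      using 1(3,4) 2(3,4) by simp
  qed (rule polys.mult 1(1,2) 2(1,2))+
qed

lemma sections_mult:
  assumes "s \<in> sections n d a b" "s' \<in> sections n d a' b'"
  shows "(\<lambda>x. s x * s' x) \<in> sections n d (a + a') (\<lambda>i. b i + b' i)"
  using assms
  by (auto simp: sections_def multihomogeneous_def regular_mult power_int_add prod.distrib)

lemma sections_one: "(\<lambda>_. 1) \<in> sections n d 0 (\<lambda>_. 0)"
  by (auto simp: sections_def multihomogeneous_def intro!: regular_poly polys.const)

lemma sections_power:
  assumes "s \<in> sections n d a b"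
  shows "(\<lambda>x. s x ^ k) \<in> sections n d (int k * a) (\<lambda>i. int k * b i)"
proof (induction k)
  case 0
  then show ?case using sections_one by simp
next
  case (Suc k)
  then show ?case using sections_mult[OF assms Suc] by (simp add: distrib_right)
qed

lemma cleared_cong: "(\<And>i. i \<in> {1..n} \<Longrightarrow> w i = w' i) \<Longrightarrow> cleared n m \<gamma> w a b = cleared n m \<gamma> w' a b"
  by (auto simp: cleared_def)

lemma semistable_cong: "(\<And>i. i \<in> {1..n} \<Longrightarrow> w i = w' i) \<Longrightarrow> semistable n d \<gamma> w = semistable n d \<gamma> w'"
proof -
  assume "\<And>i. i \<in> {1..n} \<Longrightarrow> w i = w' i"
  then have "cleared n m \<gamma> w = cleared n m \<gamma> w'" for m by (intro ext cleared_cong)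
  then show ?thesis by (simp add: semistable_def)
qed

lemma semistableI:
  assumes "x \<in> multicone n d" "m > 0" "s \<in> sections n d a b" "cleared n m \<gamma> w a b" "invariant n d s" "s x \<noteq> 0"
  shows "x \<in> semistable n d \<gamma> w"
  using assms unfolding semistable_def by blast

lemma semistableE:
  assumes "x \<in> semistable n d \<gamma> w"
  obtains m a b s where "x \<in> multicone n d" "m > 0" "s \<in> sections n d a b" "cleared n m \<gamma> w a b" "invariant n d s" "s x \<noteq> 0"
  using assms unfolding semistable_def by blast

text \<open>Raising each section to the multiplier of the other class gives both the common
  multiplier \<open>m * m'\<close>, and their product does not vanish at \<open>x\<close>.\<close>

lemma semistable_add:
  assumes "x \<in> semistable n d \<gamma> w" "x \<in> semistable n d \<gamma>' w'"
  shows "x \<in> semistable n d (\<gamma> + \<gamma>') (\<lambda>i. w i + w' i)"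
proof -
  obtain m a b s where 1: "x \<in> multicone n d" "m > 0" "s \<in> sections n d a b" "cleared n m \<gamma> w a b" "invariant n d s" "s x \<noteq> 0"
    using assms(1) by (rule semistableE)
  obtain m' a' b' s' where 2: "m' > 0" "s' \<in> sections n d a' b'" "cleared n m' \<gamma>' w' a' b'" "invariant n d s'" "s' x \<noteq> 0"
    using assms(2) by (rule semistableE)
  show ?thesis
  proof (rule semistableI[OF 1(1)])
    show "m * m' > 0" using 1 2 by simp
    show "(\<lambda>x. s x ^ m' * s' x ^ m) \<in> sections n d (int m' * a + int m * a') (\<lambda>i. int m' * b i + int m * b' i)"
      by (intro sections_mult sections_power 1 2)
    show "cleared n (m * m') (\<gamma> + \<gamma>') (\<lambda>i. w i + w' i) (int m' * a + int m * a') (\<lambda>i. int m' * b i + int m * b' i)"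
      using 1(4) 2(3) by (auto simp: cleared_def algebra_simps)
    show "invariant n d (\<lambda>x. s x ^ m' * s' x ^ m)" using 1(5) 2(4) by (auto simp: invariant_def)
    show "s x ^ m' * s' x ^ m \<noteq> 0" using 1 2 by simp
  qed
qed

lemma semistable_scale:
  assumes "x \<in> semistable n d \<gamma> w" "q \<ge> 0"
  shows "x \<in> semistable n d (q * \<gamma>) (\<lambda>i. q * w i)"
proof -
  obtain m a b s where 1: "x \<in> multicone n d" "m > 0" "s \<in> sections n d a b" "cleared n m \<gamma> w a b" "invariant n d s" "s x \<noteq> 0"
    using assms(1) by (rule semistableE)
  obtain u v where uv: "quotient_of q = (u, v)" by fastforce
  then have v: "v > 0" and q: "q = of_int u / of_int v" by (auto simp: quotient_of_denom_pos quotient_of_div)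
  have "u \<ge> 0" using assms(2) v by (auto simp: q zero_le_divide_iff)
  then obtain U V :: nat where UV: "u = int U" "v = int V"
    using v nonneg_int_cases[of u] nonneg_int_cases[of v] by (metis less_imp_le)
  have V: "V > 0" using v UV by simp
  show ?thesis
  proof (rule semistableI[OF 1(1)])
    show "m * V > 0" using 1 V by simp
    show "(\<lambda>x. s x ^ U) \<in> sections n d (int U * a) (\<lambda>i. int U * b i)"
      by (intro sections_power 1)
    show "cleared n (m * V) (q * \<gamma>) (\<lambda>i. q * w i) (int U * a) (\<lambda>i. int U * b i)"
      using 1(4) V by (auto simp: cleared_def q UV)
    show "invariant n d (\<lambda>x. s x ^ U)" using 1(5) by (auto simp: invariant_def)
    show "s x ^ U \<noteq> 0" using 1 by simp
  qed
qed

lemma semistable_zero: "x \<in> multicone n d \<Longrightarrow> x \<in> semistable n d 0 (\<lambda>_. 0)"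
  by (rule semistableI[where m = 1 and s = "\<lambda>_. 1", OF _ _ sections_one]) (auto simp: cleared_def invariant_def)

lemma semistable_sum:
  assumes "x \<in> multicone n d" "\<And>k. k \<in> K \<Longrightarrow> x \<in> semistable n d (\<gamma> k) (w k)"
  shows "x \<in> semistable n d (\<Sum>k\<in>K. \<gamma> k) (\<lambda>i. \<Sum>k\<in>K. w k i)"
  using assms(2)
  by (induction K rule: infinite_finite_induct) (auto intro: semistable_zero[OF assms(1)] semistable_add)

lemma prod_powi_delta:
  fixes i n :: nat
  assumes "i \<in> {1..n}"
  shows "(\<Prod>k\<in>{1..n}. \<beta> k powi (if k = i then c else 0)) = (\<beta> i powi c :: complex)"
proof -
  have "(\<Prod>k\<in>{1..n}. \<beta> k powi (if k = i then c else 0)) = (\<Prod>k\<in>{1..n}. if k = i then \<beta> k powi c else 1)"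
    by (intro prod.cong) auto
  also have "\<dots> = \<beta> i powi c" using assms by (subst prod.delta) auto
  finally show ?thesis .
qed

definition unit_weight :: "nat \<Rightarrow> nat \<Rightarrow> rat" where "unit_weight i = (\<lambda>j. if j = i then 1 else 0)"

lemma sections_polyI: "s \<in> polys (coords n) \<Longrightarrow> multihomogeneous n d a b s \<Longrightarrow> s \<in> sections n d a b"
  by (simp add: sections_def regular_poly)

lemma multicone_forms: "x \<in> multicone n d \<Longrightarrow> fst x \<in> forms d"
  by (auto simp: multicone_def)

text \<open>The multiplier is the degree of the invariant in \<open>f\<close>, which normalizes the
  class to \<gamma> = 1; the same convention gives 3 for the Hessian and 1 for the polar.\<close>

lemma semistable_sextic:
  assumes "x \<in> multicone n d" "2 \<le> d" "sextic_inv d (fst x) \<noteq> 0"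
  shows "x \<in> semistable n d 1 (\<lambda>_. 0)"
proof (rule semistableI[OF assms(1)])
  show "(0::nat) < 6" by simp
  show "(\<lambda>x. sextic_inv d (fst x)) \<in> sections n d 6 (\<lambda>_. 0)"
    by (rule sections_polyI[OF polys_sextic_inv]) (simp add: multihomogeneous_def rescale_def sextic_inv_scale)
  show "cleared n 6 1 (\<lambda>_. 0) 6 (\<lambda>_. 0)" by (simp add: cleared_def)
  show "invariant n d (\<lambda>x. sextic_inv d (fst x))"
    unfolding invariant_def using assms(2)
    by (auto simp: act_def sextic_inv_comp[OF multicone_forms] matrix_inv_SL(3))
qed fact

lemma semistable_hessian:
  assumes "x \<in> multicone n d" "2 \<le> d" "i \<in> {1..n}" "hessian_inv d (fst x) (snd x i) \<noteq> 0"
  shows "x \<in> semistable n d 1 (\<lambda>j. (of_nat d - 2) * unit_weight i j)"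
proof (rule semistableI[OF assms(1)])
  let ?b = "\<lambda>k. if k = i then 3 * (int d - 2) else 0"
  have p: "\<beta> powi (3 * int d - 6) = \<beta> ^ (3 * (d - 2))" for \<beta> :: complex
    using assms(2) by (subst power_int_of_nat[symmetric]) (simp add: of_nat_diff)
  show "(0::nat) < 3" by simp
  show "(\<lambda>x. hessian_inv d (fst x) (snd x i)) \<in> sections n d 3 ?b"
    using assms(3) prod_powi_delta[OF assms(3), of _ "3 * (int d - 2)"]
    by (intro sections_polyI[OF polys_hessian_inv[OF assms(3)]]) (simp add: multihomogeneous_def rescale_def hessian_inv_scale p)
  show "cleared n 3 1 (\<lambda>j. (of_nat d - 2) * unit_weight i j) 3 ?b" by (simp add: cleared_def unit_weight_def)
  show "invariant n d (\<lambda>x. hessian_inv d (fst x) (snd x i))"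
    unfolding invariant_def using assms(2,3)
    by (auto simp: act_def hessian_inv_comp[OF multicone_forms] matrix_inv_SL(3) matrix_inv_SL_mult(1))
qed fact

lemma semistable_polar:
  assumes "x \<in> multicone n d" "2 \<le> d" "i \<in> {1..n}" "j \<in> {1..n}" "polar_inv d (fst x) (snd x i) (snd x j) \<noteq> 0"
  shows "x \<in> semistable n d 1 (\<lambda>k. (of_nat d - 1) * unit_weight i k + unit_weight j k)"
proof (rule semistableI[OF assms(1)])
  let ?b = "\<lambda>k. (if k = i then int d - 1 else 0) + (if k = j then 1 else 0)"
  have p: "\<beta> powi (int d - 1) = \<beta> ^ (d - 1)" for \<beta> :: complex
    using assms(2) by (subst power_int_of_nat[symmetric]) (simp add: of_nat_diff)
  show "(0::nat) < 1" by simp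
  have "(\<Prod>k\<in>{1..n}. \<beta> k powi ?b k) = \<beta> i ^ (d - 1) * \<beta> j" if "\<forall>k\<in>{1..n}. \<beta> k \<noteq> 0" for \<beta> :: "nat \<Rightarrow> complex"
  proof -
    have "(\<Prod>k\<in>{1..n}. \<beta> k powi ?b k) = (\<Prod>k\<in>{1..n}. \<beta> k powi (if k = i then int d - 1 else 0)) * (\<Prod>k\<in>{1..n}. \<beta> k powi (if k = j then 1 else 0))"
      unfolding prod.distrib[symmetric] using that by (intro prod.cong refl power_int_add) auto
    then show ?thesis unfolding prod_powi_delta[OF assms(3)] prod_powi_delta[OF assms(4)] by (simp add: p)
  qed
  then show "(\<lambda>x. polar_inv d (fst x) (snd x i) (snd x j)) \<in> sections n d 1 ?b"
    by (intro sections_polyI[OF polys_polar_inv[OF assms(3,4)]])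
      (use assms(3,4) in \<open>simp add: multihomogeneous_def rescale_def polar_inv_scale\<close>)
  show "cleared n 1 1 (\<lambda>k. (of_nat d - 1) * unit_weight i k + unit_weight j k) 1 ?b" by (simp add: cleared_def unit_weight_def)
  show "invariant n d (\<lambda>x. polar_inv d (fst x) (snd x i) (snd x j))"
    unfolding invariant_def using assms(2,3,4)
    by (auto simp: act_def polar_inv_comp[OF multicone_forms] matrix_inv_SL_mult(1))
qed fact

lemma semistable_bracket:
  assumes "x \<in> multicone n d" "i \<in> {1..n}" "j \<in> {1..n}" "l \<in> {1..n}" "det3 (snd x i) (snd x j) (snd x l) \<noteq> 0"
  shows "x \<in> semistable n d 0 (\<lambda>k. unit_weight i k + unit_weight j k + unit_weight l k)"
proof (rule semistableI[OF assms(1)])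
  let ?b = "\<lambda>k. (if k = i then 1 else 0) + (if k = j then 1 else 0) + (if k = l then 1 else 0)"
  show "(0::nat) < 1" by simp
  have "(\<Prod>k\<in>{1..n}. \<beta> k powi ?b k) = \<beta> i * \<beta> j * \<beta> l" if "\<forall>k\<in>{1..n}. \<beta> k \<noteq> 0" for \<beta> :: "nat \<Rightarrow> complex"
  proof -
    have "(\<Prod>k\<in>{1..n}. \<beta> k powi ?b k) = (\<Prod>k\<in>{1..n}. \<beta> k powi (if k = i then 1 else 0)) * (\<Prod>k\<in>{1..n}. \<beta> k powi (if k = j then 1 else 0)) * (\<Prod>k\<in>{1..n}. \<beta> k powi (if k = l then 1 else 0))"
      unfolding prod.distrib[symmetric] using that by (intro prod.cong refl) (auto simp: power_int_add)
    then show ?thesis unfolding prod_powi_delta[OF assms(2)] prod_powi_delta[OF assms(3)] prod_powi_delta[OF assms(4)] by simp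
  qed
  then show "(\<lambda>x. det3 (snd x i) (snd x j) (snd x l)) \<in> sections n d 0 ?b"
    by (intro sections_polyI[OF polys_det3[OF assms(2-4)]])
      (use assms(2-4) in \<open>simp add: multihomogeneous_def rescale_def det3_scale\<close>)
  show "cleared n 1 0 (\<lambda>k. unit_weight i k + unit_weight j k + unit_weight l k) 0 ?b" by (simp add: cleared_def unit_weight_def)
  show "invariant n d (\<lambda>x. det3 (snd x i) (snd x j) (snd x l))"
    unfolding invariant_def using assms(2-4)
    by (auto simp: act_def det3_mult)
qed fact

section \<open>Strict convexity of the real Fermat arc\<close>

lemma young_strict:
  fixes a b :: real
  assumes "2 \<le> d" "0 < a" "0 < b" "a \<noteq> b"
  shows "real d * (a ^ (d - 1) * b) < real (d - 1) * a ^ d + b ^ d"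
  using assms(1)
proof (induction d rule: dec_induct)
  case base
  have "0 < (a - b)^2" using assms by simp
  then show ?case by (simp add: power2_eq_square algebra_simps)
next
  case (step k)
  obtain m where k: "k = Suc m" using step by (cases k) auto
  \<comment> \<open>Both factors have the same sign. Adding this rearrangement inequality to
    \<open>a\<close> times the induction hypothesis gives the next exponent.\<close>
  have "(a - b) * (a ^ k - b ^ k) \<ge> 0"
  proof (cases "a \<le> b")
    case True
    then show ?thesis using assms power_mono[of a b k] by (intro mult_nonpos_nonpos) auto
  next
    case False
    then show ?thesis using assms power_mono[of b a k] by (intro mult_nonneg_nonneg) auto
  qed
  moreover have "(real m + 1) * (a ^ m * b) < real m * (a * a ^ m) + b * b ^ m" using step k by (simp add: add.commute)
  then have "a * ((real m + 1) * (a ^ m * b)) < a * (real m * (a * a ^ m) + b * b ^ m)"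
    using assms(2) by (rule mult_strict_left_mono)
  ultimately show ?case by (simp add: k algebra_simps)
qed

lemma young:
  fixes a b :: real
  assumes "2 \<le> d" "0 < a" "0 < b"
  shows "real d * (a ^ (d - 1) * b) \<le> real (d - 1) * a ^ d + b ^ d"
proof (cases "a = b")
  case True
  have "a ^ (d - 1) * a = a ^ d" using assms by (metis Suc_diff_1 less_le_trans pos2 power_Suc2)
  then show ?thesis using assms True by (simp add: of_nat_diff algebra_simps)
qed (use young_strict[OF assms] in auto)

definition arc_y :: "nat \<Rightarrow> real \<Rightarrow> real" where "arc_y d t = root d (1 - t ^ d)"

definition arc :: "nat \<Rightarrow> real \<Rightarrow> complex ^ 3" where
  "arc d t = vector [complex_of_real t, complex_of_real (arc_y d t), 1]"

lemma arc_y: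
  assumes "0 < t" "t < 1" "2 \<le> d"
  shows "0 < arc_y d t" "arc_y d t ^ d = 1 - t ^ d"
proof -
  have "t ^ d < 1" using assms by (simp add: power_less_one_iff)
  then show "0 < arc_y d t" "arc_y d t ^ d = 1 - t ^ d" using assms by (auto simp: arc_y_def)
qed

text \<open>The affine equation of the tangent line at parameter \<open>s\<close>, evaluated at
  parameter \<open>t\<close>; it is also the polar of the Fermat form at these two points.\<close>

definition arc_tangent :: "nat \<Rightarrow> real \<Rightarrow> real \<Rightarrow> real" where
  "arc_tangent d s t = s ^ (d - 1) * t + arc_y d s ^ (d - 1) * arc_y d t - 1"

text \<open>Young's inequality is added over the two coordinates. As both points lie on the curve,
  the right-hand sides sum to \<open>(d - 1) + 1 = d\<close>; strictness comes from the first
  coordinate.\<close>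

lemma arc_tangent_neg:
  assumes "0 < s" "s < 1" "0 < t" "t < 1" "s \<noteq> t" "2 \<le> d"
  shows "arc_tangent d s t < 0"
proof -
  note ys = arc_y[OF assms(1,2,6)] and yt = arc_y[OF assms(3,4,6)]
  have "real d * (s ^ (d - 1) * t) < real (d - 1) * s ^ d + t ^ d" using assms by (intro young_strict) auto
  moreover have "real d * (arc_y d s ^ (d - 1) * arc_y d t) \<le> real (d - 1) * arc_y d s ^ d + arc_y d t ^ d"
    using assms ys yt by (intro young) auto
  ultimately have "real d * arc_tangent d s t < real (d - 1) * (s ^ d + arc_y d s ^ d) + (t ^ d + arc_y d t ^ d) - real d"
    by (simp add: arc_tangent_def algebra_simps)
  also have "\<dots> = 0" using ys yt assms by (simp add: of_nat_diff)
  finally show ?thesis using assms by (simp add: mult_less_0_iff)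
qed

lemma arc_tangent_self:
  assumes "0 < s" "s < 1" "2 \<le> d"
  shows "arc_tangent d s s = 0"
proof -
  have "x ^ (d - 1) * x = x ^ d" for x :: real using assms by (metis Suc_diff_1 less_le_trans pos2 power_Suc2)
  then show ?thesis using arc_y[OF assms] by (simp add: arc_tangent_def)
qed

text \<open>If the three points were collinear, the middle one would be a convex combination of the
  outer ones. The tangent equation at the middle point is affine and vanishes there, but is negative
  at both outer points.\<close>

lemma arc_det3_sorted:
  assumes "0 < r" "r < s" "s < t" "t < 1" "2 \<le> d"
  shows "det3 (arc d r) (arc d s) (arc d t) \<noteq> 0"
proof
  let ?y = "arc_y d"
  assume "det3 (arc d r) (arc d s) (arc d t) = 0"
  then have "complex_of_real (r * (?y s - ?y t) - ?y r * (s - t) + (s * ?y t - ?y s * t)) = 0"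
    by (simp add: det3_def arc_def)
  then have "r * (?y s - ?y t) - ?y r * (s - t) + (s * ?y t - ?y s * t) = 0"
    by (simp only: of_real_eq_0_iff)
  then have 1: "(t - s) * ?y r + (s - r) * ?y t = (t - r) * ?y s" by (simp add: algebra_simps)
  have "(t - s) * arc_tangent d s r + (s - r) * arc_tangent d s t
      = s ^ (d - 1) * ((t - s) * r + (s - r) * t) + ?y s ^ (d - 1) * ((t - s) * ?y r + (s - r) * ?y t) - (t - r)"
    by (simp add: arc_tangent_def algebra_simps)
  also have "\<dots> = (t - r) * arc_tangent d s s" unfolding 1 by (simp add: arc_tangent_def algebra_simps)
  also have "\<dots> = 0" using assms by (simp add: arc_tangent_self)
  finally have "(t - s) * arc_tangent d s r + (s - r) * arc_tangent d s t = 0" .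
  moreover have "(t - s) * arc_tangent d s r < 0" "(s - r) * arc_tangent d s t < 0"
    using assms by (auto intro!: mult_pos_neg arc_tangent_neg)
  ultimately show False by linarith
qed

lemma det3_eq_0_swap: "det3 b a c = 0 \<longleftrightarrow> det3 a b c = 0" "det3 a c b = 0 \<longleftrightarrow> det3 a b c = 0"
  by (metis det3_swap(1) neg_0_equal_iff_equal) (metis det3_swap(2) neg_0_equal_iff_equal)

lemma arc_det3:
  assumes "0 < r" "0 < s" "0 < t" "r < 1" "s < 1" "t < 1" "r \<noteq> s" "s \<noteq> t" "r \<noteq> t" "2 \<le> d"
  shows "det3 (arc d r) (arc d s) (arc d t) \<noteq> 0"
proof -
  have "r < s \<and> s < t \<or> r < t \<and> t < s \<or> s < r \<and> r < t \<or> s < t \<and> t < r \<or> t < r \<and> r < s \<or> t < s \<and> s < r"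
    using assms by linarith
  then show ?thesis
    using arc_det3_sorted[of r s t d] arc_det3_sorted[of r t s d] arc_det3_sorted[of s r t d] arc_det3_sorted[of s t r d]
      arc_det3_sorted[of t r s d] arc_det3_sorted[of t s r d] assms
    by (elim disjE) (auto simp: det3_eq_0_swap)
qed

text \<open>The denominator \<open>n + 1\<close> keeps all parameters, including that of
  \<open>i = n\<close>, strictly between 0 and 1.\<close>

definition arc_point :: "nat \<Rightarrow> nat \<Rightarrow> mcurve" where
  "arc_point n d = (fermat d, \<lambda>i\<in>{1..n}. arc d (of_nat i / of_nat (n + 1)))"

lemma arc_param:
  assumes "i \<in> {1..n}"
  shows "0 < real i / real (n + 1)" "real i / real (n + 1) < 1"
  using assms by auto

lemma arc_point_multicone:
  assumes "2 \<le> d"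
  shows "arc_point n d \<in> multicone n d"
proof -
  have "fermat d (arc d t) = 0" if "0 < t" "t < 1" for t
    using arc_y(2)[OF that assms] by (simp add: fermat_def arc_def flip: of_real_power)
  moreover have "fermat d (e3 1) = 1" using assms by (simp add: fermat_def axis_def)
  then have "fermat d \<noteq> (\<lambda>_. 0)" by (metis zero_neq_one)
  moreover have "arc d t \<noteq> 0" for t by (simp add: arc_def vec_eq_iff forall_3)
  ultimately show ?thesis
    using arc_param[of _ n] by (auto simp: multicone_def arc_point_def fermat_forms)
qed

lemma arc_point_semistable:
  fixes n d
  assumes "2 \<le> d"
  defines "x \<equiv> arc_point n d"
  shows "x \<in> semistable n d 1 (\<lambda>_. 0)"
    and "i \<in> {1..n} \<Longrightarrow> x \<in> semistable n d 1 (\<lambda>j. (of_nat d - 2) * unit_weight i j)"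
    and "i \<in> {1..n} \<Longrightarrow> j \<in> {1..n} \<Longrightarrow> i \<noteq> j \<Longrightarrow> x \<in> semistable n d 1 (\<lambda>k. (of_nat d - 1) * unit_weight i k + unit_weight j k)"
    and "i \<in> {1..n} \<Longrightarrow> j \<in> {1..n} \<Longrightarrow> l \<in> {1..n} \<Longrightarrow> i \<noteq> j \<Longrightarrow> j \<noteq> l \<Longrightarrow> i \<noteq> l \<Longrightarrow>
      x \<in> semistable n d 0 (\<lambda>k. unit_weight i k + unit_weight j k + unit_weight l k)"
proof -
  note x = arc_point_multicone[OF assms(1), of n, folded x_def]
  let ?t = "\<lambda>i. real i / real (n + 1)"
  have f: "fst x = fermat d" by (simp add: x_def arc_point_def)
  have p: "snd x i = arc d (?t i)" if "i \<in> {1..n}" for i using that by (simp add: x_def arc_point_def)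
  have t: "0 < ?t i" "?t i < 1" if "i \<in> {1..n}" for i using that by auto
  have ne: "?t i \<noteq> ?t j" if "i \<noteq> j" for i j using that by simp
  show "x \<in> semistable n d 1 (\<lambda>_. 0)"
    by (rule semistable_sextic[OF x assms(1)]) (simp add: f sextic_inv_fermat assms(1))
  show "x \<in> semistable n d 1 (\<lambda>j. (of_nat d - 2) * unit_weight i j)" if i: "i \<in> {1..n}" for i
  proof (rule semistable_hessian[OF x assms(1) i])
    have "hessian_inv d (fermat d) (arc d s) \<noteq> 0" if "0 < s" "s < 1" for s
      using that arc_y(1)[OF that assms(1)] by (simp add: hessian_inv_fermat[OF assms(1)] arc_def)
    then show "hessian_inv d (fst x) (snd x i) \<noteq> 0" unfolding f p[OF i] using t[OF i] by blast
  qed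
  show "x \<in> semistable n d 1 (\<lambda>k. (of_nat d - 1) * unit_weight i k + unit_weight j k)" if "i \<in> {1..n}" "j \<in> {1..n}" "i \<noteq> j" for i j
  proof (rule semistable_polar[OF x assms(1) that(1,2)])
    have "polar_inv d (fst x) (snd x i) (snd x j) = complex_of_real (arc_tangent d (?t i) (?t j))"
      unfolding f p[OF that(1)] p[OF that(2)] using assms(1) by (subst polar_inv_fermat) (simp_all add: arc_def arc_tangent_def)
    then show "polar_inv d (fst x) (snd x i) (snd x j) \<noteq> 0"
      using arc_tangent_neg[OF t[OF that(1)] t[OF that(2)] ne[OF that(3)] assms(1)] by simp
  qed
  show "x \<in> semistable n d 0 (\<lambda>k. unit_weight i k + unit_weight j k + unit_weight l k)"
    if "i \<in> {1..n}" "j \<in> {1..n}" "l \<in> {1..n}" "i \<noteq> j" "j \<noteq> l" "i \<noteq> l" for i j l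
    by (rule semistable_bracket[OF x that(1-3)], unfold p[OF that(1)] p[OF that(2)] p[OF that(3)])
      (intro arc_det3 t that ne assms)
qed

section \<open>The cone spanned by the four invariants\<close>

text \<open>Each item is repeated consecutively. The second clause records this as a bound on the
  distance between two copies, which is what prevents one item from entering the same subset
  twice.\<close>

lemma wrap_items:
  assumes "finite J"
  obtains g :: "nat \<Rightarrow> 'a" where "\<And>t. t < (\<Sum>i\<in>J. m i) \<Longrightarrow> g t \<in> J"
    "\<And>s t. s \<le> t \<Longrightarrow> t < (\<Sum>i\<in>J. m i) \<Longrightarrow> g s = g t \<Longrightarrow> t < s + m (g t)"
    "\<And>i. i \<in> J \<Longrightarrow> (\<Sum>t<(\<Sum>i\<in>J. m i). if g t = i then 1 else 0) = (of_nat (m i) :: rat)"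
proof -
  have "\<exists>g. (\<forall>t<(\<Sum>i\<in>J. m i). g t \<in> J) \<and> (\<forall>s t. s \<le> t \<longrightarrow> t < (\<Sum>i\<in>J. m i) \<longrightarrow> g s = g t \<longrightarrow> t < s + m (g t)) \<and>
    (\<forall>i\<in>J. (\<Sum>t<(\<Sum>i\<in>J. m i). if g t = i then 1 else 0) = (of_nat (m i) :: rat))"
    using assms
  proof (induction J)
    case empty
    then show ?case by simp
  next
    case (insert a J)
    let ?M = "\<Sum>i\<in>J. m i"
    obtain g where g: "\<forall>t<?M. g t \<in> J" "\<forall>s t. s \<le> t \<longrightarrow> t < ?M \<longrightarrow> g s = g t \<longrightarrow> t < s + m (g t)"
      "\<forall>i\<in>J. (\<Sum>t<?M. if g t = i then 1 else 0) = (of_nat (m i) :: rat)" using insert.IH by blast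
    define h where "h = (\<lambda>t. if t < ?M then g t else a)"
    have M: "(\<Sum>i\<in>insert a J. m i) = ?M + m a" using insert by simp
    have split: "(\<Sum>t<?M + m a. if h t = i then 1 else 0) = (\<Sum>t<?M. if g t = i then 1 else (0::rat)) + (if i = a then of_nat (m a) else 0)" for i
    proof -
      have "{..<?M + m a} = {..<?M} \<union> {?M..<?M + m a}" by auto
      then have "(\<Sum>t<?M + m a. if h t = i then 1 else (0::rat)) = (\<Sum>t<?M. if h t = i then 1 else 0) + (\<Sum>t\<in>{?M..<?M + m a}. if h t = i then 1 else 0)"
        by (simp add: sum.union_disjoint ivl_disj_int)
      moreover have "(\<Sum>t<?M. if h t = i then 1 else (0::rat)) = (\<Sum>t<?M. if g t = i then 1 else 0)"
        by (intro sum.cong) (auto simp: h_def)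
      moreover have "(\<Sum>t\<in>{?M..<?M + m a}. if h t = i then 1 else (0::rat)) = (\<Sum>t\<in>{?M..<?M + m a}. if i = a then 1 else 0)"
        by (intro sum.cong) (auto simp: h_def)
      ultimately show ?thesis by simp
    qed
    have "(\<Sum>t<?M. if g t = a then 1 else (0::rat)) = 0"
      using g(1) insert.hyps by (intro sum.neutral) auto
    then have "\<forall>i\<in>insert a J. (\<Sum>t<?M + m a. if h t = i then 1 else 0) = (of_nat (m i) :: rat)"
      using g(3) insert.hyps by (auto simp: split)
    moreover have "\<forall>t<?M + m a. h t \<in> insert a J" using g(1) by (auto simp: h_def)
    moreover have "t < s + m (h t)" if st: "s \<le> t" "t < ?M + m a" "h s = h t" for s t
    proof (cases "t < ?M")
      case True
      then show ?thesis using st g(2) by (auto simp: h_def)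
    next
      case False
      then have "h t = a" by (simp add: h_def)
      then have "\<not> s < ?M" using st(3) g(1) insert.hyps by (auto simp: h_def)
      then show ?thesis using st \<open>h t = a\<close> by simp
    qed
    ultimately show ?case unfolding M by blast
  qed
  then show thesis using that by blast
qed

lemma sum_blocks:
  fixes f :: "nat \<Rightarrow> 'b :: comm_monoid_add"
  shows "(\<Sum>r<N. \<Sum>t<k. f (r + t * N)) = (\<Sum>q<k * N. f q)"
proof (induction k)
  case (Suc k)
  have "{..<Suc k * N} = {..<k * N} \<union> {k * N..<k * N + N}" by auto
  then have "(\<Sum>q<Suc k * N. f q) = (\<Sum>q<k * N. f q) + (\<Sum>q\<in>{k * N..<k * N + N}. f q)"
    by (simp add: sum.union_disjoint ivl_disj_int)
  also have "(\<Sum>q\<in>{k * N..<k * N + N}. f q) = (\<Sum>r<N. f (r + k * N))"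
    using sum.shift_bounds_nat_ivl[of f 0 "k * N" N] by (simp add: atLeast0LessThan add.commute)
  finally show ?case using Suc by (simp add: sum.distrib)
qed simp

text \<open>McNaughton's wrap-around rule: after clearing denominators the items are laid out one after
  the other on \<open>k * N\<close> cells, and cell \<open>q\<close> is put into the subset number \<open>q mod N\<close>.\<close>

lemma wrap_around:
  fixes w :: "'a \<Rightarrow> rat"
  assumes J: "finite J" and w: "\<And>i. i \<in> J \<Longrightarrow> 0 \<le> w i" and le: "\<And>i. i \<in> J \<Longrightarrow> of_nat k * w i \<le> (\<Sum>j\<in>J. w j)"
    and k: "k > 0"
  obtains N :: nat and c :: rat and g :: "nat \<Rightarrow> nat \<Rightarrow> 'a" where "c \<ge> 0" "\<And>r t. r < N \<Longrightarrow> t < k \<Longrightarrow> g r t \<in> J"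
    "\<And>r. r < N \<Longrightarrow> inj_on (g r) {..<k}"
    "\<And>i. i \<in> J \<Longrightarrow> w i = c * (\<Sum>r<N. \<Sum>t<k. if g r t = i then 1 else 0)"
proof -
  define D where "D = (\<Prod>i\<in>J. snd (quotient_of (w i)))"
  have D: "D > 0" unfolding D_def by (intro prod_pos) (simp add: quotient_of_denom_pos')
  have "\<exists>m::nat. of_nat m = of_int D * w i" if i: "i \<in> J" for i
  proof -
    obtain A B where AB: "quotient_of (w i) = (A, B)" by fastforce
    have "snd (quotient_of (w i)) dvd D" unfolding D_def using J i by (rule dvd_prodI)
    then obtain e where e: "D = B * e" by (auto simp: AB)
    have "w i = of_int A / of_int B" "B > 0" using AB by (auto simp: quotient_of_div quotient_of_denom_pos)
    then have "of_int D * w i = of_int (e * A)" by (simp add: e)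
    moreover have "of_int D * w i \<ge> 0" using D w[OF i] by simp
    ultimately have "of_int (e * A) = of_int D * w i" "0 \<le> e * A" by (simp, metis of_int_0_le_iff)
    then have "of_nat (nat (e * A)) = of_int D * w i" by simp
    then show ?thesis by blast
  qed
  then obtain m :: "'a \<Rightarrow> nat" where m: "\<And>i. i \<in> J \<Longrightarrow> of_nat (m i) = of_int D * w i" by metis
  define N where "N = (\<Sum>i\<in>J. m i)"
  \<comment> \<open>Multiplicities are \<open>k * m i\<close>, so that the number of cells is
    divisible by \<open>k\<close> and the hypothesis \<open>le\<close> becomes
    \<open>k * m i \<le> N\<close>.\<close>
  have M: "(\<Sum>i\<in>J. k * m i) = k * N" by (simp add: N_def sum_distrib_left)
  obtain h where h: "\<And>t. t < k * N \<Longrightarrow> h t \<in> J"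
    "\<And>s t. s \<le> t \<Longrightarrow> t < k * N \<Longrightarrow> h s = h t \<Longrightarrow> t < s + k * m (h t)"
    "\<And>i. i \<in> J \<Longrightarrow> (\<Sum>t<k * N. if h t = i then 1 else 0) = (of_nat (k * m i) :: rat)"
    using wrap_items[OF J, of "\<lambda>i. k * m i", unfolded M] by blast
  have N: "of_nat N = of_int D * (\<Sum>i\<in>J. w i)" unfolding N_def sum_distrib_left of_nat_sum by (intro sum.cong) (auto simp: m)
  have mN: "k * m i \<le> N" if "i \<in> J" for i
  proof -
    have "of_int D * (of_nat k * w i) \<le> of_int D * (\<Sum>i\<in>J. w i)" using le[OF that] D by simp
    then have "(of_nat (k * m i) :: rat) \<le> of_nat N" unfolding N by (simp add: m[OF that] mult_ac)
    then show ?thesis by (simp only: of_nat_le_iff)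
  qed
  have bound: "r + t * N < k * N" if "r < N" "t < k" for r t
  proof -
    have "r + t * N < Suc t * N" using that by simp
    also have "\<dots> \<le> k * N" using that by (intro mult_le_mono1) simp
    finally show ?thesis .
  qed
  \<comment> \<open>Two cells of one residue class are at least \<open>N\<close> apart, whereas
    copies of one item lie less than \<open>k * m i \<le> N\<close> apart.\<close>
  have far: False if "r < N" "s < t" "t < k" "h (r + s * N) = h (r + t * N)" for r s t
  proof -
    have "r + t * N < (r + s * N) + k * m (h (r + t * N))"
      using that bound[of r t] by (intro h(2)) auto
    also have "\<dots> \<le> r + s * N + N" using mN[OF h(1)[OF bound[of r t]]] that by simp
    also have "\<dots> = r + Suc s * N" by simp
    also have "\<dots> \<le> r + t * N" using that by (intro add_left_mono mult_le_mono1) simp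
    finally show False by simp
  qed
  show thesis
  proof (rule that[of "1 / (of_nat k * of_int D)" N "\<lambda>r t. h (r + t * N)"])
    show "inj_on (\<lambda>t. h (r + t * N)) {..<k}" if "r < N" for r
      using far[OF that] by (intro inj_onI) (metis lessThan_iff linorder_neqE_nat)
    show "w i = 1 / (of_nat k * of_int D) * (\<Sum>r<N. \<Sum>t<k. if h (r + t * N) = i then 1 else 0)" if "i \<in> J" for i
      unfolding sum_blocks[of "\<lambda>q. if h q = i then 1 else 0"] h(3)[OF that] using D k by (simp add: m[OF that])
  qed (use D h(1) bound in auto)
qed

section \<open>Decomposition of classes at the marked Fermat curve\<close>

context
  fixes n d :: nat and S :: "rat \<Rightarrow> (nat \<Rightarrow> rat) \<Rightarrow> bool"
  assumes d: "2 \<le> d"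
  defines "S \<gamma> w \<equiv> arc_point n d \<in> semistable n d \<gamma> w"
begin

lemma S_cong: "S \<gamma> w \<Longrightarrow> \<gamma> = \<gamma>' \<Longrightarrow> (\<And>i. i \<in> {1..n} \<Longrightarrow> w i = w' i) \<Longrightarrow> S \<gamma>' w'"
  unfolding S_def using semistable_cong[of n w w'] by simp

lemma S_add: "S \<gamma> w \<Longrightarrow> S \<gamma>' w' \<Longrightarrow> S (\<gamma> + \<gamma>') (\<lambda>i. w i + w' i)"
  unfolding S_def by (rule semistable_add)

lemma S_sum: "(\<And>k. k \<in> K \<Longrightarrow> S (\<gamma> k) (w k)) \<Longrightarrow> S (\<Sum>k\<in>K. \<gamma> k) (\<lambda>i. \<Sum>k\<in>K. w k i)"
  unfolding S_def by (rule semistable_sum[OF arc_point_multicone[OF d]])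

lemma S_sextic: "q \<ge> 0 \<Longrightarrow> S q (\<lambda>_. 0)"
  unfolding S_def using semistable_scale[OF arc_point_semistable(1)[OF d], of q] by simp

lemma S_hessian: "q \<ge> 0 \<Longrightarrow> i \<in> {1..n} \<Longrightarrow> S q (\<lambda>k. q * ((of_nat d - 2) * unit_weight i k))"
  unfolding S_def using semistable_scale[OF arc_point_semistable(2)[OF d], of i n q] by simp

lemma S_polar: "q \<ge> 0 \<Longrightarrow> i \<in> {1..n} \<Longrightarrow> j \<in> {1..n} \<Longrightarrow> i \<noteq> j \<Longrightarrow> S q (\<lambda>k. q * ((of_nat d - 1) * unit_weight i k + unit_weight j k))"
  unfolding S_def using semistable_scale[OF arc_point_semistable(3)[OF d], of i n j q] by simp

lemma S_bracket: "q \<ge> 0 \<Longrightarrow> i \<in> {1..n} \<Longrightarrow> j \<in> {1..n} \<Longrightarrow> l \<in> {1..n} \<Longrightarrow> i \<noteq> j \<Longrightarrow> j \<noteq> l \<Longrightarrow> i \<noteq> l \<Longrightarrow>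
    S 0 (\<lambda>k. q * (unit_weight i k + unit_weight j k + unit_weight l k))"
  unfolding S_def using semistable_scale[OF arc_point_semistable(4)[OF d], of i n j l q] by simp

lemma unit_weight_eq: "(if a = b then 1 else 0) = unit_weight a b"
  by (auto simp: unit_weight_def)

text \<open>The second hypothesis is the condition of \<open>wrap_around\<close> for subsets of size
  3, and each subset is a triple of distinct points, hence a bracket.\<close>

lemma S_triples:
  assumes "\<And>i. i \<in> {1..n} \<Longrightarrow> 0 \<le> w i" "\<And>i. i \<in> {1..n} \<Longrightarrow> 3 * w i \<le> (\<Sum>j=1..n. w j)"
  shows "S 0 w"
proof -
  obtain N :: nat and c :: rat and g :: "nat \<Rightarrow> nat \<Rightarrow> nat" where g: "c \<ge> 0" "\<And>r t. r < N \<Longrightarrow> t < 3 \<Longrightarrow> g r t \<in> {1..n}"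
    "\<And>r. r < N \<Longrightarrow> inj_on (g r) {..<3}"
    "\<And>i. i \<in> {1..n} \<Longrightarrow> w i = c * (\<Sum>r<N. \<Sum>t<3. if g r t = i then 1 else 0)"
    by (rule wrap_around[OF finite_atLeastAtMost assms(1), where k = 3]) (use assms(2) in auto)
  have "S 0 (\<lambda>k. c * (unit_weight (g r 0) k + unit_weight (g r 1) k + unit_weight (g r 2) k))" if "r < N" for r
  proof (rule S_bracket[OF g(1)])
    show "g r 0 \<noteq> g r 1" "g r 1 \<noteq> g r 2" "g r 0 \<noteq> g r 2" using inj_onD[OF g(3)[OF that], of 0 1] inj_onD[OF g(3)[OF that], of 1 2] inj_onD[OF g(3)[OF that], of 0 2] by auto
  qed (use g(2)[OF that] in auto)
  then have "S (\<Sum>r<N. 0) (\<lambda>k. \<Sum>r<N. c * (unit_weight (g r 0) k + unit_weight (g r 1) k + unit_weight (g r 2) k))"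
    by (intro S_sum) auto
  then show ?thesis
  proof (rule S_cong)
    fix i assume "i \<in> {1..n}"
    then show "(\<Sum>r<N. c * (unit_weight (g r 0) i + unit_weight (g r 1) i + unit_weight (g r 2) i)) = w i"
      by (simp add: g(4) unit_weight_eq sum_distrib_left eval_nat_numeral lessThan_Suc add_ac)
  qed simp
qed

text \<open>The other points are grouped into pairs by \<open>wrap_around\<close>, and every pair is
  completed by \<open>i\<close> to a bracket.\<close>

lemma S_pairs:
  assumes i: "i \<in> {1..n}" and u: "\<And>j. j \<in> {1..n} - {i} \<Longrightarrow> 0 \<le> u j \<and> u j \<le> b" and b: "(\<Sum>j\<in>{1..n} - {i}. u j) = 2 * b"
    and ui: "u i = b"
  shows "S 0 u"
proof -
  obtain N :: nat and c :: rat and g :: "nat \<Rightarrow> nat \<Rightarrow> nat" where g: "c \<ge> 0" "\<And>r t. r < N \<Longrightarrow> t < 2 \<Longrightarrow> g r t \<in> {1..n} - {i}"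
    "\<And>r. r < N \<Longrightarrow> inj_on (g r) {..<2}"
    "\<And>j. j \<in> {1..n} - {i} \<Longrightarrow> u j = c * (\<Sum>r<N. \<Sum>t<2. if g r t = j then 1 else 0)"
    by (rule wrap_around[of "{1..n} - {i}" u 2]) (use u b in auto)
  have g4: "u j = c * (\<Sum>r<N. unit_weight (g r 0) j + unit_weight (g r 1) j)" if "j \<in> {1..n} - {i}" for j
    by (simp add: g(4)[OF that] unit_weight_eq eval_nat_numeral lessThan_Suc add_ac)
  have 1: "(\<Sum>j\<in>{1..n} - {i}. unit_weight (g r t) j) = 1" if "r < N" "t < 2" for r t
    using g(2)[OF that] by (simp add: unit_weight_def)
  \<comment> \<open>Each pair is counted twice in the total \<open>2 * b\<close>, so the pairs have
    total weight \<open>b\<close>, exactly what \<open>i\<close> has to contribute.\<close>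
  have "2 * b = (\<Sum>j\<in>{1..n} - {i}. c * (\<Sum>r<N. unit_weight (g r 0) j + unit_weight (g r 1) j))"
    unfolding b[symmetric] by (intro sum.cong g4) auto
  also have "\<dots> = c * (\<Sum>r<N. (\<Sum>j\<in>{1..n} - {i}. unit_weight (g r 0) j) + (\<Sum>j\<in>{1..n} - {i}. unit_weight (g r 1) j))"
    by (simp add: sum_distrib_left[symmetric] sum.distrib sum.swap[of _ "{..<N}"])
  also have "\<dots> = c * (\<Sum>r<N. 1 + 1)" using 1 by simp
  finally have cN: "b = c * of_nat N" by simp
  have "S 0 (\<lambda>k. c * (unit_weight (g r 0) k + unit_weight (g r 1) k + unit_weight i k))" if "r < N" for r
  proof (rule S_bracket[OF g(1)])
    show "g r 0 \<noteq> g r 1" using inj_onD[OF g(3)[OF that], of 0 1] by auto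
  qed (use g(2)[OF that, of 0] g(2)[OF that, of 1] i in auto)
  then have "S (\<Sum>r<N. 0) (\<lambda>k. \<Sum>r<N. c * (unit_weight (g r 0) k + unit_weight (g r 1) k + unit_weight i k))"
    by (intro S_sum) auto
  then show ?thesis
  proof (rule S_cong)
    fix j assume j: "j \<in> {1..n}"
    have s: "(\<Sum>r<N. c * (unit_weight (g r 0) j + unit_weight (g r 1) j + unit_weight i j)) = c * (\<Sum>r<N. unit_weight (g r 0) j + unit_weight (g r 1) j) + c * of_nat N * unit_weight i j"
      by (simp add: sum_distrib_left[symmetric] sum.distrib distrib_left)
    show "(\<Sum>r<N. c * (unit_weight (g r 0) j + unit_weight (g r 1) j + unit_weight i j)) = u j"
    proof (cases "j = i")
      case True
      have "unit_weight (g r t) i = 0" if "r < N" "t < 2" for r t using g(2)[OF that] by (auto simp: unit_weight_def)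
      then show ?thesis unfolding s using True cN ui by (simp add: unit_weight_def)
    next
      case False
      then show ?thesis unfolding s using g4[of j] j by (simp add: unit_weight_def)
    qed
  qed simp
qed

text \<open>A symmetric couple of polars adds \<open>d\<close> at both points. The polar
  \<open>(i, j)\<close> and the Hessian at \<open>i\<close> each raise the excess of
  \<open>i\<close> over \<open>j\<close> by \<open>d - 2\<close>; polars are preferred until the
  weight of \<open>j\<close> is used up.\<close>

lemma S_two:
  assumes ij: "i \<in> {1..n}" "j \<in> {1..n}" "i \<noteq> j" and v: "0 \<le> v" "v \<le> u"
    and uv: "u + v \<le> \<gamma> * of_nat d" "u \<le> v + \<gamma> * (of_nat d - 2)" and \<gamma>: "0 \<le> \<gamma>"
  shows "S \<gamma> (\<lambda>k. u * unit_weight i k + v * unit_weight j k)"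
proof -
  let ?d = "of_nat d :: rat"
  \<comment> \<open>The amount of unsymmetric polars and Hessians that produces the excess
    \<open>u - v\<close>. For \<open>d = 2\<close> the hypotheses force \<open>u = v\<close>, and
    division by zero gives the right value 0.\<close>
  define e where "e = (u - v) / (?d - 2)"
  define a where "a = min v e"
  define q where "q = (v - a) / ?d"
  define h where "h = e - a"
  have d2: "?d \<ge> 2" using d by (metis of_nat_le_iff of_nat_numeral)
  have e: "e * (?d - 2) = u - v" "0 \<le> e" "e \<le> \<gamma>"
    using d2 v uv(2) \<gamma> by (auto simp: e_def divide_le_eq)
  have nn: "0 \<le> a" "0 \<le> q" "0 \<le> h" using v(1) e d2 by (auto simp: a_def q_def h_def)
  have q: "q * ?d = v - a" using d2 by (simp add: q_def)
  have tot: "2 * q + a + h \<le> \<gamma>"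
  proof (cases "v \<le> e")
    case True
    then show ?thesis using e by (simp add: a_def q_def h_def)
  next
    case False
    then have a: "a = e" by (simp add: a_def)
    have "(2 * q + e) * ?d = 2 * (v - e) + e * ?d" using q a by (simp add: algebra_simps)
    also have "\<dots> = u + v" using e(1) by (simp add: algebra_simps)
    finally have "(2 * q + e) * ?d \<le> \<gamma> * ?d" using uv by simp
    then show ?thesis using d2 a by (simp add: h_def)
  qed
  have "S ((q + q + (a + h)) + (\<gamma> - (2 * q + a + h))) (\<lambda>k. (q * ((?d - 1) * unit_weight i k + unit_weight j k) + q * ((?d - 1) * unit_weight j k + unit_weight i k)
      + (a * ((?d - 1) * unit_weight i k + unit_weight j k) + h * ((?d - 2) * unit_weight i k))) + 0)"
    by (rule S_add[OF S_add[OF S_add[OF S_polar S_polar] S_add[OF S_polar S_hessian]] S_sextic]) (use nn ij tot in simp_all)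
  then show ?thesis
  proof (rule S_cong)
    fix k
    have "u = q * ?d + a * (?d - 1) + h * (?d - 2)" "v = q * ?d + a"
      using q e(1) by (simp_all add: h_def algebra_simps)
    note uv = this
    show "(q * ((?d - 1) * unit_weight i k + unit_weight j k) + q * ((?d - 1) * unit_weight j k + unit_weight i k)
      + (a * ((?d - 1) * unit_weight i k + unit_weight j k) + h * ((?d - 2) * unit_weight i k))) + 0 = u * unit_weight i k + v * unit_weight j k"
      unfolding uv by (simp add: algebra_simps)
  qed simp
qed

lemma sum_unit_weight: "finite J \<Longrightarrow> (\<Sum>l\<in>J. f l * unit_weight l k) = (if k \<in> J then f k else 0)"
  by (simp add: unit_weight_def if_distrib cong: if_cong)

text \<open>The class is a sum of brackets through \<open>i\<close> of total weight \<open>b\<close>, of polars \<open>(i, j)\<close> of total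
  weight \<open>U - 2 * b\<close>, and of \<open>h\<close> Hessians at \<open>i\<close>.\<close>

lemma S_star:
  fixes w :: "nat \<Rightarrow> rat"
  assumes i: "i \<in> {1..n}" and w: "\<And>j. j \<in> {1..n} \<Longrightarrow> 0 \<le> w j"
    and U_def: "U = (\<Sum>j\<in>{1..n} - {i}. w j)"
    and b: "0 \<le> b" "2 * b \<le> U" "\<And>j. j \<in> {1..n} - {i} \<Longrightarrow> b \<le> U - w j"
    and h: "0 \<le> h" "w i = b + (of_nat d - 1) * (U - 2 * b) + (of_nat d - 2) * h" "U - 2 * b + h \<le> \<gamma>"
  shows "S \<gamma> w"
proof -
  let ?d = "of_nat d :: rat" and ?J = "{1..n} - {i}"
  \<comment> \<open>Brackets through \<open>i\<close> of total weight \<open>b\<close> can use at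
    most \<open>b\<close> of any other point; the uncapped remainder goes into polars.\<close>
  define u where "u = (\<lambda>j. min (w j) b)"
  define T where "T = (\<Sum>j\<in>?J. u j)"
  have u: "0 \<le> u j" "u j \<le> w j" "u j \<le> b" if "j \<in> ?J" for j using w that b(1) by (auto simp: u_def)
  \<comment> \<open>If no weight exceeds \<open>b\<close>, nothing is capped and the total is
    \<open>U\<close>; if exactly one does, the bound \<open>b \<le> U - w j\<close> supplies the
    second \<open>b\<close>; two such weights already contribute \<open>2 * b\<close>.\<close>
  have T: "2 * b \<le> T"
  proof (cases "\<forall>j\<in>?J. w j \<le> b")
    case True
    then have "T = U" unfolding T_def U_def u_def by (intro sum.cong) auto
    then show ?thesis using b by simp
  next
    case False
    then obtain j where j: "j \<in> ?J" "w j > b" by force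
    have Tj: "T = b + (\<Sum>l\<in>?J - {j}. u l)" unfolding T_def using j by (subst sum.remove[of _ j]) (auto simp: u_def)
    have "b \<le> (\<Sum>l\<in>?J - {j}. u l)"
    proof (cases "\<forall>l\<in>?J - {j}. w l \<le> b")
      case True
      then have "(\<Sum>l\<in>?J - {j}. u l) = (\<Sum>l\<in>?J - {j}. w l)" unfolding u_def by (intro sum.cong) auto
      also have "\<dots> = U - w j" unfolding U_def using j by (subst sum.remove[of _ j]) auto
      finally show ?thesis using b(3)[OF j(1)] by simp
    next
      case False
      then obtain l where l: "l \<in> ?J - {j}" "w l > b" by force
      have "u l \<le> (\<Sum>l\<in>?J - {j}. u l)" using l(1) u(1) by (intro member_le_sum) auto
      then show ?thesis using l by (simp add: u_def)
    qed
    then show ?thesis using Tj by simp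
  qed
  \<comment> \<open>Scaling brings the capped total from \<open>T\<close> down to exactly
    \<open>2 * b\<close>. If \<open>T = 0\<close> then also \<open>b = 0\<close>, and the quotient
    is 0 by convention.\<close>
  define v where "v = (\<lambda>j. if j = i then b else u j * (2 * b / T))"
  have ratio: "0 \<le> 2 * b / T" "2 * b / T \<le> 1" using T b(1) by (auto simp: divide_le_eq)
  have v: "0 \<le> v j" "v j \<le> u j" if "j \<in> ?J" for j
    using that mult_nonneg_nonneg[OF u(1)[OF that] ratio(1)] mult_left_mono[OF ratio(2) u(1)[OF that]] by (auto simp: v_def)
  have vsum: "(\<Sum>j\<in>?J. v j) = 2 * b"
  proof -
    have "(\<Sum>j\<in>?J. v j) = (\<Sum>j\<in>?J. u j * (2 * b / T))" by (intro sum.cong) (auto simp: v_def)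
    also have "\<dots> = T * (2 * b / T)" by (simp only: T_def sum_distrib_right)
    also have "\<dots> = 2 * b" using T b(1) by (cases "T = 0") auto
    finally show ?thesis .
  qed
  have Sv: "S 0 v"
  proof (rule S_pairs[OF i _ vsum])
    show "0 \<le> v j \<and> v j \<le> b" if "j \<in> ?J" for j using v[OF that] u(3)[OF that] by simp
  qed (simp add: v_def)
  define P where "P = (\<lambda>j. w j - v j)"
  have P: "0 \<le> P j" if "j \<in> ?J" for j using v(2)[OF that] u(2)[OF that] by (simp add: P_def)
  have Psum: "(\<Sum>j\<in>?J. P j) = U - 2 * b" unfolding P_def sum_subtractf vsum U_def ..
  have "S (0 + (\<Sum>j\<in>?J. P j) + h + (\<gamma> - (U - 2 * b + h)))
    (\<lambda>k. v k + (\<Sum>j\<in>?J. P j * ((?d - 1) * unit_weight i k + unit_weight j k)) + h * ((?d - 2) * unit_weight i k) + 0)"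
  proof (rule S_add[OF S_add[OF S_add[OF Sv S_sum[OF S_polar]] S_hessian] S_sextic])
    show "0 \<le> P j" if "j \<in> ?J" for j using P[OF that] .
  qed (use i h in simp_all)
  then show ?thesis
  proof (rule S_cong)
    fix k assume k: "k \<in> {1..n}"
    have "(\<Sum>j\<in>?J. P j * ((?d - 1) * unit_weight i k + unit_weight j k)) = (\<Sum>j\<in>?J. P j) * (?d - 1) * unit_weight i k + (\<Sum>j\<in>?J. P j * unit_weight j k)"
      by (simp add: distrib_left sum.distrib sum_distrib_right mult.assoc)
    also have "\<dots> = (U - 2 * b) * (?d - 1) * unit_weight i k + (if k \<in> ?J then P k else 0)"
      unfolding Psum by (subst sum_unit_weight) auto
    finally show "v k + (\<Sum>j\<in>?J. P j * ((?d - 1) * unit_weight i k + unit_weight j k)) + h * ((?d - 2) * unit_weight i k) + 0 = w k"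
      using k h(2) by (auto simp: unit_weight_def v_def P_def mult.commute)
  qed (use Psum in simp)
qed

text \<open>Let \<open>w i\<close> be the largest weight and \<open>U\<close> the sum of the others. If \<open>3 * w i \<le> W\<close>, brackets
  suffice. If \<open>w j\<close> dominates the other points and is close to \<open>w i\<close>, then the brackets
  \<open>(i, j, l)\<close> exhaust all points \<open>l\<close> and leave a class supported at \<open>i\<close> and \<open>j\<close>.
  Otherwise \<open>S_star\<close> applies, with the smallest \<open>b\<close> that makes the Hessian weight nonnegative.\<close>

lemma S_cone:
  fixes w :: "nat \<Rightarrow> rat"
  defines "W \<equiv> \<Sum>k=1..n. w k"
  assumes \<gamma>: "0 \<le> \<gamma>" and w: "\<And>i. i \<in> {1..n} \<Longrightarrow> 0 \<le> w i"
    and c1: "\<And>i. i \<in> {1..n} \<Longrightarrow> 3 * w i \<le> W + \<gamma> * (2 * of_nat d - 3)"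
    and c2: "\<And>i. i \<in> {1..n} \<Longrightarrow> 2 * w i \<le> W + \<gamma> * (of_nat d - 2)"
    and c3: "\<And>i j. i \<in> {1..n} \<Longrightarrow> j \<in> {1..n} \<Longrightarrow> i \<noteq> j \<Longrightarrow> 3 * (w i + w j) \<le> 2 * W + \<gamma> * of_nat d"
  shows "S \<gamma> w"
proof (cases "\<forall>i\<in>{1..n}. 3 * w i \<le> W")
  case True
  then have "S 0 w" using w by (intro S_triples) (auto simp: W_def)
  then have "S (\<gamma> + 0) (\<lambda>i. 0 + w i)" by (rule S_add[OF S_sextic[OF \<gamma>]])
  then show ?thesis by simp
next
  case False
  let ?d = "of_nat d :: rat"
  have d2: "?d \<ge> 2" using d by (metis of_nat_le_iff of_nat_numeral)
  have "Max (w ` {1..n}) \<in> w ` {1..n}" using False by (intro Max_in) (blast intro: finite_imageI)+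
  then obtain i where i0: "i \<in> {1..n}" "w i = Max (w ` {1..n})" by (elim imageE) simp
  then have "w j \<le> w i" if "j \<in> {1..n}" for j using that by simp
  note i = i0(1) this
  let ?J = "{1..n} - {i}"
  define U where "U = (\<Sum>j\<in>?J. w j)"
  have W: "W = w i + U" unfolding W_def U_def using i(1) by (subst sum.remove[of _ i]) auto
  obtain j where j: "j \<in> {1..n}" "\<not> 3 * w j \<le> W" using False by blast
  then have U: "U < 2 * w i" using i(2)[OF j(1)] W by linarith
  have wU: "w j \<le> U" if "j \<in> ?J" for j unfolding U_def using that w by (intro member_le_sum) auto
  have U0: "0 \<le> U" unfolding U_def using w by (intro sum_nonneg) auto
  note c1 = c1[OF i(1), unfolded W] and c2 = c2[OF i(1), unfolded W]
  show ?thesis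
  \<comment> \<open>The second condition is what \<open>S_two\<close> requires of the remainder:
    subtracting \<open>V\<close> from both weights preserves their difference.\<close>
  proof (cases "\<exists>j\<in>?J. U < 2 * w j \<and> w i \<le> w j + \<gamma> * (?d - 2)")
    case True
    then obtain j where j: "j \<in> ?J" "U < 2 * w j" "w i \<le> w j + \<gamma> * (?d - 2)" by blast
    define V where "V = U - w j"
    have Vs: "V = (\<Sum>l\<in>?J - {j}. w l)" unfolding V_def U_def using j(1) by (subst sum.remove[of _ j]) auto
    have V: "0 \<le> V" "V \<le> w j" "w j \<le> w i" using wU[OF j(1)] j i by (auto simp: V_def)
    have c3': "w i + w j \<le> 2 * V + \<gamma> * ?d" using c3[OF i(1), of j] j(1) by (auto simp: W V_def)
    have "S 0 (\<lambda>k. if k = i then V else if k = j then V else w k)"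
    proof (rule S_pairs[OF i(1), of _ V])
      have "(\<Sum>l\<in>?J. if l = i then V else if l = j then V else w l) = (\<Sum>l\<in>?J. if l = j then V else w l)"
        by (intro sum.cong) auto
      also have "\<dots> = V + (\<Sum>l\<in>?J - {j}. if l = j then V else w l)" using j(1) by (subst sum.remove[of _ j]) auto
      also have "(\<Sum>l\<in>?J - {j}. if l = j then V else w l) = V" unfolding Vs by (intro sum.cong) auto
      finally show "(\<Sum>l\<in>?J. if l = i then V else if l = j then V else w l) = 2 * V" by simp
    next
      fix l assume l: "l \<in> ?J"
      have "w l \<le> V" if "l \<noteq> j" unfolding Vs using that l w by (intro member_le_sum) auto
      then show "0 \<le> (if l = i then V else if l = j then V else w l) \<and> (if l = i then V else if l = j then V else w l) \<le> V"
        using V w l by auto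
    qed simp
    moreover have "S \<gamma> (\<lambda>k. (w i - V) * unit_weight i k + (w j - V) * unit_weight j k)"
      using i(1) j V c3' \<gamma> by (intro S_two) auto
    ultimately have "S (0 + \<gamma>) (\<lambda>k. (if k = i then V else if k = j then V else w k) + ((w i - V) * unit_weight i k + (w j - V) * unit_weight j k))"
      by (rule S_add)
    then show ?thesis by (rule S_cong) (use j in \<open>auto simp: unit_weight_def\<close>)
  next
    case F: False
    \<comment> \<open>\<open>L\<close> is the value of \<open>b\<close> for which the equation
      \<open>w i = b + (d - 1) * (U - 2 * b) + (d - 2) * h\<close> of \<open>S_star\<close> has
      \<open>h = 0\<close>; larger \<open>b\<close> makes the Hessian part nonnegative.\<close>
    define L where "L = ((?d - 1) * U - w i) / (2 * ?d - 3)"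
    define b where "b = max 0 L"
    define h where "h = (w i - b - (?d - 1) * (U - 2 * b)) / (?d - 2)"
    have L: "L * (2 * ?d - 3) = (?d - 1) * U - w i" using d2 by (simp add: L_def)
    have Lle: "L \<le> x" if "(?d - 1) * U - w i \<le> x * (2 * ?d - 3)" for x
      using that d2 by (simp add: L_def divide_le_eq)
    have b2: "2 * b \<le> U"
    proof -
      have "L \<le> U / 2" using U by (intro Lle) (simp add: algebra_simps)
      then show ?thesis using U0 by (simp add: b_def)
    qed
    have bj: "b \<le> U - w j" if j: "j \<in> ?J" for j
    proof (cases "2 * w j \<le> U")
      case True
      then show ?thesis using b2 by simp
    next
      case False
      \<comment> \<open>This inequality times \<open>d\<close> and the third family for
        \<open>(i, j)\<close> times \<open>d - 2\<close> eliminate \<gamma>; what remains is the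
        bound on \<open>L\<close>.\<close>
      then have "w i > w j + \<gamma> * (?d - 2)" using F j by (meson not_le)
      then have "?d * w i \<ge> ?d * w j + (\<gamma> * ?d) * (?d - 2)"
        using mult_left_mono[of "w j + \<gamma> * (?d - 2)" "w i" ?d] d2 by (simp add: algebra_simps)
      moreover have "\<gamma> * ?d \<ge> w i + w j - 2 * (U - w j)" using c3[OF i(1), of j] j by (auto simp: W)
      then have "(\<gamma> * ?d) * (?d - 2) \<ge> (w i + w j - 2 * (U - w j)) * (?d - 2)" using d2 by (intro mult_right_mono) auto
      ultimately have "?d * w i \<ge> ?d * w j + (w i + w j - 2 * (U - w j)) * (?d - 2)" by linarith
      then have "L \<le> U - w j" by (intro Lle) (simp add: algebra_simps)
      then show ?thesis using wU[OF j] by (simp add: b_def)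
    qed
    \<comment> \<open>This is the bound on the total \<gamma> solved for \<open>b\<close>: for
      \<open>b = L\<close> it follows from the first family, for \<open>b = 0\<close> from the
      second.\<close>
    have bg: "b \<le> \<gamma> * (?d - 2) + U - w i"
    proof -
      have "(2 * w i) * (?d - 2) \<le> (U + \<gamma> * (2 * ?d - 3)) * (?d - 2)"
        using c1 d2 by (intro mult_right_mono) auto
      then have "L \<le> \<gamma> * (?d - 2) + U - w i" by (intro Lle) (simp add: algebra_simps)
      then show ?thesis using c2 by (simp add: b_def)
    qed
    have num: "0 \<le> w i - b - (?d - 1) * (U - 2 * b)"
    proof -
      have "L * (2 * ?d - 3) \<le> b * (2 * ?d - 3)" using d2 by (intro mult_right_mono) (auto simp: b_def)
      then show ?thesis unfolding L by (simp add: algebra_simps)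
    qed
    \<comment> \<open>For \<open>d = 2\<close> the quotient \<open>h\<close> is 0 by convention.
      This is correct because the second family gives \<open>w i \<le> U\<close>, hence
      \<open>b = L\<close>, and the numerator vanishes too.\<close>
    have hd: "(?d - 2) * h = w i - b - (?d - 1) * (U - 2 * b)"
    proof (cases "d = 2")
      case True
      then have "L = U - w i" by (simp add: L_def)
      then have "b = U - w i" using c2 True by (simp add: b_def)
      then show ?thesis using True by (simp add: h_def)
    next
      case False
      then have "?d - 2 \<noteq> 0" using d by (metis eq_iff_diff_eq_0 of_nat_eq_iff of_nat_numeral)
      then show ?thesis by (simp add: h_def)
    qed
    have hg: "U - 2 * b + h \<le> \<gamma>"
    proof (cases "d = 2")
      case True
      then have "L = U - w i" by (simp add: L_def)
      then have "b = U - w i" using c2 True by (simp add: b_def)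
      then show ?thesis using True c1 by (simp add: h_def)
    next
      case False
      then have d3: "?d - 2 > 0" using d by (metis diff_gt_0_iff_gt le_neq_implies_less of_nat_less_iff of_nat_numeral)
      have "(?d - 2) * (U - 2 * b + h) = (?d - 2) * (U - 2 * b) + (?d - 2) * h" by (rule distrib_left)
      also have "\<dots> = w i - U + b" unfolding hd by (simp add: algebra_simps)
      also have "\<dots> \<le> (?d - 2) * \<gamma>" using bg by (simp add: algebra_simps)
      finally show ?thesis using d3 by simp
    qed
    show ?thesis
    proof (rule S_star[where w = w and U = U and b = b and h = h and i = i])
      show "0 \<le> b" by (simp add: b_def)
      show "0 \<le> h" using num d2 by (simp add: h_def)
      show "w i = b + (?d - 1) * (U - 2 * b) + (?d - 2) * h" unfolding hd by simp
      show "0 \<le> w j" if "j \<in> {1..n}" for j using w[OF that] .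
      show "b \<le> U - w j" if "j \<in> ?J" for j using bj[OF that] .
    qed (fact i(1) U_def b2 hg)+
  qed
qed

end

section \<open>Ample classes are positive\<close>

lemma polys_holomorphic:
  assumes "P \<in> polys X" "\<And>c. c \<in> X \<Longrightarrow> (\<lambda>t. c (\<phi> t)) holomorphic_on UNIV"
  shows "(\<lambda>t. P (\<phi> t)) holomorphic_on UNIV"
  using assms(1) by induction (simp_all add: assms(2) holomorphic_on_add holomorphic_on_mult)

text \<open>A regular function is a quotient only locally, so differentiability is checked near each
  \<open>t0\<close>, on the open set where the denominator chosen at \<open>t0\<close> does not
  vanish.\<close>

lemma regular_holomorphic:
  assumes s: "regular n d s" and mc: "\<And>t. \<phi> t \<in> multicone n d"
    and hol: "\<And>c. c \<in> coords n \<Longrightarrow> (\<lambda>t. c (\<phi> t)) holomorphic_on UNIV"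
  shows "(\<lambda>t. s (\<phi> t)) holomorphic_on UNIV"
  unfolding holomorphic_on_def
proof
  fix t0 :: complex
  obtain P Q where PQ: "P \<in> polys (coords n)" "Q \<in> polys (coords n)" "Q (\<phi> t0) \<noteq> 0"
    "\<forall>y\<in>multicone n d. Q y \<noteq> 0 \<longrightarrow> s y = P y / Q y"
    using bspec[OF s[unfolded regular_def] mc[of t0]] by (elim bexE conjE)
  define U where "U = {t. Q (\<phi> t) \<noteq> 0}"
  have hP: "(\<lambda>t. P (\<phi> t)) holomorphic_on UNIV" and hQ: "(\<lambda>t. Q (\<phi> t)) holomorphic_on UNIV"
    using polys_holomorphic[where \<phi> = \<phi>, OF PQ(1) hol] polys_holomorphic[where \<phi> = \<phi>, OF PQ(2) hol] by blast+
  have "open U"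
    unfolding U_def using holomorphic_on_imp_continuous_on[OF hQ] by (intro open_Collect_neq) auto
  have "(\<lambda>t. P (\<phi> t) / Q (\<phi> t)) holomorphic_on U"
    by (intro holomorphic_on_divide holomorphic_on_subset[OF hP] holomorphic_on_subset[OF hQ]) (auto simp: U_def)
  then have "(\<lambda>t. s (\<phi> t)) holomorphic_on U"
    by (rule holomorphic_transform) (use PQ(4) mc in \<open>simp add: U_def\<close>)
  moreover have "t0 \<in> U" using PQ(3) by (simp add: U_def)
  ultimately have "(\<lambda>t. s (\<phi> t)) field_differentiable at t0"
    using \<open>open U\<close> by (metis at_within_open holomorphic_on_def)
  then show "(\<lambda>t. s (\<phi> t)) field_differentiable at t0 within UNIV" by simp
qed

lemma norm_powi_le_one:
  fixes t :: complex
  assumes "1 \<le> norm t" "\<beta> \<le> 0"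
  shows "norm (t powi \<beta>) \<le> 1"
proof -
  have "norm (inverse t) ^ nat (- \<beta>) \<le> 1"
    using assms by (intro power_le_one) (auto simp: norm_inverse inverse_le_1_iff)
  then show ?thesis using assms by (cases "\<beta> = 0") (auto simp: power_int_def norm_power norm_inverse)
qed

text \<open>A section of nonpositive degree is bounded on a pencil, hence constant by Liouville's theorem.\<close>

lemma pencil_constant:
  assumes s: "regular n d s" and mc: "\<And>t. \<phi> t \<in> multicone n d" "\<And>t. \<psi> t \<in> multicone n d"
    and hol: "\<And>c. c \<in> coords n \<Longrightarrow> (\<lambda>t. c (\<phi> t)) holomorphic_on UNIV" "\<And>c. c \<in> coords n \<Longrightarrow> (\<lambda>t. c (\<psi> t)) holomorphic_on UNIV"
    and \<beta>: "\<beta> \<le> 0" and rel: "\<And>t. t \<noteq> 0 \<Longrightarrow> s (\<phi> t) = t powi \<beta> * s (\<psi> (1 / t))"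
  shows "s (\<phi> t) = s (\<phi> 0)"
proof -
  have h: "(\<lambda>t. s (\<phi> t)) holomorphic_on UNIV" "(\<lambda>t. s (\<psi> t)) holomorphic_on UNIV"
    using regular_holomorphic[where \<phi> = \<phi>, OF s mc(1) hol(1)] regular_holomorphic[where \<phi> = \<psi>, OF s mc(2) hol(2)] by blast+
  have bdd: "bounded ((\<lambda>t. f t) ` cball 0 1)" if "f holomorphic_on UNIV" for f :: "complex \<Rightarrow> complex"
    using holomorphic_on_imp_continuous_on[OF that]
    by (intro compact_imp_bounded compact_continuous_image) (auto intro: continuous_on_subset)
  obtain B1 where B1: "\<And>t. norm t \<le> 1 \<Longrightarrow> norm (s (\<phi> t)) \<le> B1"
    using bdd[OF h(1)] by (force simp: bounded_iff)
  obtain B2 where B2: "\<And>t. norm t \<le> 1 \<Longrightarrow> norm (s (\<psi> t)) \<le> B2"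
    using bdd[OF h(2)] by (force simp: bounded_iff)
  have "norm (s (\<phi> t)) \<le> max B1 B2" for t
  proof (cases "norm t \<le> 1")
    case True
    then show ?thesis using B1[of t] by linarith
  next
    case False
    then have "t \<noteq> 0" by auto
    have "norm (s (\<phi> t)) = norm (t powi \<beta>) * norm (s (\<psi> (1 / t)))" by (simp add: rel[OF \<open>t \<noteq> 0\<close>] norm_mult)
    also have "\<dots> \<le> 1 * norm (s (\<psi> (1 / t)))" using False \<beta> by (intro mult_right_mono norm_powi_le_one) auto
    also have "\<dots> \<le> B2" using False B2[of "1 / t"] by (simp add: norm_divide divide_le_eq)
    finally show ?thesis by simp
  qed
  then have "bounded (range (\<lambda>t. s (\<phi> t)))" by (auto simp: bounded_iff)
  then have "(\<lambda>t. s (\<phi> t)) constant_on UNIV" by (rule Liouville_theorem[OF h(1)])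
  then show ?thesis by (auto simp: constant_on_def)
qed

lemma coords_cases:
  assumes "c \<in> coords n" "\<And>u. Q (\<lambda>x. fst x u)" "\<And>i k. i \<in> {1..n} \<Longrightarrow> Q (\<lambda>x. snd x i $ k)"
  shows "Q c"
  using assms by (auto simp: coords_def)

lemma very_ample_separates:
  assumes "very_ample n d a b" "x \<in> multicone n d" "y \<in> multicone n d"
    and eq: "\<And>s. s \<in> sections n d a b \<Longrightarrow> s y = s x"
  shows "same_point n x y"
proof -
  have *: "\<exists>N \<sigma>. A N \<sigma> \<and> B N \<sigma> \<and> C N \<sigma> \<and> D N \<sigma> \<Longrightarrow> \<exists>N \<sigma>. A N \<sigma> \<and> C N \<sigma>"
    for A B C D :: "nat \<Rightarrow> (nat \<Rightarrow> mcurve \<Rightarrow> complex) \<Rightarrow> bool" by blast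
  have "\<exists>(N::nat) \<sigma>. (\<forall>j\<le>N. \<sigma> j \<in> sections n d a b) \<and> (\<forall>x\<in>multicone n d. \<forall>y\<in>multicone n d.
      (\<exists>c. c \<noteq> 0 \<and> (\<forall>j\<le>N. \<sigma> j y = c * \<sigma> j x)) \<longrightarrow> same_point n x y)"
    by (rule *[OF assms(1)[unfolded very_ample_def]])
  then obtain N :: nat and \<sigma> where \<sigma>: "\<forall>j\<le>N. \<sigma> j \<in> sections n d a b"
    and inj: "\<forall>x\<in>multicone n d. \<forall>y\<in>multicone n d. (\<exists>c. c \<noteq> 0 \<and> (\<forall>j\<le>N. \<sigma> j y = c * \<sigma> j x)) \<longrightarrow> same_point n x y"
    by blast
  have "(1::complex) \<noteq> 0 \<and> (\<forall>j\<le>N. \<sigma> j y = 1 * \<sigma> j x)" using \<sigma> eq by simp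
  then show ?thesis by (intro inj[rule_format, OF assms(2,3)] exI)
qed

text \<open>All markings sit at the base point \<open>e3 3\<close> of the pencil
  \<open>s x^d + t y^d\<close>, so only the curve moves. If \<open>a \<le> 0\<close>, no section
  distinguishes two members of the pencil.\<close>

lemma very_ample_curve_degree_pos:
  assumes va: "very_ample n d a b" and d: "1 \<le> d"
  shows "0 < a"
proof (rule ccontr)
  assume "\<not> 0 < a"
  define F where "F s t v = s * (v $ 1) ^ d + t * (v $ 2) ^ d" for s t :: complex and v :: "complex ^ 3"
  define \<Phi> :: "complex \<Rightarrow> complex \<Rightarrow> mcurve" where "\<Phi> s t = (F s t, \<lambda>i\<in>{1..n}. e3 3)" for s t
  have F: "F s t \<in> forms d" for s t
    unfolding F_def[abs_def] using forms_power[OF forms_nth, of 1 d] forms_power[OF forms_nth, of 2 d]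
    by (intro forms_add forms_scale) simp_all
  have F1: "F s t (e3 1) = s" "F s t (e3 2) = t" "F s t (e3 3) = 0" for s t
    using d by (auto simp: F_def axis_def power_0_left)
  have F0: "F s t \<noteq> (\<lambda>_. 0)" if "s \<noteq> 0 \<or> t \<noteq> 0" for s t using F1(1,2)[of s t] that by metis
  have mc: "\<Phi> s t \<in> multicone n d" if "s \<noteq> 0 \<or> t \<noteq> 0" for s t
    using F F0[OF that] F1 by (auto simp: multicone_def \<Phi>_def)
  have hol: "(\<lambda>t. c (\<Phi> s t)) holomorphic_on UNIV" if "c \<in> coords n" for c s
    by (rule coords_cases[OF that, where Q = "\<lambda>c. (\<lambda>t. c (\<Phi> s t)) holomorphic_on UNIV"])
      (auto simp: \<Phi>_def F_def intro!: holomorphic_intros)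
  have hol': "(\<lambda>t. c (\<Phi> t s)) holomorphic_on UNIV" if "c \<in> coords n" for c s
    by (rule coords_cases[OF that, where Q = "\<lambda>c. (\<lambda>t. c (\<Phi> t s)) holomorphic_on UNIV"])
      (auto simp: \<Phi>_def F_def intro!: holomorphic_intros)
  have eq: "\<sigma> (\<Phi> 1 1) = \<sigma> (\<Phi> 1 0)" if sj: "\<sigma> \<in> sections n d a b" for \<sigma>
  proof (rule pencil_constant[of n d \<sigma> "\<Phi> 1" "\<lambda>u. \<Phi> u 1" a])
    show "regular n d (\<sigma>)" using sj by (simp add: sections_def)
    fix t :: complex assume t: "t \<noteq> 0"
    have "\<Phi> 1 t = rescale n t (\<lambda>_. 1) (\<Phi> (1 / t) 1)"
      using t by (auto simp: \<Phi>_def rescale_def F_def fun_eq_iff algebra_simps)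
    then show "\<sigma> (\<Phi> 1 t) = t powi a * \<sigma> (\<Phi> (1 / t) 1)"
      using sj mc[of "1 / t" 1] t by (simp add: sections_def multihomogeneous_def)
  qed (use mc hol hol' \<open>\<not> 0 < a\<close> in auto)
  have "same_point n (\<Phi> 1 0) (\<Phi> 1 1)"
    by (rule very_ample_separates[OF va mc mc]) (auto intro: eq)
  then obtain \<alpha> where "F 1 1 = (\<lambda>v. \<alpha> * F 1 0 v)" by (auto simp: same_point_def rescale_def \<Phi>_def)
  then have "F 1 1 (e3 2) = \<alpha> * F 1 0 (e3 2)" by metis
  then show False by (simp add: F1)
qed

lemma holomorphic_on_const_if:
  "f holomorphic_on A \<Longrightarrow> g holomorphic_on A \<Longrightarrow> (\<lambda>t. if P then f t else g t) holomorphic_on A"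
  by (cases P) auto

text \<open>On the multiple line \<open>x^d = 0\<close> the marking \<open>i\<close> can run through
  the whole line while the curve and the other markings stay fixed.\<close>

lemma very_ample_point_degree_pos:
  assumes va: "very_ample n d a b" and d: "1 \<le> d" and i: "i \<in> {1..n}"
  shows "0 < b i"
proof (rule ccontr)
  assume "\<not> 0 < b i"
  define f :: form where "f v = (v $ 1) ^ d" for v
  define V :: "complex \<Rightarrow> complex \<Rightarrow> complex ^ 3" where "V s t = vector [0, s, t]" for s t
  define \<Phi> :: "complex \<Rightarrow> complex \<Rightarrow> mcurve" where "\<Phi> s t = (f, \<lambda>k\<in>{1..n}. if k = i then V s t else e3 3)" for s t
  have f: "f \<in> forms d" unfolding f_def[abs_def] using forms_power[OF forms_nth, of 1 d] by simp
  have f1: "f (e3 1) = 1" "f (e3 3) = 0" "f (V s t) = 0" for s t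
    using d by (auto simp: f_def axis_def V_def power_0_left)
  have f0: "f \<noteq> (\<lambda>_. 0)" using f1(1) by (metis zero_neq_one)
  have V: "V s t \<noteq> 0" if "s \<noteq> 0 \<or> t \<noteq> 0" for s t using that by (auto simp: V_def vec_eq_iff forall_3)
  have mc: "\<Phi> s t \<in> multicone n d" if "s \<noteq> 0 \<or> t \<noteq> 0" for s t
    using f f0 f1 V[OF that] by (auto simp: multicone_def \<Phi>_def)
  have V_nth: "V s t $ k = (if k = 2 then s else if k = 3 then t else 0)" for s t k
    using exhaust_3[of k] by (auto simp: V_def)
  have hol: "(\<lambda>t. c (\<Phi> s t)) holomorphic_on UNIV" if "c \<in> coords n" for c s
    by (rule coords_cases[OF that, where Q = "\<lambda>c. (\<lambda>t. c (\<Phi> s t)) holomorphic_on UNIV"])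
      (auto simp: \<Phi>_def V_nth if_distrib[of "\<lambda>v. v $ _"] intro!: holomorphic_intros holomorphic_on_const_if)
  have hol': "(\<lambda>t. c (\<Phi> t s)) holomorphic_on UNIV" if "c \<in> coords n" for c s
    by (rule coords_cases[OF that, where Q = "\<lambda>c. (\<lambda>t. c (\<Phi> t s)) holomorphic_on UNIV"])
      (auto simp: \<Phi>_def V_nth if_distrib[of "\<lambda>v. v $ _"] intro!: holomorphic_intros holomorphic_on_const_if)
  have eq: "\<sigma> (\<Phi> 1 1) = \<sigma> (\<Phi> 1 0)" if sj: "\<sigma> \<in> sections n d a b" for \<sigma>
  proof (rule pencil_constant[of n d \<sigma> "\<Phi> 1" "\<lambda>u. \<Phi> u 1" "b i"])
    show "regular n d (\<sigma>)" using sj by (simp add: sections_def)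
    fix t :: complex assume t: "t \<noteq> 0"
    have 1: "\<Phi> 1 t = rescale n 1 (\<lambda>k. if k = i then t else 1) (\<Phi> (1 / t) 1)"
      using t i by (auto simp: \<Phi>_def rescale_def fun_eq_iff V_def vec_eq_iff forall_3)
    have "(\<Prod>k\<in>{1..n}. (if k = i then t else 1) powi b k) = (\<Prod>k\<in>{1..n}. if k = i then t powi b k else 1)"
      by (intro prod.cong) auto
    also have "\<dots> = t powi b i" using i by (subst prod.delta) auto
    finally have 2: "(\<Prod>k\<in>{1..n}. (if k = i then t else 1) powi b k) = t powi b i" .
    have "\<sigma> (\<Phi> 1 t) = 1 powi a * (\<Prod>k\<in>{1..n}. (if k = i then t else 1) powi b k) * \<sigma> (\<Phi> (1 / t) 1)"
      unfolding 1 using sj mc[of "1 / t" 1] t unfolding sections_def multihomogeneous_def by auto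
    then show "\<sigma> (\<Phi> 1 t) = t powi b i * \<sigma> (\<Phi> (1 / t) 1)" unfolding 2 by simp
  qed (use mc hol hol' \<open>\<not> 0 < b i\<close> in auto)
  have "same_point n (\<Phi> 1 0) (\<Phi> 1 1)"
    by (rule very_ample_separates[OF va mc mc]) (auto intro: eq)
  then obtain \<beta> :: "nat \<Rightarrow> complex" where "snd (\<Phi> 1 1) = (\<lambda>k\<in>{1..n}. \<beta> k *s snd (\<Phi> 1 0) k)" by (auto simp: same_point_def rescale_def)
  then have "snd (\<Phi> 1 1) i $ 3 = (\<beta> i *s snd (\<Phi> 1 0) i) $ 3" using i by simp
  then show False using i by (simp add: \<Phi>_def V_def)
qed

lemma ample_pos:
  assumes "ample n d \<gamma> w" "1 \<le> d"
  shows "0 < \<gamma>" "\<And>i. i \<in> {1..n} \<Longrightarrow> 0 < w i"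
proof -
  obtain m a b where m: "m > 0" "cleared n m \<gamma> w a b" "very_ample n d a b" using assms(1) unfolding ample_def by blast
  have "0 < of_nat m * \<gamma>" using very_ample_curve_degree_pos[OF m(3) assms(2)] m(2) by (metis cleared_def of_int_0_less_iff)
  then show "0 < \<gamma>" using m(1) by (simp add: zero_less_mult_iff)
  show "0 < w i" if "i \<in> {1..n}" for i
  proof -
    have "0 < of_nat m * w i" using very_ample_point_degree_pos[OF m(3) assms(2) that] m(2) that by (metis cleared_def of_int_0_less_iff)
    then show ?thesis using m(1) by (simp add: zero_less_mult_iff)
  qed
qed

section \<open>Positive classes are ample\<close>

definition nodes :: "nat \<Rightarrow> (nat \<times> nat) set" where "nodes d = {..d} \<times> {..d}"

definition node_at :: "nat \<times> nat \<Rightarrow> complex ^ 3" where "node_at s = node (fst s) (snd s)"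

text \<open>The weights that express the value of a form at \<open>u\<close> by its values at the
  nodes, so that finitely many evaluations serve as projective coordinates of the curve.\<close>

definition interp :: "nat \<Rightarrow> complex ^ 3 \<Rightarrow> nat \<times> nat \<Rightarrow> complex" where
  "interp d u s = (\<Sum>i\<le>d. \<Sum>j\<le>d - i. vandermonde_dual d i (fst s) * vandermonde_dual d j (snd s) * mon3 i j (d - i - j) u)"

lemma forms_interp:
  assumes "f \<in> forms d"
  shows "f u = (\<Sum>s\<in>nodes d. interp d u s * f (node_at s))"
proof -
  let ?h = "\<lambda>i j s. vandermonde_dual d i (fst s) * vandermonde_dual d j (snd s) * mon3 i j (d - i - j) u * f (node_at s)"
  have form_coeff: "form_coeff d f i j * c = (\<Sum>s\<in>nodes d. vandermonde_dual d i (fst s) * vandermonde_dual d j (snd s) * c * f (node_at s))" for i j c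
    unfolding form_coeff_def nodes_def node_at_def by (simp add: sum.cartesian_product split_beta sum_distrib_left sum_distrib_right mult_ac)
  have "f u = (\<Sum>i\<le>d. \<Sum>j\<le>d - i. \<Sum>s\<in>nodes d. ?h i j s)"
    unfolding forms_expand[OF assms, of u] form_coeff ..
  also have "\<dots> = (\<Sum>i\<le>d. \<Sum>s\<in>nodes d. \<Sum>j\<le>d - i. ?h i j s)"
    by (intro sum.cong refl sum.swap)
  also have "\<dots> = (\<Sum>s\<in>nodes d. \<Sum>i\<le>d. \<Sum>j\<le>d - i. ?h i j s)" by (rule sum.swap)
  also have "\<dots> = (\<Sum>s\<in>nodes d. interp d u s * f (node_at s))"
    by (simp add: interp_def sum_distrib_right)
  finally show ?thesis .
qed

lemma forms_nonzero_node:
  assumes "f \<in> forms d" "f \<noteq> (\<lambda>_. 0)"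
  obtains s where "s \<in> nodes d" "f (node_at s) \<noteq> 0"
proof -
  have "\<exists>s\<in>nodes d. f (node_at s) \<noteq> 0"
  proof (rule ccontr)
    assume "\<not> ?thesis"
    then have "f u = 0" for u unfolding forms_interp[OF assms(1), of u] by simp
    then show False using assms(2) by auto
  qed
  then show thesis using that by blast
qed

context
  fixes n d A :: nat and B :: "nat \<Rightarrow> nat"
  assumes A: "A \<ge> 1" and B: "\<And>i. i \<in> {1..n} \<Longrightarrow> B i \<ge> 1"
begin

text \<open>Only the Segre-Veronese monomials needed for charts: \<open>s0\<close> and
  \<open>k0\<close> name a chart by one coordinate of each factor, taken to the full degree less
  one, while \<open>s\<close> and \<open>k\<close> choose the remaining coordinate. Diagonal indices
  are nonzero exactly on their chart.\<close>

definition veronese :: "(nat \<times> nat) \<times> (nat \<times> nat) \<times> (nat \<Rightarrow> 3) \<times> (nat \<Rightarrow> 3) \<Rightarrow> mcurve \<Rightarrow> complex" where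
  "veronese = (\<lambda>(s, s0, k, k0) x. fst x (node_at s) * fst x (node_at s0) ^ (A - 1) *
     (\<Prod>i\<in>{1..n}. snd x i $ k i * (snd x i $ k0 i) ^ (B i - 1)))"

definition veronese_index :: "((nat \<times> nat) \<times> (nat \<times> nat) \<times> (nat \<Rightarrow> 3) \<times> (nat \<Rightarrow> 3)) set" where
  "veronese_index = nodes d \<times> nodes d \<times> ({1..n} \<rightarrow>\<^sub>E UNIV) \<times> ({1..n} \<rightarrow>\<^sub>E UNIV)"

lemma finite_veronese_index: "finite veronese_index"
  by (simp add: veronese_index_def nodes_def finite_PiE)

lemma veronese_index_nonempty: "veronese_index \<noteq> {}"
  by (auto simp: veronese_index_def nodes_def PiE_eq_empty_iff)

lemma veronese_section: "veronese t \<in> sections n d (int A) (\<lambda>i. int (B i))"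
proof -
  obtain s s0 k k0 where t: "t = (s, s0, k, k0)" by (metis prod_cases4)
  have "veronese t \<in> polys (coords n)"
    unfolding t veronese_def by (auto intro!: polys.mult[OF polys.mult] polys_prod polys_power polys_fst polys.mult polys_snd)
  moreover have "multihomogeneous n d (int A) (\<lambda>i. int (B i)) (veronese t)"
    unfolding multihomogeneous_def
  proof (intro ballI allI impI)
    fix x :: mcurve and \<alpha> \<beta>
    have 1: "(\<Prod>i\<in>{1..n}. snd (rescale n \<alpha> \<beta> x) i $ k i * (snd (rescale n \<alpha> \<beta> x) i $ k0 i) ^ (B i - 1))
        = (\<Prod>i\<in>{1..n}. \<beta> i ^ B i) * (\<Prod>i\<in>{1..n}. snd x i $ k i * (snd x i $ k0 i) ^ (B i - 1))"
      unfolding prod.distrib[symmetric]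
    proof (intro prod.cong refl)
      fix i assume "i \<in> {1..n}"
      moreover from B[OF this] obtain b where "B i = Suc b" by (cases "B i") auto
      ultimately show "snd (rescale n \<alpha> \<beta> x) i $ k i * (snd (rescale n \<alpha> \<beta> x) i $ k0 i) ^ (B i - 1)
          = \<beta> i ^ B i * (snd x i $ k i * (snd x i $ k0 i) ^ (B i - 1))"
        by (simp add: rescale_def power_mult_distrib)
    qed
    obtain a where "A = Suc a" using A by (cases A) auto
    then show "veronese t (rescale n \<alpha> \<beta> x) = \<alpha> powi int A * (\<Prod>i\<in>{1..n}. \<beta> i powi int (B i)) * veronese t x"
      unfolding t veronese_def prod.case 1 power_int_of_nat by (simp add: rescale_def power_mult_distrib)
  qed
  ultimately show ?thesis by (rule sections_polyI)
qed

lemma veronese_diag_nonzero: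
  "veronese (s, s, k, k) x \<noteq> 0 \<longleftrightarrow> fst x (node_at s) \<noteq> 0 \<and> (\<forall>i\<in>{1..n}. snd x i $ k i \<noteq> 0)"
  by (auto simp: veronese_def)

lemma veronese_ratio_curve:
  "veronese (s, s0, k, k0) x * fst x (node_at s0) = fst x (node_at s) * veronese (s0, s0, k, k0) x"
  by (simp add: veronese_def)

lemma veronese_ratio_point:
  assumes "i \<in> {1..n}"
  shows "veronese (s, s0, k(i := l), k0) x * snd x i $ k i = snd x i $ l * veronese (s, s0, k, k0) x"
proof -
  let ?p = "\<lambda>k j. snd x j $ k j * (snd x j $ k0 j) ^ (B j - 1)"
  have "(\<Prod>j\<in>{1..n}. ?p k' j) = ?p k' i * (\<Prod>j\<in>{1..n} - {i}. ?p k' j)" for k'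
    using assms by (intro prod.remove) auto
  moreover have "(\<Prod>j\<in>{1..n} - {i}. ?p (k(i := l)) j) = (\<Prod>j\<in>{1..n} - {i}. ?p k j)"
    by (intro prod.cong) auto
  ultimately show ?thesis by (simp add: veronese_def)
qed

text \<open>The coordinates of the representative that is normalized on a chart are ratios of sections, so
  a quotient of multihomogeneous functions becomes a quotient of polynomials in the sections.\<close>

definition chart :: "nat \<times> nat \<Rightarrow> (nat \<Rightarrow> 3) \<Rightarrow> mcurve \<Rightarrow> mcurve" where
  "chart s k x = rescale n (1 / fst x (node_at s)) (\<lambda>i. 1 / snd x i $ k i) x"

lemma chart_curve:
  assumes "x \<in> multicone n d" "veronese (s, s, k, k) x \<noteq> 0"
  shows "fst (chart s k x) u * veronese (s, s, k, k) x = (\<Sum>r\<in>nodes d. interp d u r * veronese (r, s, k, k) x)"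
proof -
  let ?v = "veronese (s, s, k, k) x" and ?f = "fst x"
  have nz: "?f (node_at s) \<noteq> 0" using assms(2) by (simp add: veronese_diag_nonzero)
  have "fst (chart s k x) u * ?v = (\<Sum>r\<in>nodes d. interp d u r * (?f (node_at r) * ?v)) / ?f (node_at s)"
    using forms_interp[OF multicone_forms[OF assms(1)], of u]
    by (simp add: chart_def rescale_def sum_distrib_right mult.assoc)
  also have "\<dots> = (\<Sum>r\<in>nodes d. interp d u r * veronese (r, s, k, k) x)"
    unfolding veronese_ratio_curve[of _ s k k x, symmetric] using nz by (simp add: sum_divide_distrib)
  finally show ?thesis .
qed

lemma chart_point:
  assumes "veronese (s, s, k, k) x \<noteq> 0" "i \<in> {1..n}"
  shows "snd (chart s k x) i $ l * veronese (s, s, k, k) x = veronese (s, s, k(i := l), k) x"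
proof -
  have nz: "snd x i $ k i \<noteq> 0" using assms by (simp add: veronese_diag_nonzero)
  have "snd (chart s k x) i $ l * veronese (s, s, k, k) x = (snd x i $ l * veronese (s, s, k, k) x) / snd x i $ k i"
    using assms(2) by (simp add: chart_def rescale_def)
  also have "\<dots> = veronese (s, s, k(i := l), k) x"
    unfolding veronese_ratio_point[OF assms(2), symmetric] using nz by simp
  finally show ?thesis .
qed

lemma veronese_index_mem:
  assumes "s \<in> nodes d" "k \<in> {1..n} \<rightarrow>\<^sub>E UNIV"
  shows "r \<in> nodes d \<Longrightarrow> (r, s, k, k) \<in> veronese_index" "i \<in> {1..n} \<Longrightarrow> (s, s, k(i := l), k) \<in> veronese_index"
  using assms by (auto simp: veronese_index_def PiE_iff extensional_def)

lemma chart_exists: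
  assumes "x \<in> multicone n d"
  obtains s k where "s \<in> nodes d" "k \<in> {1..n} \<rightarrow>\<^sub>E UNIV" "veronese (s, s, k, k) x \<noteq> 0"
proof -
  have x: "fst x \<in> forms d" "fst x \<noteq> (\<lambda>_. 0)" "\<And>i. i \<in> {1..n} \<Longrightarrow> snd x i \<noteq> 0"
    using assms by (auto simp: multicone_def)
  obtain s where s: "s \<in> nodes d" "fst x (node_at s) \<noteq> 0" using forms_nonzero_node[OF x(1,2)] by blast
  have "\<forall>i\<in>{1..n}. \<exists>l. snd x i $ l \<noteq> 0" using x(3) by (simp add: vec_eq_iff)
  then obtain k where k: "\<forall>i\<in>{1..n}. snd x i $ k i \<noteq> 0" by metis
  show thesis
    by (rule that[OF s(1), of "\<lambda>i\<in>{1..n}. k i"]) (use s k in \<open>auto simp: veronese_diag_nonzero\<close>)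
qed

text \<open>The normalized representatives on a chart are ratios of sections, in which the common
  factor \<open>c\<close> cancels. So \<open>x\<close> and \<open>y\<close> have the same
  normalization and differ by rescaling.\<close>

lemma veronese_separates:
  assumes x: "x \<in> multicone n d" and y: "y \<in> multicone n d" and c: "c \<noteq> 0"
    and eq: "\<And>t. t \<in> veronese_index \<Longrightarrow> veronese t y = c * veronese t x"
  shows "same_point n x y"
proof -
  obtain s k where sk: "s \<in> nodes d" "k \<in> {1..n} \<rightarrow>\<^sub>E UNIV" "veronese (s, s, k, k) x \<noteq> 0"
    using chart_exists[OF x] by blast
  note idx = veronese_index_mem[OF sk(1,2)]
  have vy: "veronese (s, s, k, k) y = c * veronese (s, s, k, k) x" by (rule eq[OF idx(1)[OF sk(1)]])
  then have nz: "veronese (s, s, k, k) y \<noteq> 0" using sk(3) c by simp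
  have xs: "fst x (node_at s) \<noteq> 0" "\<And>i. i \<in> {1..n} \<Longrightarrow> snd x i $ k i \<noteq> 0" using sk(3) by (auto simp: veronese_diag_nonzero)
  have ys: "fst y (node_at s) \<noteq> 0" "\<And>i. i \<in> {1..n} \<Longrightarrow> snd y i $ k i \<noteq> 0" using nz by (auto simp: veronese_diag_nonzero)
  have "fst (chart s k y) u = fst (chart s k x) u" for u
  proof -
    have "fst (chart s k y) u * veronese (s, s, k, k) y = c * (fst (chart s k x) u * veronese (s, s, k, k) x)"
      unfolding chart_curve[OF x sk(3)] chart_curve[OF y nz]
      using eq[OF idx(1)] by (simp add: sum_distrib_left mult_ac)
    then show ?thesis using c sk(3) by (simp add: vy)
  qed
  then have f: "fst y u = fst y (node_at s) / fst x (node_at s) * fst x u" for u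
    using xs ys by (simp add: chart_def rescale_def field_simps)
  have "snd (chart s k y) i $ l = snd (chart s k x) i $ l" if i: "i \<in> {1..n}" for i l
  proof -
    have "snd (chart s k y) i $ l * veronese (s, s, k, k) y = c * (snd (chart s k x) i $ l * veronese (s, s, k, k) x)"
      unfolding chart_point[OF sk(3) i] chart_point[OF nz i] by (rule eq[OF idx(2)[OF i]])
    then show ?thesis using c sk(3) by (simp add: vy)
  qed
  then have p: "snd y i $ l = snd y i $ k i / snd x i $ k i * snd x i $ l" if "i \<in> {1..n}" for i l
  proof -
    have "snd y i $ l / snd y i $ k i = snd x i $ l / snd x i $ k i"
      using \<open>\<And>i l. _ \<Longrightarrow> snd (chart s k y) i $ l = _\<close>[OF that, of l] that by (simp add: chart_def rescale_def)
    then show ?thesis using xs(2)[OF that] ys(2)[OF that] by (simp add: field_simps)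
  qed
  have y_ext: "snd y \<in> extensional {1..n}" using y by (auto simp: multicone_def PiE_def)
  have "y = rescale n (fst y (node_at s) / fst x (node_at s)) (\<lambda>i. snd y i $ k i / snd x i $ k i) x"
  proof (rule prod_eqI)
    show "fst y = fst (rescale n (fst y (node_at s) / fst x (node_at s)) (\<lambda>i. snd y i $ k i / snd x i $ k i) x)"
      unfolding rescale_def fst_conv by (rule ext) (rule f)
    show "snd y = snd (rescale n (fst y (node_at s) / fst x (node_at s)) (\<lambda>i. snd y i $ k i / snd x i $ k i) x)"
      unfolding rescale_def snd_conv
    proof (rule extensionalityI[OF y_ext restrict_extensional])
      fix i assume i: "i \<in> {1..n}"
      have "snd y i = (snd y i $ k i / snd x i $ k i) *s snd x i"
        unfolding vec_eq_iff vector_smult_component using p[OF i] by blast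
      then show "snd y i = (\<lambda>i\<in>{1..n}. (snd y i $ k i / snd x i $ k i) *s snd x i) i" using i by simp
    qed
  qed
  then show ?thesis unfolding same_point_def using xs ys by (intro exI conjI ballI; (assumption | simp))
qed

text \<open>Chart coordinates have the diagonal section as denominator, so a polynomial in them
  becomes homogeneous in the sections after multiplication by a power of it. For a sum, the two
  powers are equalized by factors \<open>z h\<close>.\<close>

lemma dehomogenize:
  assumes idx: "\<forall>t\<in>veronese_index. J t \<le> M \<and> \<sigma> (J t) = veronese t"
    and s: "s \<in> nodes d" and k: "k \<in> {1..n} \<rightarrow>\<^sub>E UNIV" and P: "P \<in> polys (coords n)"
  shows "\<exists>N. \<exists>F\<in>polys (proj_coords M). (\<forall>c z. F (\<lambda>j. c * z j) = c ^ N * F z) \<and>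
    (\<forall>y\<in>multicone n d. veronese (s, s, k, k) y \<noteq> 0 \<longrightarrow> P (chart s k y) * veronese (s, s, k, k) y ^ N = F (\<lambda>j. \<sigma> j y))"
    (is "\<exists>N. \<exists>F\<in>_. ?hom N F \<and> ?val P N F")
  using P
proof induction
  note idx = bspec[OF idx]
  let ?v = "veronese (s, s, k, k)"
  note mem = veronese_index_mem[OF s k]
  have z: "(\<lambda>z. z (J t)) \<in> polys (proj_coords M)" if "t \<in> veronese_index" for t
    using idx[OF that] by (auto simp: proj_coords_def intro!: polys.coord)
  define h where "h = J (s, s, k, k)"
  have h: "(\<lambda>z. z h) \<in> polys (proj_coords M)" "\<sigma> h = ?v"
    using z[OF mem(1)[OF s]] idx[OF mem(1)[OF s]] by (auto simp: h_def)
  {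
    case (const c)
    show ?case by (intro exI[of _ 0] bexI[of _ "\<lambda>_. c"]) (auto intro: polys.const)
  next
    case (coord u)
    then consider w where "u = (\<lambda>x. fst x w)" | i l where "i \<in> {1..n}" "u = (\<lambda>x. snd x i $ l)"
      by (auto simp: coords_def)
    then show ?case
    proof cases
      case 1
      let ?F = "\<lambda>z. \<Sum>r\<in>nodes d. interp d w r * z (J (r, s, k, k))"
      have "?F \<in> polys (proj_coords M)" by (intro polys_sum polys.mult[OF polys.const] z mem)
      moreover have "?hom 1 ?F" by (simp add: sum_distrib_left mult_ac)
      moreover have "?val u 1 ?F" using idx[OF mem(1)] by (auto simp: 1 chart_curve)
      ultimately show ?thesis by (intro exI[of _ "1"] bexI[of _ ?F] conjI)
    next
      case 2
      let ?F = "\<lambda>z. z (J (s, s, k(i := l), k))"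
      have "?F \<in> polys (proj_coords M)" by (intro z mem 2)
      moreover have "?hom 1 ?F" by simp
      moreover have "?val u 1 ?F" using idx[OF mem(2)[OF 2(1)]] by (auto simp: 2(2) chart_point[OF _ 2(1)])
      ultimately show ?thesis by (intro exI[of _ "1"] bexI[of _ ?F] conjI)
    qed
  next
    case (add P Q)
    then obtain N F N' F' where F: "F \<in> polys (proj_coords M)" "?hom N F" "?val P N F"
      and F': "F' \<in> polys (proj_coords M)" "?hom N' F'" "?val Q N' F'" by blast
    let ?F = "\<lambda>z. F z * z h ^ N' + F' z * z h ^ N"
    have "?F \<in> polys (proj_coords M)" by (intro polys.add polys.mult polys_power F(1) F'(1) h(1))
    moreover have "?hom (N + N') ?F" using F(2) F'(2) by (simp add: power_add power_mult_distrib algebra_simps)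
    moreover have "?val (\<lambda>x. P x + Q x) (N + N') ?F"
    proof (intro ballI impI)
      fix y assume "y \<in> multicone n d" "?v y \<noteq> 0"
      then have 1: "F (\<lambda>j. \<sigma> j y) = P (chart s k y) * ?v y ^ N" "F' (\<lambda>j. \<sigma> j y) = Q (chart s k y) * ?v y ^ N'"
        using F(3) F'(3) by auto
      show "(P (chart s k y) + Q (chart s k y)) * ?v y ^ (N + N') = F (\<lambda>j. \<sigma> j y) * \<sigma> h y ^ N' + F' (\<lambda>j. \<sigma> j y) * \<sigma> h y ^ N"
        unfolding 1 h(2) by (simp add: power_add algebra_simps)
    qed
    ultimately show ?case by (intro exI[of _ "N + N'"] bexI[of _ ?F] conjI)
  next
    case (mult P Q)
    then obtain N F N' F' where F: "F \<in> polys (proj_coords M)" "?hom N F" "?val P N F"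
      and F': "F' \<in> polys (proj_coords M)" "?hom N' F'" "?val Q N' F'" by blast
    let ?F = "\<lambda>z. F z * F' z"
    have "?F \<in> polys (proj_coords M)" by (intro polys.mult F(1) F'(1))
    moreover have "?hom (N + N') ?F" using F(2) F'(2) by (simp add: power_add mult_ac)
    moreover have "?val (\<lambda>x. P x * Q x) (N + N') ?F"
    proof (intro ballI impI)
      fix y assume "y \<in> multicone n d" "?v y \<noteq> 0"
      then have 1: "F (\<lambda>j. \<sigma> j y) = P (chart s k y) * ?v y ^ N" "F' (\<lambda>j. \<sigma> j y) = Q (chart s k y) * ?v y ^ N'"
        using F(3) F'(3) by auto
      show "P (chart s k y) * Q (chart s k y) * ?v y ^ (N + N') = F (\<lambda>j. \<sigma> j y) * F' (\<lambda>j. \<sigma> j y)"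
        unfolding 1 by (simp add: power_add)
    qed
    ultimately show ?case by (intro exI[of _ "N + N'"] bexI[of _ ?F] conjI)
  }
qed

text \<open>As \<open>P\<close> and \<open>Q\<close> have the same multidegree, normalization
  multiplies both by the same factor and preserves their quotient.\<close>

lemma multihomogeneous_chart:
  assumes P: "multihomogeneous n d a b P" and Q: "multihomogeneous n d a b Q"
    and y: "y \<in> multicone n d" "veronese (s, s, k, k) y \<noteq> 0"
  obtains \<mu> where "\<mu> \<noteq> 0" "P (chart s k y) = \<mu> * P y" "Q (chart s k y) = \<mu> * Q y"
proof -
  let ?\<alpha> = "1 / fst y (node_at s)" and ?\<beta> = "\<lambda>i. 1 / snd y i $ k i"
  have nz: "?\<alpha> \<noteq> 0" "\<forall>i\<in>{1..n}. ?\<beta> i \<noteq> 0" using y(2) by (auto simp: veronese_diag_nonzero)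
  have "R (chart s k y) = (?\<alpha> powi a * (\<Prod>i\<in>{1..n}. ?\<beta> i powi b i)) * R y" if "multihomogeneous n d a b R" for R
    unfolding chart_def
    by (rule mp[OF mp[OF spec[OF spec[OF bspec[OF that[unfolded multihomogeneous_def] y(1)], of ?\<alpha>], of ?\<beta>] nz(1)] nz(2)])
  note eq = this[OF P] this[OF Q]
  show thesis
  proof (rule that[OF _ eq])
    show "?\<alpha> powi a * (\<Prod>i\<in>{1..n}. ?\<beta> i powi b i) \<noteq> 0" using nz by (simp add: power_int_eq_0_iff)
  qed
qed

lemma very_ample_positive: "very_ample n d (int A) (\<lambda>i. int (B i))"
proof -
  obtain M0 and e :: "nat \<Rightarrow> _" where e: "veronese_index = e ` {i. i < M0}"
    using finite_imp_nat_seg_image_inj_on[OF finite_veronese_index] by blast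
  have "M0 > 0" using e veronese_index_nonempty by (cases M0) auto
  then obtain M where M: "M0 = Suc M" by (cases M0) auto
  have "\<forall>t\<in>veronese_index. \<exists>j. j \<le> M \<and> e j = t" unfolding e M by (auto simp: less_Suc_eq_le)
  then obtain J where J: "\<And>t. t \<in> veronese_index \<Longrightarrow> J t \<le> M \<and> e (J t) = t" by metis
  define \<sigma> where "\<sigma> j = veronese (e j)" for j
  have idx: "J t \<le> M \<and> \<sigma> (J t) = veronese t" if "t \<in> veronese_index" for t using J[OF that] by (simp add: \<sigma>_def)
  then have idx': "\<forall>t\<in>veronese_index. J t \<le> M \<and> \<sigma> (J t) = veronese t" by blast
  show ?thesis
    unfolding very_ample_def
  proof (rule exI[of _ M], rule exI[of _ \<sigma>], intro conjI ballI allI impI)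
    show "\<sigma> j \<in> sections n d (int A) (\<lambda>i. int (B i))" for j unfolding \<sigma>_def by (rule veronese_section)
  next
    fix x assume x: "x \<in> multicone n d"
    obtain s k where sk: "s \<in> nodes d" "k \<in> {1..n} \<rightarrow>\<^sub>E UNIV" "veronese (s, s, k, k) x \<noteq> 0" using chart_exists[OF x] by blast
    show "\<exists>j\<le>M. \<sigma> j x \<noteq> 0"
      by (rule exI[of _ "J (s, s, k, k)"]) (use idx[OF veronese_index_mem(1)[OF sk(1,2,1)]] sk(3) in simp)
  next
    fix x y assume x: "x \<in> multicone n d" and y: "y \<in> multicone n d" and "\<exists>c. c \<noteq> 0 \<and> (\<forall>j\<le>M. \<sigma> j y = c * \<sigma> j x)"
    then obtain c where c: "c \<noteq> 0" "\<forall>j\<le>M. \<sigma> j y = c * \<sigma> j x" by blast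
    have "veronese t y = c * veronese t x" if "t \<in> veronese_index" for t
      using idx[OF that] c(2)[rule_format, of "J t"] by simp
    then show "same_point n x y" by (rule veronese_separates[OF x y c(1)])
  next
    fix x P Q a' b'
    assume x: "x \<in> multicone n d" and P: "P \<in> polys (coords n)" and Q: "Q \<in> polys (coords n)"
      and hom: "multihomogeneous n d a' b' P \<and> multihomogeneous n d a' b' Q \<and> Q x \<noteq> 0"
    obtain s k where s: "s \<in> nodes d" and k: "k \<in> {1..n} \<rightarrow>\<^sub>E UNIV" and vx: "veronese (s, s, k, k) x \<noteq> 0"
      using chart_exists[OF x] by blast
    let ?v = "veronese (s, s, k, k)"
    define h where "h = J (s, s, k, k)"
    have h: "(\<lambda>z. z h) \<in> polys (proj_coords M)" "\<sigma> h = ?v"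
      using idx[OF veronese_index_mem(1)[OF s k s]] by (auto simp: h_def proj_coords_def intro!: polys.coord)
    obtain N F where F: "F \<in> polys (proj_coords M)" "\<forall>c z. F (\<lambda>j. c * z j) = c ^ N * F z"
      "\<forall>y\<in>multicone n d. ?v y \<noteq> 0 \<longrightarrow> P (chart s k y) * ?v y ^ N = F (\<lambda>j. \<sigma> j y)"
      using dehomogenize[OF idx' s k P] by (elim exE bexE conjE)
    obtain N' G where G: "G \<in> polys (proj_coords M)" "\<forall>c z. G (\<lambda>j. c * z j) = c ^ N' * G z"
      "\<forall>y\<in>multicone n d. ?v y \<noteq> 0 \<longrightarrow> Q (chart s k y) * ?v y ^ N' = G (\<lambda>j. \<sigma> j y)"
      using dehomogenize[OF idx' s k Q] by (elim exE bexE conjE)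
    \<comment> \<open>The exponents equalize the degrees of numerator and denominator. The
      additional factor \<open>z h\<close> makes the domain of the quotient lie inside the
      chart.\<close>
    let ?F = "\<lambda>z. F z * z h ^ (N' + 1)" and ?G = "\<lambda>z. G z * z h ^ (N + 1)"
    show "\<exists>F\<in>polys (proj_coords M). \<exists>G\<in>polys (proj_coords M). \<exists>k.
      (\<forall>c z. F (\<lambda>j. c * z j) = c ^ k * F z) \<and> (\<forall>c z. G (\<lambda>j. c * z j) = c ^ k * G z) \<and>
      G (\<lambda>j. \<sigma> j x) \<noteq> 0 \<and>
      (\<forall>y\<in>multicone n d. G (\<lambda>j. \<sigma> j y) \<noteq> 0 \<longrightarrow>
         Q y \<noteq> 0 \<and> P y / Q y = F (\<lambda>j. \<sigma> j y) / G (\<lambda>j. \<sigma> j y))"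
    proof (rule bexI[of _ ?F], rule bexI[of _ ?G], intro exI[of _ "N + N' + 1"] conjI ballI impI)
      show "?F \<in> polys (proj_coords M)" "?G \<in> polys (proj_coords M)" by (intro polys.mult polys_power F G h(1))+
      show "\<forall>c z. ?F (\<lambda>j. c * z j) = c ^ (N + N' + 1) * ?F z" "\<forall>c z. ?G (\<lambda>j. c * z j) = c ^ (N + N' + 1) * ?G z"
        using F(2) G(2) by (simp_all add: power_add power_mult_distrib mult_ac)
      obtain \<mu> where "\<mu> \<noteq> 0" "Q (chart s k x) = \<mu> * Q x"
        using multihomogeneous_chart[OF conjunct1[OF hom] conjunct1[OF conjunct2[OF hom]] x vx] by blast
      then have "Q (chart s k x) \<noteq> 0" using hom by simp
      then show "?G (\<lambda>j. \<sigma> j x) \<noteq> 0" using G(3)[rule_format, OF x vx, symmetric] vx by (simp add: h(2))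
    next
      fix y assume y: "y \<in> multicone n d" and Gy: "?G (\<lambda>j. \<sigma> j y) \<noteq> 0"
      then have vy: "?v y \<noteq> 0" by (auto simp: h(2))
      obtain \<mu> where \<mu>: "\<mu> \<noteq> 0" "P (chart s k y) = \<mu> * P y" "Q (chart s k y) = \<mu> * Q y"
        using multihomogeneous_chart[OF conjunct1[OF hom] conjunct1[OF conjunct2[OF hom]] y vy] by blast
      have Fy: "F (\<lambda>j. \<sigma> j y) = \<mu> * P y * ?v y ^ N" "G (\<lambda>j. \<sigma> j y) = \<mu> * Q y * ?v y ^ N'"
        using F(3)[rule_format, OF y vy] G(3)[rule_format, OF y vy] \<mu> by simp_all
      show "Q y \<noteq> 0" using Gy by (auto simp: Fy)
      then show "P y / Q y = ?F (\<lambda>j. \<sigma> j y) / ?G (\<lambda>j. \<sigma> j y)"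
        using \<mu>(1) vy by (simp add: Fy h(2) field_simps)
    qed
  qed
qed

end

lemma positive_ample:
  assumes \<gamma>: "0 < \<gamma>" and w: "\<And>i. i \<in> {1..n} \<Longrightarrow> 0 < w i"
  shows "ample n d \<gamma> w"
proof -
  \<comment> \<open>Storing \<gamma> at the free index 0 lets one product of denominators clear all
    \<open>n + 1\<close> entries.\<close>
  define v where "v = w(0 := \<gamma>)"
  define D where "D = (\<Prod>i\<in>{0..n}. snd (quotient_of (v i)))"
  have D: "D > 0" unfolding D_def by (intro prod_pos) (simp add: quotient_of_denom_pos')
  have v: "0 < v i" if "i \<in> {0..n}" for i using assms that by (auto simp: v_def)
  have "\<exists>m::nat. of_nat m = of_int D * v i \<and> m \<ge> 1" if i: "i \<in> {0..n}" for i
  proof -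
    obtain A B where AB: "quotient_of (v i) = (A, B)" by fastforce
    have "snd (quotient_of (v i)) dvd D" unfolding D_def using i by (intro dvd_prodI) auto
    then obtain e where e: "D = B * e" by (auto simp: AB)
    have "v i = of_int A / of_int B" "B > 0" using AB by (auto simp: quotient_of_div quotient_of_denom_pos)
    then have eA: "of_int (e * A) = of_int D * v i" by (simp add: e)
    then have "(0::rat) < of_int (e * A)" using D v[OF i] by simp
    then have "0 < e * A" by (simp only: of_int_0_less_iff)
    then show ?thesis using eA by (intro exI[of _ "nat (e * A)"]) auto
  qed
  then obtain m :: "nat \<Rightarrow> nat" where m: "\<And>i. i \<in> {0..n} \<Longrightarrow> of_nat (m i) = of_int D * v i \<and> m i \<ge> 1" by metis
  have "cleared n (nat D) \<gamma> w (int (m 0)) (\<lambda>i. int (m i))"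
    using m D by (auto simp: cleared_def v_def)
  moreover have "very_ample n d (int (m 0)) (\<lambda>i. int (m i))"
    by (rule very_ample_positive) (use m in auto)
  ultimately show ?thesis unfolding ample_def using D by (intro exI[of _ "nat D"]) auto
qed

section \<open>The Hilbert-Mumford inequalities\<close>

lemma continuous_const_off_point:
  fixes F :: "complex \<Rightarrow> complex"
  assumes "continuous_on UNIV F" "\<And>t. t \<noteq> 0 \<Longrightarrow> F t = c"
  shows "F 0 = c"
proof -
  have "F \<midarrow>0\<rightarrow> F 0" using assms(1) by (simp add: continuous_on_def)
  moreover have "F \<midarrow>0\<rightarrow> c"
    by (rule tendsto_eventually) (simp add: eventually_at_filter assms(2))
  ultimately show ?thesis by (rule tendsto_unique[OF at_neq_bot])
qed

lemma forms_homogeneous: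
  assumes "f \<in> forms d"
  shows "f (c *s v) = c ^ d * f v"
proof -
  have c: "c ^ d = c ^ i * c ^ j * c ^ (d - i - j)" if "i \<le> d" "j \<le> d - i" for i j
    using that unfolding power_add[symmetric] by simp
  have "mon3 i j (d - i - j) (c *s v) = c ^ d * mon3 i j (d - i - j) v" if "i \<le> d" "j \<le> d - i" for i j
    unfolding c[OF that] mon3_def vector_smult_component power_mult_distrib by (simp only: mult_ac)
  then have "form_coeff d f i j * mon3 i j (d - i - j) (c *s v) = c ^ d * (form_coeff d f i j * mon3 i j (d - i - j) v)"
    if "i \<le> d" "j \<le> d - i" for i j using that by simp
  then show ?thesis unfolding forms_expand[OF assms, of "c *s v"] forms_expand[OF assms, of v] sum_distrib_left
    by (intro sum.cong refl) simp
qed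

lemma powi_split:
  fixes t :: complex
  assumes "t \<noteq> 0" "e \<le> k"
  shows "t powi k = t powi e * t ^ nat (k - e)"
proof -
  have "t powi k = t powi (e + int (nat (k - e)))" using assms(2) by simp
  also have "\<dots> = t powi e * t powi int (nat (k - e))" using assms(1) by (simp only: power_int_add[OF disjI1] simp_thms)
  finally show ?thesis by (simp only: power_int_of_nat)
qed

lemma act_semistable:
  assumes "x \<in> semistable n d \<gamma> w" "det g = 1"
  shows "act n g x \<in> semistable n d \<gamma> w"
proof -
  obtain m a b s where 1: "x \<in> multicone n d" "m > 0" "s \<in> sections n d a b" "cleared n m \<gamma> w a b" "invariant n d s" "s x \<noteq> 0"
    using assms(1) by (rule semistableE)
  have "s (act n g x) \<noteq> 0" using 1 assms(2) by (simp add: invariant_def)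
  then show ?thesis by (rule semistableI[OF act_multicone[OF 1(1) assms(2)] 1(2-5)])
qed

definition diag_mat :: "(3 \<Rightarrow> complex) \<Rightarrow> complex ^ 3 ^ 3" where
  "diag_mat c = (\<chi> i j. if i = j then c i else 0)"

lemma diag_mat_mult: "(diag_mat c *v v) $ k = c k * v $ k"
proof -
  have "(\<Sum>j\<in>UNIV. (if k = j then c k else 0) * v $ j) = (\<Sum>j\<in>UNIV. if k = j then c k * v $ j else 0)"
    by (intro sum.cong) auto
  then show ?thesis by (simp add: diag_mat_def matrix_vector_mult_def)
qed

lemma det_diag_mat: "det (diag_mat c) = c 1 * c 2 * c 3"
  by (simp add: diag_mat_def det_3)

text \<open>The easy half of the Hilbert-Mumford criterion: the one-parameter subgroup
  \<open>t \<mapsto> diag (t\<^bsup>r 1\<^esup>, t\<^bsup>r 2\<^esup>, t\<^bsup>r 3\<^esup>)\<close> moves \<open>x\<close> to \<open>y t\<close> up to rescaling, where the exponents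
  \<open>e\<close> and \<open>E i\<close> of the rescaling are exact, so that the limit \<open>y 0\<close> is still a marked curve.\<close>

lemma hilbert_mumford:
  fixes r :: "3 \<Rightarrow> int"
  assumes x: "x \<in> semistable n d \<gamma> w" and \<gamma>: "0 \<le> \<gamma>" and w: "\<And>i. i \<in> {1..n} \<Longrightarrow> 0 \<le> w i"
    and r: "r 1 + r 2 + r 3 = 0"
    and R: "\<And>i j. i \<le> d \<Longrightarrow> j \<le> d - i \<Longrightarrow> form_coeff d (fst x) i j \<noteq> 0 \<Longrightarrow>
      R \<le> - (r 1 * int i + r 2 * int j + r 3 * int (d - i - j))"
    and \<rho>: "\<And>i k. i \<in> {1..n} \<Longrightarrow> snd x i $ k \<noteq> 0 \<Longrightarrow> \<rho> i \<le> r k"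
  shows "of_int R * \<gamma> + (\<Sum>i=1..n. of_int (\<rho> i) * w i) \<le> 0"
proof -
  obtain m a b s where s: "x \<in> multicone n d" "m > 0" "s \<in> sections n d a b" "cleared n m \<gamma> w a b" "invariant n d s" "s x \<noteq> 0"
    using x by (rule semistableE)
  obtain f p where xfp: "x = (f, p)" by fastforce
  have f: "f \<in> forms d" "f \<noteq> (\<lambda>_. 0)" and p: "\<And>i. i \<in> {1..n} \<Longrightarrow> p i \<noteq> 0" "\<And>i. i \<in> {1..n} \<Longrightarrow> f (p i) = 0"
    and pext: "p \<in> extensional {1..n}"
    using s(1) by (auto simp: xfp multicone_def PiE_def)
  \<comment> \<open>The sign is negative because the form is composed with the inverse
    matrix.\<close>
  define wt where "wt i j = - (r 1 * int i + r 2 * int j + r 3 * int (d - i - j))" for i j :: nat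
  define supp where "supp = {(i, j). i \<le> d \<and> j \<le> d - i \<and> form_coeff d f i j \<noteq> 0}"
  have fin: "finite supp" by (rule finite_subset[of _ "{..d} \<times> {..d}"]) (auto simp: supp_def)
  have "supp \<noteq> {}"
  proof
    assume "supp = {}"
    then have "form_coeff d f i j = 0" if "i \<le> d" "j \<le> d - i" for i j using that by (auto simp: supp_def)
    then have "f v = 0" for v unfolding forms_expand[OF f(1), of v] by (intro sum.neutral ballI) auto
    then show False using f(2) by auto
  qed
  define e where "e = Min ((\<lambda>(i, j). wt i j) ` supp)"
  have "e \<in> (\<lambda>(i, j). wt i j) ` supp" unfolding e_def using fin \<open>supp \<noteq> {}\<close> by (intro Min_in) auto
  then obtain i0 j0 where ij0: "(i0, j0) \<in> supp" "e = wt i0 j0" by auto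
  have e_le: "e \<le> wt i j" if "i \<le> d" "j \<le> d - i" "form_coeff d f i j \<noteq> 0" for i j
    unfolding e_def by (rule Min_le) (use fin that in \<open>force simp: supp_def\<close>)+
  \<comment> \<open>\<open>R\<close> and the \<rho> are only lower bounds for the exact exponents;
    since \<gamma> and the weights are nonnegative, they can replace them at the end.\<close>
  have Re: "R \<le> e" using R[of i0 j0] ij0 by (auto simp: supp_def xfp wt_def)
  have "\<exists>k. p i $ k \<noteq> 0 \<and> (\<forall>l. p i $ l \<noteq> 0 \<longrightarrow> r k \<le> r l)" if "i \<in> {1..n}" for i
  proof -
    let ?S = "{k. p i $ k \<noteq> 0}"
    have "?S \<noteq> {}" using p(1)[OF that] by (auto simp: vec_eq_iff)
    then have "Min (r ` ?S) \<in> r ` ?S" by (intro Min_in) simp_all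
    then obtain k where k: "p i $ k \<noteq> 0" "Min (r ` ?S) = r k" by (elim imageE) simp
    have "r k \<le> r l" if "p i $ l \<noteq> 0" for l unfolding k(2)[symmetric] using that by (intro Min_le) simp_all
    then show ?thesis using k(1) by blast
  qed
  then obtain \<kappa> where \<kappa>: "\<And>i. i \<in> {1..n} \<Longrightarrow> p i $ \<kappa> i \<noteq> 0" "\<And>i l. i \<in> {1..n} \<Longrightarrow> p i $ l \<noteq> 0 \<Longrightarrow> r (\<kappa> i) \<le> r l"
    by metis
  define E where "E i = r (\<kappa> i)" for i
  have \<rho>E: "\<rho> i \<le> E i" if "i \<in> {1..n}" for i using \<rho>[OF that] \<kappa>(1)[OF that] by (simp add: xfp E_def)
  \<comment> \<open>By minimality of \<open>e\<close>, truncation in \<open>nat\<close> can occur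
    only where the coefficient is zero; the same holds for \<open>q\<close> and zero coordinates of
    the points.\<close>
  define F where "F t v = (\<Sum>i\<le>d. \<Sum>j\<le>d - i. (form_coeff d f i j * t ^ nat (wt i j - e)) * mon3 i j (d - i - j) v)" for t v
  define q where "q t i = (\<chi> k. t ^ nat (r k - E i) * p i $ k)" for t i
  define y where "y t = (F t, \<lambda>i\<in>{1..n}. q t i)" for t
  define g where "g t = diag_mat (\<lambda>k. t powi r k)" for t
  have F: "F t \<in> forms d" for t unfolding forms_iff F_def by (rule exI) (rule refl)
  \<comment> \<open>The coefficient at the minimizing index has exponent 0, so it survives at
    \<open>t = 0\<close>.\<close>
  have F0: "F t \<noteq> (\<lambda>_. 0)" for t
  proof
    assume "F t = (\<lambda>_. 0)"
    then have "form_coeff d (F t) i0 j0 = 0" by (simp add: form_coeff_zero)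
    moreover have "form_coeff d (F t) i0 j0 = form_coeff d f i0 j0 * t ^ nat (wt i0 j0 - e)"
      by (rule form_coeff_eq) (use ij0 in \<open>auto simp: F_def supp_def\<close>)
    ultimately show False using ij0 by (auto simp: supp_def)
  qed
  have q0: "q t i \<noteq> 0" if "i \<in> {1..n}" for t i
  proof
    assume "q t i = 0"
    then have "q t i $ \<kappa> i = 0" by simp
    then show False using \<kappa>(1)[OF that] by (simp add: q_def E_def)
  qed
  have det: "det (g t) = 1" if "t \<noteq> 0" for t
    unfolding g_def det_diag_mat using that r by (simp flip: power_int_add)
  have ginv: "matrix_inv (g t) *v v = diag_mat (\<lambda>k. t powi (- r k)) *v v" if "t \<noteq> 0" for t v
  proof -
    have "g t *v (diag_mat (\<lambda>k. t powi (- r k)) *v v) = v"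
      unfolding vec_eq_iff g_def diag_mat_mult using that by (simp add: power_int_minus)
    then show ?thesis using matrix_inv_SL_mult(1)[OF det[OF that]] by metis
  qed
  have Fg: "f (matrix_inv (g t) *v v) = t powi e * F t v" if t: "t \<noteq> 0" for t v
  proof -
    have "form_coeff d f i j * mon3 i j (d - i - j) (matrix_inv (g t) *v v)
        = t powi e * ((form_coeff d f i j * t ^ nat (wt i j - e)) * mon3 i j (d - i - j) v)" if ij: "i \<le> d" "j \<le> d - i" for i j
    proof (cases "form_coeff d f i j = 0")
      case False
      then have "t powi wt i j = t powi e * t ^ nat (wt i j - e)"
        using powi_split[OF t] e_le[OF ij] by blast
      moreover have "mon3 i j (d - i - j) (matrix_inv (g t) *v v) = t powi wt i j * mon3 i j (d - i - j) v"
      proof -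
        have pw: "(t powi c) ^ k = t powi (c * int k)" for c k by (simp add: power_int_mult)
        have "wt i j = - r 1 * int i + - r 2 * int j + - r 3 * int (d - i - j)" by (simp add: wt_def)
        then have "t powi wt i j = (t powi (- r 1)) ^ i * (t powi (- r 2)) ^ j * (t powi (- r 3)) ^ (d - i - j)"
          unfolding pw using t by (simp only: power_int_add[OF disjI1] simp_thms)
        then show ?thesis unfolding ginv[OF t] mon3_def diag_mat_mult by (simp add: power_mult_distrib mult_ac)
      qed
      ultimately show ?thesis by (simp add: mult_ac)
    qed simp
    then show ?thesis unfolding forms_expand[OF f(1), of "matrix_inv (g t) *v v"] F_def sum_distrib_left by (intro sum.cong refl) simp
  qed
  have qg: "g t *v p i = t powi E i *s q t i" if t: "t \<noteq> 0" and i: "i \<in> {1..n}" for t i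
    unfolding vec_eq_iff
  proof
    fix k
    have "t powi r k * p i $ k = t powi E i * (t ^ nat (r k - E i) * p i $ k)"
    proof (cases "p i $ k = 0")
      case False
      then have "E i \<le> r k" using \<kappa>(2)[OF i] by (simp add: E_def)
      then have "t powi r k = t powi E i * t ^ nat (r k - E i)" by (rule powi_split[OF t])
      then show ?thesis by simp
    qed simp
    then show "(g t *v p i) $ k = (t powi E i *s q t i) $ k"
      unfolding g_def diag_mat_mult by (simp add: q_def)
  qed
  have hol_F: "(\<lambda>t. F t v) holomorphic_on UNIV" for v
    unfolding F_def by (intro holomorphic_intros)
  have hol_q: "(\<lambda>t. q t i $ k) holomorphic_on UNIV" for i k
    unfolding q_def by (simp, intro holomorphic_intros)
  have Fq: "F t (q t i) = 0" if i: "i \<in> {1..n}" for t i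
  proof -
    have off: "F t (q t i) = 0" if t: "t \<noteq> 0" for t
    proof -
      have "0 = f (matrix_inv (g t) *v (g t *v p i))" using matrix_inv_SL_mult(1)[OF det[OF t]] p(2)[OF i] by simp
      also have "\<dots> = t powi e * ((t powi E i) ^ d * F t (q t i))"
        unfolding Fg[OF t] qg[OF t i] forms_homogeneous[OF F] ..
      finally show ?thesis using t by simp
    qed
    have "(\<lambda>t. F t (q t i)) holomorphic_on UNIV"
      unfolding F_def mon3_def by (intro holomorphic_intros hol_q)
    then have "F 0 (q 0 i) = 0"
      using continuous_const_off_point[OF holomorphic_on_imp_continuous_on] off by blast
    then show ?thesis using off by (cases "t = 0") auto
  qed
  have y: "y t \<in> multicone n d" for t
    using F F0 q0 Fq by (auto simp: multicone_def y_def)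
  have act: "act n (g t) x = rescale n (t powi e) (\<lambda>i. t powi E i) (y t)" if "t \<noteq> 0" for t
    using Fg[OF that] qg[OF that] by (auto simp: act_def rescale_def y_def xfp)
  define h where "h = e * a + (\<Sum>i\<in>{1..n}. E i * b i)"
  have sx: "t powi h * s (y t) = s x" if t: "t \<noteq> 0" for t
  proof -
    have "s x = s (act n (g t) x)" using s(1,5) det[OF t] by (simp add: invariant_def)
    also have "\<dots> = (t powi e) powi a * (\<Prod>i\<in>{1..n}. (t powi E i) powi b i) * s (y t)"
      unfolding act[OF t] using s(3) y t by (simp add: sections_def multihomogeneous_def)
    also have "(\<Prod>i\<in>K. (t powi E i) powi b i) = t powi (\<Sum>i\<in>K. E i * b i)" if "finite K" for K
      using that by induction (use t in \<open>simp_all add: power_int_add power_int_mult\<close>)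
    finally show ?thesis using t by (simp add: h_def power_int_add power_int_mult)
  qed
  \<comment> \<open>If \<open>h\<close> were positive, \<open>t ^ h * s (y t)\<close> would tend to
    0 at \<open>t = 0\<close>, although off 0 it equals the nonzero constant
    \<open>s x\<close>.\<close>
  have "h \<le> 0"
  proof (rule ccontr)
    assume "\<not> h \<le> 0"
    then obtain l :: nat where l: "h = int l" "l > 0" by (metis not_le zero_less_imp_eq_int)
    have "(\<lambda>t. s (y t)) holomorphic_on UNIV"
    proof (rule regular_holomorphic[of n d s y])
      show "regular n d s" using s(3) by (simp add: sections_def)
      show "(\<lambda>t. c (y t)) holomorphic_on UNIV" if "c \<in> coords n" for c
        by (rule coords_cases[OF that, where Q = "\<lambda>c. (\<lambda>t. c (y t)) holomorphic_on UNIV"])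
          (auto simp: y_def hol_F hol_q)
    qed (rule y)
    then have "(\<lambda>t. t ^ l * s (y t)) holomorphic_on UNIV" by (intro holomorphic_intros)
    then have "0 ^ l * s (y 0) = s x"
      by (rule continuous_const_off_point[OF holomorphic_on_imp_continuous_on]) (use sx in \<open>simp add: l\<close>)
    moreover have "(0::complex) ^ l = 0" using l(2) by (simp add: power_0_left)
    ultimately show False using s(6) by simp
  qed
  moreover have "of_nat m * (of_int e * \<gamma> + (\<Sum>i=1..n. of_int (E i) * w i)) = (of_int h :: rat)"
    using s(4) by (simp add: h_def cleared_def distrib_left sum_distrib_left mult_ac)
  ultimately have "of_nat m * (of_int e * \<gamma> + (\<Sum>i=1..n. of_int (E i) * w i)) \<le> 0" by simp
  then have "of_int e * \<gamma> + (\<Sum>i=1..n. of_int (E i) * w i) \<le> 0" using s(2) by (simp add: mult_le_0_iff)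
  moreover have "of_int R * \<gamma> \<le> of_int e * \<gamma>" using Re \<gamma> by (intro mult_right_mono) auto
  moreover have "(\<Sum>i=1..n. of_int (\<rho> i) * w i) \<le> (\<Sum>i=1..n. of_int (E i) * w i)"
    using \<rho>E w by (intro sum_mono mult_right_mono) auto
  ultimately show ?thesis by linarith
qed


section \<open>Coordinates adapted to marked points and tangents\<close>

lemma SL_move_to_axis:
  fixes p :: "complex ^ 3"
  assumes "p \<noteq> 0"
  obtains g :: "complex ^ 3 ^ 3" where "det g = 1" "(g *v p) $ 2 = 0" "(g *v p) $ 3 = 0"
proof (cases "p $ 1 = 0")
  case False
  let ?g = "vector [vector [1, 0, 0], vector [- (p $ 2 / p $ 1), 1, 0], vector [- (p $ 3 / p $ 1), 0, 1]] :: complex ^ 3 ^ 3"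
  show thesis
    by (rule that[of ?g]) (use False in \<open>simp_all add: det_3 matrix_vector_mult_def sum_3\<close>)
next
  case True
  show thesis
  proof (cases "p $ 2 = 0")
    case False
    let ?g = "vector [vector [0, 1, 0], vector [- 1, 0, 0], vector [0, - (p $ 3 / p $ 2), 1]] :: complex ^ 3 ^ 3"
    show thesis
      by (rule that[of ?g]) (use True False in \<open>simp_all add: det_3 matrix_vector_mult_def sum_3\<close>)
  next
    case p2: True
    let ?g = "vector [vector [0, 0, 1], vector [1, 0, 0], vector [0, 1, 0]] :: complex ^ 3 ^ 3"
    show thesis
      by (rule that[of ?g]) (use True p2 in \<open>simp_all add: det_3 matrix_vector_mult_def sum_3\<close>)
  qed
qed

text \<open>The last clause keeps a first marked point, already on the axis, in the plane while a
  second one is moved there.\<close>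

lemma SL_move_to_plane:
  fixes q :: "complex ^ 3"
  obtains g :: "complex ^ 3 ^ 3" where "det g = 1" "(g *v q) $ 3 = 0"
    "\<And>v. v $ 2 = 0 \<Longrightarrow> v $ 3 = 0 \<Longrightarrow> (g *v v) $ 3 = 0"
proof (cases "q $ 2 = 0")
  case False
  let ?g = "vector [vector [1, 0, 0], vector [0, 1, 0], vector [0, - (q $ 3 / q $ 2), 1]] :: complex ^ 3 ^ 3"
  show thesis
    by (rule that[of ?g]) (use False in \<open>simp_all add: det_3 matrix_vector_mult_def sum_3\<close>)
next
  case True
  let ?g = "vector [vector [1, 0, 0], vector [0, 0, 1], vector [0, - 1, 0]] :: complex ^ 3 ^ 3"
  show thesis
    by (rule that[of ?g]) (use True in \<open>simp_all add: det_3 matrix_vector_mult_def sum_3\<close>)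
qed

lemma matrix_inv_matrix_inv:
  fixes A :: "complex ^ 3 ^ 3"
  assumes "det A = 1"
  shows "matrix_inv (matrix_inv A) = A"
proof -
  let ?B = "matrix_inv A"
  have "matrix_inv ?B = matrix_inv ?B ** (?B ** A)" by (simp add: matrix_inv_SL(1)[OF assms])
  also have "\<dots> = A" by (simp add: matrix_mul_assoc matrix_inv_SL(1)[OF matrix_inv_SL(3)[OF assms]])
  finally show ?thesis .
qed

lemma form_coeff_axis:
  assumes "f \<in> forms d"
  shows "f (e3 1) = form_coeff d f d 0"
proof -
  have "f (e3 1) = (\<Sum>i\<le>d. \<Sum>j\<le>d - i. if i = d \<and> j = 0 then form_coeff d f i j else 0)"
    unfolding forms_expand[OF assms, of "e3 1"]
    by (intro sum.cong refl) (auto simp: mon3_def axis_def power_0_left)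
  then show ?thesis by (simp add: sum_triangle_delta)
qed

text \<open>After grouping by powers of \<open>t\<close>, only \<open>i = d - 1\<close> contributes
  to the derivative at 0. The two coefficients are thus read as a gradient, and their change under a
  substitution follows from uniqueness of derivatives.\<close>

lemma form_coeff_tangent:
  assumes "f \<in> forms d" "1 \<le> d"
  shows "((\<lambda>t. f (vector [1, b * t, c * t])) has_field_derivative form_coeff d f (d - 1) 1 * b + form_coeff d f (d - 1) 0 * c) (at 0)"
proof -
  define C where "C i = (\<Sum>j\<le>d - i. form_coeff d f i j * b ^ j * c ^ (d - i - j))" for i
  have "f (vector [1, b * t, c * t]) = (\<Sum>i\<le>d. C i * t ^ (d - i))" for t
  proof -
    have "mon3 i j (d - i - j) (vector [1, b * t, c * t]) = b ^ j * c ^ (d - i - j) * t ^ (d - i)" if "j \<le> d - i" for i j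
    proof -
      have "d - i = j + (d - i - j)" using that by arith
      then have "t ^ (d - i) = t ^ j * t ^ (d - i - j)" by (metis power_add)
      then show ?thesis by (simp add: mon3_def power_mult_distrib)
    qed
    then show ?thesis
      unfolding forms_expand[OF assms(1), of "vector [1, b * t, c * t]"] C_def sum_distrib_right
      by (intro sum.cong refl) simp
  qed
  moreover have "((\<lambda>t. \<Sum>i\<le>d. C i * t ^ (d - i)) has_field_derivative (\<Sum>i\<le>d. C i * (of_nat (d - i) * 0 ^ (d - i - 1)))) (at 0)"
    by (intro DERIV_sum DERIV_cmult) (auto intro!: derivative_eq_intros)
  moreover have "(\<Sum>i\<le>d. C i * (of_nat (d - i) * 0 ^ (d - i - 1))) = (\<Sum>i\<le>d. if i = d - 1 then C i else 0)"
    using assms(2) by (intro sum.cong refl) (auto simp: power_0_left)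
  moreover have "C (d - 1) = form_coeff d f (d - 1) 1 * b + form_coeff d f (d - 1) 0 * c"
    using assms(2) by (simp add: C_def)
  ultimately show ?thesis using assms(2) by simp
qed

text \<open>The vanishing coefficient says that the tangent line at \<open>e3 1\<close> is the line \<open>v $ 2 = 0\<close>.\<close>

lemma SL_adapt_tangent:
  assumes f: "f \<in> forms d" and d: "1 \<le> d"
  obtains g :: "complex ^ 3 ^ 3" where "det g = 1" "form_coeff d (\<lambda>v. f (matrix_inv g *v v)) (d - 1) 0 = 0"
    "\<And>v. v $ 2 = 0 \<Longrightarrow> v $ 3 = 0 \<Longrightarrow> g *v v = v"
proof (cases "form_coeff d f (d - 1) 0 = 0")
  case True
  have "matrix_inv (mat 1) = (mat 1 :: complex ^ 3 ^ 3)"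
    using matrix_inv_SL(1)[of "mat 1"] by simp
  then show thesis using True by (intro that[of "mat 1"]) simp_all
next
  case False
  define \<alpha> where "\<alpha> = form_coeff d f (d - 1) 1"
  define \<beta> where "\<beta> = form_coeff d f (d - 1) 0"
  \<comment> \<open>The third column \<open>(0, - \<beta>, \<alpha>)\<close> is annihilated by the
    gradient \<open>(\<alpha>, \<beta>)\<close>, so it is a tangent direction; the entry
    \<open>1 / \<beta>\<close> normalizes the determinant.\<close>
  define A :: "complex ^ 3 ^ 3" where "A = vector [vector [1, 0, 0], vector [0, 0, - \<beta>], vector [0, 1 / \<beta>, \<alpha>]]"
  have det: "det A = 1" using False by (simp add: A_def det_3 \<beta>_def)
  define f' where "f' = (\<lambda>v. f (A *v v))"
  have f': "f' \<in> forms d" unfolding f'_def by (rule forms_comp[OF f])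
  have "A *v vector [1, 0 * t, 1 * t] = vector [1, - \<beta> * t, \<alpha> * t]" for t
    by (simp add: A_def vec_eq_iff forall_3 matrix_vector_mult_def sum_3)
  then have eq: "(\<lambda>t. f' (vector [1, 0 * t, 1 * t])) = (\<lambda>t. f (vector [1, - \<beta> * t, \<alpha> * t]))"
    unfolding f'_def by (simp only:)
  have "form_coeff d f' (d - 1) 1 * 0 + form_coeff d f' (d - 1) 0 * 1 = form_coeff d f (d - 1) 1 * - \<beta> + form_coeff d f (d - 1) 0 * \<alpha>"
    by (rule DERIV_unique[OF form_coeff_tangent[OF f' d, of 0 1, unfolded eq] form_coeff_tangent[OF f d, of "- \<beta>" \<alpha>]])
  then have "form_coeff d f' (d - 1) 0 = 0" by (simp add: \<alpha>_def \<beta>_def)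
  moreover have "matrix_inv (matrix_inv A) = A" by (rule matrix_inv_matrix_inv[OF det])
  moreover have "matrix_inv A *v v = v" if "v $ 2 = 0" "v $ 3 = 0" for v
  proof -
    have "A *v v = v" using that by (simp add: A_def vec_eq_iff forall_3 matrix_vector_mult_def sum_3)
    then show ?thesis using matrix_inv_SL_mult(1)[OF det, of v] by simp
  qed
  ultimately show thesis
    by (intro that[of "matrix_inv A"]) (simp_all add: f'_def matrix_inv_SL(3)[OF det])
qed

lemma semistable_multicone: "x \<in> semistable n d \<gamma> w \<Longrightarrow> x \<in> multicone n d"
  by (simp add: semistable_def)

lemma form_coeff_axis_zero:
  assumes "x \<in> multicone n d" "i \<in> {1..n}" "snd x i $ 2 = 0" "snd x i $ 3 = 0"
  shows "form_coeff d (fst x) d 0 = 0"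
proof -
  have x: "fst x \<in> forms d" "fst x (snd x i) = 0" "snd x i \<noteq> 0"
    using assms(1,2) by (auto simp: multicone_def)
  have p: "snd x i = snd x i $ 1 *s e3 1"
    using assms(3,4) by (simp add: vec_eq_iff forall_3 axis_def)
  have "snd x i $ 1 \<noteq> 0"
  proof
    assume "snd x i $ 1 = 0"
    then show False using x(3) assms(3,4) by (simp add: vec_eq_iff forall_3)
  qed
  moreover have "(snd x i $ 1) ^ d * fst x (e3 1) = 0"
    using x(2) p forms_homogeneous[OF x(1), of "snd x i $ 1" "e3 1"] by simp
  ultimately show ?thesis using form_coeff_axis[OF x(1)] by simp
qed

lemma sum_if_const:
  fixes w :: "nat \<Rightarrow> rat"
  assumes "finite K"
  shows "(\<Sum>k\<in>K. of_int (if P k then a else b) * w k) = of_int b * (\<Sum>k\<in>K. w k) + of_int (a - b) * (\<Sum>k\<in>{k \<in> K. P k}. w k)"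
proof -
  have "(\<Sum>k\<in>K. of_int (if P k then a else b) * w k) = (\<Sum>k\<in>K. of_int b * w k + (if P k then of_int (a - b) * w k else 0))"
    by (intro sum.cong refl) (auto simp: algebra_simps)
  also have "\<dots> = of_int b * (\<Sum>k\<in>K. w k) + (\<Sum>k\<in>{k \<in> K. P k}. of_int (a - b) * w k)"
    using assms by (simp add: sum.distrib sum_distrib_left sum.inter_filter del: of_int_diff)
  finally show ?thesis by (simp add: sum_distrib_left)
qed

context
  fixes n d :: nat and \<gamma> :: rat and w :: "nat \<Rightarrow> rat" and x :: mcurve
  assumes x: "x \<in> semistable n d \<gamma> w" and \<gamma>: "0 \<le> \<gamma>" and w: "\<And>i. i \<in> {1..n} \<Longrightarrow> 0 \<le> w i" and d: "2 \<le> d"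
begin

lemma semistable_on_axis:
  assumes i: "i \<in> {1..n}"
  obtains x' where "x' \<in> semistable n d \<gamma> w" "snd x' i $ 2 = 0" "snd x' i $ 3 = 0"
proof -
  have "snd x i \<noteq> 0" using semistable_multicone[OF x] i by (auto simp: multicone_def)
  then obtain g :: "complex ^ 3 ^ 3" where "det g = 1" "(g *v snd x i) $ 2 = 0" "(g *v snd x i) $ 3 = 0"
    by (rule SL_move_to_axis)
  then show thesis using i by (intro that[OF act_semistable[OF x, of g]]) (auto simp: act_def)
qed

text \<open>The curve passes through \<open>e3 1\<close>, so \<open>x^d\<close> is absent; the other
  monomials have weight at most \<open>2 (d - 1) - 1 = 2 d - 3\<close> for
  \<open>(2, -1, -1)\<close>.\<close>

lemma semistable_weight_bound_axis:
  assumes i: "i \<in> {1..n}"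
  shows "3 * w i \<le> (\<Sum>k=1..n. w k) + \<gamma> * (2 * of_nat d - 3)"
proof -
  obtain y where y: "y \<in> semistable n d \<gamma> w" "snd y i $ 2 = 0" "snd y i $ 3 = 0" using semistable_on_axis[OF i] by blast
  let ?r = "\<lambda>k :: 3. if k = 1 then 2 else - 1 :: int"
  have "of_int (3 - 2 * int d) * \<gamma> + (\<Sum>k=1..n. of_int (if k = i then 2 else - 1) * w k) \<le> 0"
  proof (rule hilbert_mumford[OF y(1) \<gamma> w, of ?r])
    show "3 - 2 * int d \<le> - (?r 1 * int k + ?r 2 * int j + ?r 3 * int (d - k - j))"
      if "k \<le> d" "j \<le> d - k" "form_coeff d (fst y) k j \<noteq> 0" for k j
    proof -
      have "k \<noteq> d" using that form_coeff_axis_zero[OF semistable_multicone[OF y(1)] i y(2,3)] by auto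
      then show ?thesis using that by (simp add: of_nat_diff)
    qed
    show "(if k = i then 2 else - 1) \<le> ?r l" if "k \<in> {1..n}" "snd y k $ l \<noteq> 0" for k l
      using that y(2,3) exhaust_3[of l] by auto
  qed simp_all
  moreover have "{k \<in> {1..n}. k = i} = {i}" using i by auto
  ultimately show ?thesis unfolding sum_if_const[OF finite_atLeastAtMost] by (simp add: algebra_simps)
qed

text \<open>With the tangent adapted, \<open>x^d\<close> and \<open>x^(d-1) z\<close> are absent;
  for the weights \<open>(1, -1, 0)\<close> the largest remaining value is \<open>d - 2\<close>,
  attained by \<open>x^(d-1) y\<close> and \<open>x^(d-2) z^2\<close>.\<close>

lemma semistable_weight_bound_tangent:
  assumes i: "i \<in> {1..n}"
  shows "2 * w i \<le> (\<Sum>k=1..n. w k) + \<gamma> * (of_nat d - 2)"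
proof -
  obtain z where z: "z \<in> semistable n d \<gamma> w" "snd z i $ 2 = 0" "snd z i $ 3 = 0" using semistable_on_axis[OF i] by blast
  have "fst z \<in> forms d" "1 \<le> d" using multicone_forms[OF semistable_multicone[OF z(1)]] d by auto
  then obtain g :: "complex ^ 3 ^ 3" where g: "det g = 1" "form_coeff d (\<lambda>v. fst z (matrix_inv g *v v)) (d - 1) 0 = 0"
    "\<And>v. v $ 2 = 0 \<Longrightarrow> v $ 3 = 0 \<Longrightarrow> g *v v = v" by (rule SL_adapt_tangent) (rule that)
  define y where "y = act n g z"
  have y: "y \<in> semistable n d \<gamma> w" unfolding y_def by (rule act_semistable[OF z(1) g(1)])
  have yi: "snd y i $ 2 = 0" "snd y i $ 3 = 0" using i z(2,3) g(3)[OF z(2,3)] by (simp_all add: y_def act_def)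
  have yf: "form_coeff d (fst y) (d - 1) 0 = 0" using g(2) by (simp add: y_def act_def)
  let ?r = "\<lambda>k :: 3. if k = 1 then 1 else if k = 2 then - 1 else 0 :: int"
  have "of_int (2 - int d) * \<gamma> + (\<Sum>k=1..n. of_int (if k = i then 1 else - 1) * w k) \<le> 0"
  proof (rule hilbert_mumford[OF y \<gamma> w, of ?r])
    show "2 - int d \<le> - (?r 1 * int k + ?r 2 * int j + ?r 3 * int (d - k - j))"
      if "k \<le> d" "j \<le> d - k" "form_coeff d (fst y) k j \<noteq> 0" for k j
    proof -
      have "k \<noteq> d" using that form_coeff_axis_zero[OF semistable_multicone[OF y] i yi] by auto
      moreover have "k = d - 1 \<longrightarrow> j \<noteq> 0" using that(3) yf by (intro impI notI) simp
      ultimately show ?thesis using that by auto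
    qed
    show "(if k = i then 1 else - 1) \<le> ?r l" if "k \<in> {1..n}" "snd y k $ l \<noteq> 0" for k l
      using that yi exhaust_3[of l] by auto
  qed simp_all
  moreover have "{k \<in> {1..n}. k = i} = {i}" using i by auto
  ultimately show ?thesis unfolding sum_if_const[OF finite_atLeastAtMost] by (simp add: algebra_simps)
qed

text \<open>Both points are moved onto the line \<open>z = 0\<close>, where the weights are 1; every
  monomial of degree \<open>d\<close> has weight at most \<open>d\<close> for
  \<open>(1, 1, -2)\<close>.\<close>

lemma semistable_weight_bound_pair:
  assumes i: "i \<in> {1..n}" and j: "j \<in> {1..n}" and ij: "i \<noteq> j"
  shows "3 * (w i + w j) \<le> 2 * (\<Sum>k=1..n. w k) + \<gamma> * of_nat d"
proof -
  obtain z where z: "z \<in> semistable n d \<gamma> w" "snd z i $ 2 = 0" "snd z i $ 3 = 0" using semistable_on_axis[OF i] by blast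
  obtain g :: "complex ^ 3 ^ 3" where g: "det g = 1" "(g *v snd z j) $ 3 = 0"
    "\<And>v. v $ 2 = 0 \<Longrightarrow> v $ 3 = 0 \<Longrightarrow> (g *v v) $ 3 = 0" by (rule SL_move_to_plane[of "snd z j"]) (rule that)
  define y where "y = act n g z"
  have y: "y \<in> semistable n d \<gamma> w" unfolding y_def by (rule act_semistable[OF z(1) g(1)])
  have yij: "snd y i $ 3 = 0" "snd y j $ 3 = 0" using i j g(2) g(3)[OF z(2,3)] by (simp_all add: y_def act_def)
  let ?r = "\<lambda>k :: 3. if k = 3 then - 2 else 1 :: int"
  have "of_int (- int d) * \<gamma> + (\<Sum>k=1..n. of_int (if k = i \<or> k = j then 1 else - 2) * w k) \<le> 0"
  proof (rule hilbert_mumford[OF y \<gamma> w, of ?r])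
    show "- int d \<le> - (?r 1 * int k + ?r 2 * int l + ?r 3 * int (d - k - l))" if "k \<le> d" "l \<le> d - k" for k l
      using that by (simp add: of_nat_diff)
    show "(if k = i \<or> k = j then 1 else - 2) \<le> ?r l" if "k \<in> {1..n}" "snd y k $ l \<noteq> 0" for k l
      using that yij by auto
  qed simp_all
  moreover have "{k \<in> {1..n}. k = i \<or> k = j} = {i, j}" using i j by auto
  ultimately show ?thesis unfolding sum_if_const[OF finite_atLeastAtMost] using ij by (simp add: algebra_simps)
qed

end

section \<open>The cone in degree at least two, and the low degrees\<close>

lemma git_cone_main:
  assumes d: "2 \<le> d"
  shows "(\<gamma>, w) \<in> git_cone n d \<longleftrightarrow> w \<in> {1..n} \<rightarrow>\<^sub>E UNIV \<and>
     (\<forall>i\<in>{1..n}. 3 * w i \<le> (\<Sum>k=1..n. w k) + \<gamma> * (2 * of_nat d - 3)) \<and>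
     (\<forall>i\<in>{1..n}. 2 * w i \<le> (\<Sum>k=1..n. w k) + \<gamma> * (of_nat d - 2)) \<and>
     (\<forall>i\<in>{1..n}. \<forall>j\<in>{1..n}. i \<noteq> j \<longrightarrow> 3 * (w i + w j) \<le> 2 * (\<Sum>k=1..n. w k) + \<gamma> * of_nat d) \<and>
     (\<forall>i\<in>{1..n}. 0 < w i) \<and> 0 < \<gamma>" (is "_ \<longleftrightarrow> _ \<and> ?c1 \<and> ?c2 \<and> ?c3 \<and> ?pos \<and> _")
proof
  assume "(\<gamma>, w) \<in> git_cone n d"
  then obtain x where w: "w \<in> {1..n} \<rightarrow>\<^sub>E UNIV" and am: "ample n d \<gamma> w" and x: "x \<in> semistable n d \<gamma> w"
    by (auto simp: git_cone_def)
  have \<gamma>: "0 < \<gamma>" and pos: "\<And>i. i \<in> {1..n} \<Longrightarrow> 0 < w i" using ample_pos[OF am] d by simp_all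
  have nn: "0 \<le> \<gamma>" "0 \<le> w i" if "i \<in> {1..n}" for i using \<gamma> pos[OF that] by simp_all
  have "0 \<le> \<gamma>" using \<gamma> by simp
  note le = semistable_weight_bound_axis[OF x this nn(2) d] semistable_weight_bound_tangent[OF x this nn(2) d]
    semistable_weight_bound_pair[OF x this nn(2) d]
  show "w \<in> {1..n} \<rightarrow>\<^sub>E UNIV \<and> ?c1 \<and> ?c2 \<and> ?c3 \<and> ?pos \<and> 0 < \<gamma>"
    by (intro conjI ballI impI le w \<gamma> pos)
next
  assume *: "w \<in> {1..n} \<rightarrow>\<^sub>E UNIV \<and> ?c1 \<and> ?c2 \<and> ?c3 \<and> ?pos \<and> 0 < \<gamma>"
  have "ample n d \<gamma> w" by (rule positive_ample) (use * in simp_all)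
  moreover have "arc_point n d \<in> semistable n d \<gamma> w"
  proof (rule S_cone[OF d])
    show "0 \<le> w i" if "i \<in> {1..n}" for i using * that by (simp add: less_imp_le)
  qed (use * in simp_all)
  ultimately show "(\<gamma>, w) \<in> git_cone n d" using * by (auto simp: git_cone_def)
qed

theorem theorem3p2:
  fixes n d :: nat
  assumes "2 \<le> d \<or> n \<in> {1, 2, 3}"
  shows "git_cone n d =
    {(\<gamma>, w). w \<in> {1..n} \<rightarrow>\<^sub>E UNIV \<and>
       (let W = (\<Sum>k=1..n. w k) in
         (\<forall>i\<in>{1..n}. w i \<le> (W + \<gamma> * (2 * of_nat d - 3)) / 3) \<and>
         (\<forall>i\<in>{1..n}. w i \<le> (W + \<gamma> * (of_nat d - 2)) / 2) \<and>
         (\<forall>i\<in>{1..n}. \<forall>j\<in>{1..n}. i \<noteq> j \<longrightarrow> w i + w j \<le> (2 * W + \<gamma> * of_nat d) / 3) \<and>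
         (\<forall>i\<in>{1..n}. 0 < w i) \<and> 0 < \<gamma>)}"
    (is "_ = ?C")
proof (cases "2 \<le> d")
  case True
  have div: "a \<le> b / 3 \<longleftrightarrow> 3 * a \<le> b" "a \<le> b / 2 \<longleftrightarrow> 2 * a \<le> b" for a b :: rat by linarith+
  show ?thesis
    by (rule set_eqI) (simp only: split_paired_all git_cone_main[OF True] mem_Collect_eq prod.case Let_def div)
next
  case False
  then have n: "n = 1 \<or> n = 2 \<or> n = 3" using assms by auto
  \<comment> \<open>In degree 0 a nonzero constant has no zero to mark; in degree 1 the relation
    \<open>2 * \<gamma> + W = 0\<close> contradicts positivity of ample classes.\<close>
  have "git_cone n d = {}"
  proof (cases "d = 0")
    case True
    then show ?thesis using git_cone_degree_0[of n] n by auto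
  next
    case d0: False
    then have d1: "d = 1" using False by simp
    have False if "(\<gamma>, w) \<in> git_cone n 1" for \<gamma> w
    proof -
      have "ample n 1 \<gamma> w" using that by (auto simp: git_cone_def)
      then have "0 < \<gamma>" "\<And>i. i \<in> {1..n} \<Longrightarrow> 0 < w i" using ample_pos by auto
      then have "0 < 2 * \<gamma> + (\<Sum>k=1..n. w k)" by (intro add_pos_nonneg sum_nonneg) (auto intro: less_imp_le)
      then show False using git_cone_degree_1[OF that] by simp
    qed
    then show ?thesis unfolding d1 by auto
  qed
  \<comment> \<open>For \<open>d \<le> 1\<close> the terms in \<gamma> of the first two families are
    at most \<open>- \<gamma>\<close>. Summing the second family over the points for
    \<open>n \<le> 2\<close>, and the first for \<open>n = 3\<close>, contradicts
    positivity.\<close>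
  moreover have "(\<gamma>, w) \<notin> ?C" for \<gamma> w
  proof
    define W where "W = (\<Sum>k=1..n. w k)"
    assume "(\<gamma>, w) \<in> ?C"
    then have c1: "\<forall>i\<in>{1..n}. w i \<le> (W + \<gamma> * (2 * of_nat d - 3)) / 3"
      and c2: "\<forall>i\<in>{1..n}. w i \<le> (W + \<gamma> * (of_nat d - 2)) / 2"
      and pos: "0 < \<gamma>" "\<forall>i\<in>{1..n}. 0 < w i" unfolding mem_Collect_eq prod.case Let_def W_def by blast+
    have d: "\<gamma> * (of_nat d - 2) \<le> - \<gamma>" "\<gamma> * (2 * of_nat d - 3) \<le> - \<gamma>"
    proof -
      have "(of_nat d :: rat) \<le> 1" using False by simp
      then have "\<gamma> * (of_nat d - 2) \<le> \<gamma> * (- 1)" "\<gamma> * (2 * of_nat d - 3) \<le> \<gamma> * (- 1)"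
        using pos(1) by (intro mult_left_mono; simp)+
      then show "\<gamma> * (of_nat d - 2) \<le> - \<gamma>" "\<gamma> * (2 * of_nat d - 3) \<le> - \<gamma>" by simp_all
    qed
    have "n \<noteq> 1"
    proof
      assume n: "n = 1"
      have "W = w 1" by (simp add: W_def n)
      then show False using bspec[OF c2, of 1] bspec[OF pos(2), of 1] pos(1) d n by simp
    qed
    moreover have "n \<noteq> 2"
    proof
      assume n: "n = 2"
      have "W = w 1 + w 2" by (simp add: W_def n eval_nat_numeral)
      then show False using bspec[OF c2, of 1] bspec[OF c2, of 2] pos(1) d n by simp
    qed
    moreover have "n \<noteq> 3"
    proof
      assume n: "n = 3"
      have "W = w 1 + w 2 + w 3" by (simp add: W_def n eval_nat_numeral)
      then show False using bspec[OF c1, of 1] bspec[OF c1, of 2] bspec[OF c1, of 3] pos(1) d n by simp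
    qed
    ultimately show False using n by blast
  qed
  ultimately show ?thesis by auto
qed

end
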